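(* Let $p$ be a constant with $1<p<\infty$ and let $w$ be a weight. Then $w\in B_p$ if and only if there exist $w_1,w_2\in B_1$ such that $w=w_1w_2^{1-p}$.
   Context: $\mathbb B$ unit ball of $\mathbb C^n$, $\alpha>0$, $d\mu_\alpha(z)=(1-|z|^2)^{\alpha-1}d\mu(z)$. Pseudo-distance $d(z,\zeta)=\big||z|-|\zeta|\big|+\big|1-\frac{\langle z,\zeta\rangle}{|z||\zeta|}\big|$ ($z,\zeta\ne0$), $d(z,\zeta)=|z|+|\zeta|$ otherwise; pseudo-balls $B(z,r)=\{\zeta:d(z,\zeta)<r\}$; $\mathcal B$ = pseudo-balls $B(z,r)$ with $r>1-|z|$. A weight is a non-negative locally integrable function on $\mathbb B$. $m_\alpha f(z)=\sup_{B\in\mathcal B}\frac{\chi_B(z)}{\mu_\alpha(B)}\int_B|f|d\mu_\alpha$. $w\in B_p$ iff $\sup_{B\in\mathcal B}\big(\frac1{\mu_\alpha(B)}\int_Bw\,d\mu_\alpha\big)\big(\frac1{\mu_\alpha(B)}\int_Bw^{-1/(p-1)}d\mu_\alpha\big)^{p-1}<\infty$. $w\in B_1$ iff $[w]_{B_1}:=\operatorname{ess\,sup}_{z\in\mathbb B}\frac{m_\alpha w(z)}{w(z)}<\infty$. *)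

theory Defs
  imports "HOL-Analysis.Analysis"
begin

text \<open>The unit ball of C^n is ball 0 1 in the type complex^'n (n = CARD('n)).
 mu is Lebesgue measure on complex^'n (identified with R^(2n)).\<close>

definition cinner :: "complex^'n \<Rightarrow> complex^'n \<Rightarrow> complex" where
  "cinner z w = (\<Sum>i\<in>UNIV. z $ i * cnj (w $ i))"

definition pdist :: "complex^'n \<Rightarrow> complex^'n \<Rightarrow> real" where
  "pdist z w = (if z \<noteq> 0 \<and> w \<noteq> 0
      then \<bar>norm z - norm w\<bar> + cmod (1 - cinner z w / complex_of_real (norm z * norm w))
      else norm z + norm w)"

definition pball :: "complex^'n \<Rightarrow> real \<Rightarrow> (complex^'n) set" where
  "pball z r = {w \<in> ball 0 1. pdist z w < r}"

definition pballs :: "(complex^'n) set set" where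
  "pballs = {pball z r | z r. z \<in> ball 0 1 \<and> r > 1 - norm z}"

definition mu_alpha :: "real \<Rightarrow> (complex^'n) measure" where
  "mu_alpha a = density lebesgue
     (\<lambda>z. indicator (ball 0 1) z * ennreal ((1 - (norm z)\<^sup>2) powr (a - 1)))"

definition weight :: "(complex^'n \<Rightarrow> real) \<Rightarrow> bool" where
  "weight w \<longleftrightarrow> set_borel_measurable lebesgue (ball 0 1) w
     \<and> (\<forall>z\<in>ball 0 1. 0 \<le> w z)
     \<and> (\<forall>K. compact K \<and> K \<subseteq> ball 0 1 \<longrightarrow> set_integrable lebesgue K w)"

definition avg :: "real \<Rightarrow> (complex^'n) set \<Rightarrow> (complex^'n \<Rightarrow> ennreal) \<Rightarrow> ennreal" where
  "avg a B f = (\<integral>\<^sup>+ z \<in> B. f z \<partial>mu_alpha a) / emeasure (mu_alpha a) B"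

definition max_alpha :: "real \<Rightarrow> (complex^'n \<Rightarrow> real) \<Rightarrow> complex^'n \<Rightarrow> ennreal" where
  "max_alpha a f z = (SUP B\<in>pballs. indicator B z * avg a B (\<lambda>x. ennreal \<bar>f x\<bar>))"

text \<open>x^q for x in [0,infinity], q > 0.\<close>
definition epow :: "ennreal \<Rightarrow> real \<Rightarrow> ennreal" where
  "epow x q = (if x = top then top else ennreal (enn2real x powr q))"

text \<open>w^(-1/(p-1)) as an extended nonnegative function (0^(negative) = infinity).\<close>
definition dual_w :: "real \<Rightarrow> (complex^'n \<Rightarrow> real) \<Rightarrow> complex^'n \<Rightarrow> ennreal" where
  "dual_w p w z = (if w z = 0 then top else ennreal (w z powr (- 1 / (p - 1))))"

definition Bp :: "real \<Rightarrow> real \<Rightarrow> (complex^'n \<Rightarrow> real) \<Rightarrow> bool" where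
  "Bp a p w \<longleftrightarrow>
     (SUP B\<in>pballs. avg a B (\<lambda>z. ennreal (w z)) * epow (avg a B (dual_w p w)) (p - 1)) < top"

definition B1_const :: "real \<Rightarrow> (complex^'n \<Rightarrow> real) \<Rightarrow> ennreal" where
  "B1_const a w = Inf {C. AE z in mu_alpha a. z \<in> ball 0 1 \<longrightarrow> max_alpha a w z / ennreal (w z) \<le> C}"

definition B1 :: "real \<Rightarrow> (complex^'n \<Rightarrow> real) \<Rightarrow> bool" where
  "B1 a w \<longleftrightarrow> B1_const a w < top"

end

theory Submission
  imports Defs
begin

text \<open>If \<open>w = w1 * w2 powr (1 - p)\<close>, the averages of \<open>w\<close> and of its dual weight are
  controlled by bounding \<open>w2\<close> and \<open>w1\<close> below by their averages. Conversely, a \<open>B_p\<close> weight \<open>w\<close>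
  and its dual \<open>\<sigma>\<close> give doubling measures on the pseudo-balls, so the maximal operators
  taken with respect to \<open>w\<close> and \<open>\<sigma>\<close> are bounded by Vitali covering, and Lerner's pointwise
  inequality yields boundedness of \<open>m_alpha\<close> on \<open>L^p(w)\<close> and on \<open>L^q(\<sigma>)\<close>, where \<open>1/p + 1/q = 1\<close>. A fixed-point iteration then
  produces \<open>\<eta> \<ge> 1\<close> in \<open>L^p(w)\<close> such that \<open>w2 = \<eta>\<close> and \<open>w1 = w * \<eta> powr (p - 1)\<close> are
  \<open>B_1\<close> weights.\<close>

section \<open>Powers of extended nonnegative reals\<close>

text \<open>The family has one decisive feature: if \<open>r > 1 - norm z\<close>, then every larger
  radius is admissible too. Hence the tenfold pseudo-ball of the covering argument is again in the
  family, and so is the whole unit ball. The first fact turns the \<open>Bp\<close> condition into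
  doubling of \<open>w\<close> and \<open>\<sigma>\<close>; the second makes their total masses
  finite, so that the constant 1 lies in L^p(w) and can start the iteration. Two defects are treated
  apart. The quasi-triangle inequality breaks at the origin, but small pseudo-balls of the family
  avoid it and large ones grow to the whole ball. A weight vanishing almost everywhere is in
  \<open>Bp\<close> because \<open>0 * top = 0\<close>, although its dual weight is almost
  everywhere infinite; it is factored with \<open>w2 = 1\<close>.\<close>

lemma epow_ennreal [simp]: "0 \<le> x \<Longrightarrow> epow (ennreal x) q = ennreal (x powr q)"
  by (simp add: epow_def)

lemma epow_top [simp]: "epow top q = top"
  by (simp add: epow_def)

lemma epow_0 [simp]: "epow 0 q = 0"
  by (simp add: epow_def)

lemma epow_1 [simp]: "epow 1 q = 1"
  by (simp add: epow_def)

lemma epow_one [simp]: "epow x 1 = x"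
  by (cases x) auto

lemma epow_eq_top_iff [simp]: "epow x q = top \<longleftrightarrow> x = top"
  by (simp add: epow_def)

lemma epow_eq_0_iff [simp]: "epow x q = 0 \<longleftrightarrow> x = 0"
  by (cases x) auto

lemma epow_less_top_iff [simp]: "epow x q < top \<longleftrightarrow> x < top"
  by (simp add: less_top[symmetric])

lemma epow_mono: "x \<le> y \<Longrightarrow> 0 \<le> q \<Longrightarrow> epow x q \<le> epow y q"
  by (cases x; cases y) (auto intro!: ennreal_leI powr_mono2 simp: top_unique)

lemma epow_epow: "epow (epow x q) r = epow x (q * r)"
  by (cases x) (auto simp: powr_powr)

lemma epow_le_iff: "0 < q \<Longrightarrow> epow x q \<le> epow y q \<longleftrightarrow> x \<le> y"
  using epow_mono[of x y q] epow_mono[of "epow x q" "epow y q" "1/q"] by (auto simp: epow_epow)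

text \<open>For a positive exponent \<open>epow\<close> is an order isomorphism; this adjoint form
  moves a power across a supremum or to the other side of a pointwise bound.\<close>

lemma epow_le_iff_le_epow: "0 < q \<Longrightarrow> epow x q \<le> y \<longleftrightarrow> x \<le> epow y (1/q)"
  using epow_le_iff[of q x "epow y (1/q)"] by (simp add: epow_epow)

lemma epow_mult: "epow (x * y) q = epow x q * epow y q"
proof (cases x)
  case (real a)
  show ?thesis
    by (cases y; cases "a = 0")
       (auto simp: real powr_mult ennreal_mult_top simp flip: ennreal_mult)
next
  case top
  then show ?thesis by (simp add: ennreal_top_mult)
qed

lemma epow_inverse: "0 < x \<Longrightarrow> x < top \<Longrightarrow> epow (inverse x) q = inverse (epow x q)"
  by (cases x) (auto simp: inverse_ennreal powr_minus inverse_powr)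

lemma epow_divide: "0 < y \<Longrightarrow> y < top \<Longrightarrow> epow (x / y) q = epow x q / epow y q"
  by (simp add: divide_ennreal_def epow_mult epow_inverse)

lemma epow_add: "epow x q * epow x r = epow x (q + r)"
  by (cases x) (auto simp: powr_add simp flip: ennreal_mult)

lemma epow_plus_le:
  assumes "0 \<le> q"
  shows "epow (x + y) q \<le> ennreal (2 powr q) * (epow x q + epow y q)"
proof -
  have "x + y \<le> 2 * max x y"
    by (simp add: max_def mult_2 add_mono)
  then have "epow (x + y) q \<le> epow (2 * max x y) q"
    using assms by (rule epow_mono)
  also have "\<dots> = ennreal (2 powr q) * epow (max x y) q"
    using epow_ennreal[of 2 q] by (simp add: epow_mult del: epow_ennreal)
  also have "epow (max x y) q \<le> epow x q + epow y q"
    by (simp add: max_def)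
  finally show ?thesis
    by (simp add: mult_left_mono)
qed

lemma epow_measurable [measurable]:
  assumes [measurable]: "f \<in> borel_measurable M"
  shows "(\<lambda>x. epow (f x) q) \<in> borel_measurable M"
  unfolding epow_def by measurable

lemma epow_SUP:
  assumes "0 < q" "I \<noteq> {}"
  shows "epow (SUP i\<in>I. f i) q = (SUP i\<in>I. epow (f i) q)"
proof (rule antisym)
  show "epow (SUP i\<in>I. f i) q \<le> (SUP i\<in>I. epow (f i) q)"
    unfolding epow_le_iff_le_epow[OF assms(1)]
    by (rule SUP_least) (auto simp: epow_le_iff_le_epow[OF assms(1), symmetric] intro: SUP_upper)
  show "(SUP i\<in>I. epow (f i) q) \<le> epow (SUP i\<in>I. f i) q"
    using assms by (intro SUP_least epow_mono SUP_upper) auto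
qed

section \<open>Young and Hoelder inequalities for extended nonnegative functions\<close>

lemma ennreal_Youngs:
  fixes a b :: ennreal
  assumes "1 < p" "1 < q" "1/p + 1/q = 1"
  shows "a * b \<le> epow a p * ennreal (1/p) + epow b q * ennreal (1/q)"
proof (cases "a = top \<or> b = top")
  case True
  then show ?thesis
    using assms by (auto simp: ennreal_top_mult ennreal_mult_top)
next
  case False
  then obtain x y where "a = ennreal x" "0 \<le> x" "b = ennreal y" "0 \<le> y"
    by (metis ennreal_cases)
  then show ?thesis
    using Youngs_inequality[of p q x y] assms
    by (simp flip: ennreal_mult ennreal_plus)
qed

lemma nn_integral_Holder:
  assumes [measurable]: "f \<in> borel_measurable M" "g \<in> borel_measurable M"
    and pq: "1 < p" "1 < q" "1/p + 1/q = 1"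
  shows "(\<integral>\<^sup>+x. f x * g x \<partial>M) \<le> epow (\<integral>\<^sup>+x. epow (f x) p \<partial>M) (1/p) * epow (\<integral>\<^sup>+x. epow (g x) q \<partial>M) (1/q)"
    (is "_ \<le> epow ?F (1/p) * epow ?G (1/q)")
proof -
  consider "?F = 0 \<or> ?G = 0" | "?F \<noteq> 0" "?G \<noteq> 0" "?F = top \<or> ?G = top"
    | "0 < ?F" "?F < top" "0 < ?G" "?G < top"
    unfolding less_top[symmetric] zero_less_iff_neq_zero by blast
  then show ?thesis
  proof cases
    \<comment> \<open>A vanishing norm has to be settled before an infinite one: the right side may
      read \<open>0 * top = 0\<close>, and the left side is then 0 as well because the product
      vanishes almost everywhere.\<close>
    case 1
    then have "AE x in M. f x * g x = 0"
      by (auto simp: nn_integral_0_iff_AE elim: eventually_mono)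
    then have "(\<integral>\<^sup>+x. f x * g x \<partial>M) = 0"
      by (subst nn_integral_0_iff_AE) simp_all
    then show ?thesis
      by simp
  next
    case 2
    then show ?thesis by (auto simp: ennreal_top_mult ennreal_mult_top)
  next
    case 3
    \<comment> \<open>Dividing by the two norms reduces the claim to factors of norm 1, where
      integrating Young's inequality gives 1/p + 1/q = 1.\<close>
    define \<phi> where "\<phi> = epow ?F (1/p)"
    define \<gamma> where "\<gamma> = epow ?G (1/q)"
    have fin: "0 < \<phi>" "\<phi> < top" "0 < \<gamma>" "\<gamma> < top"
      using 3 by (auto simp: \<phi>_def \<gamma>_def zero_less_iff_neq_zero)
    have F: "epow \<phi> p = ?F" and G: "epow \<gamma> q = ?G"
      using pq by (simp_all add: \<phi>_def \<gamma>_def epow_epow)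
    have "(\<integral>\<^sup>+x. (f x / \<phi>) * (g x / \<gamma>) \<partial>M)
        \<le> (\<integral>\<^sup>+x. epow (f x / \<phi>) p * ennreal (1/p) + epow (g x / \<gamma>) q * ennreal (1/q) \<partial>M)"
      by (intro nn_integral_mono ennreal_Youngs pq)
    also have "\<dots> = (\<integral>\<^sup>+x. epow (f x) p / ?F * ennreal (1/p) + epow (g x) q / ?G * ennreal (1/q) \<partial>M)"
      by (simp add: epow_divide fin F G)
    also have "\<dots> = ?F / ?F * ennreal (1/p) + ?G / ?G * ennreal (1/q)"
      by (simp add: nn_integral_add nn_integral_multc nn_integral_divide)
    also have "\<dots> = 1"
      using 3 pq by (simp flip: ennreal_plus)
    finally have le: "(\<integral>\<^sup>+x. (f x / \<phi>) * (g x / \<gamma>) \<partial>M) \<le> 1" .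
    have inv: "\<phi> * \<gamma> * inverse (\<phi> * \<gamma>) = 1"
      using fin by (metis divide_ennreal_def ennreal_divide_self ennreal_mult_eq_top_iff
          ennreal_zero_less_mult_iff less_irrefl less_top)
    have *: "f x * g x = \<phi> * \<gamma> * ((f x / \<phi>) * (g x / \<gamma>))" for x
    proof -
      have "\<phi> * \<gamma> * ((f x / \<phi>) * (g x / \<gamma>)) = f x * g x * (\<phi> * \<gamma> * inverse (\<phi> * \<gamma>))"
        using fin by (simp add: divide_ennreal_def ennreal_inverse_mult ac_simps)
      then show ?thesis by (simp add: inv)
    qed
    have "(\<integral>\<^sup>+x. f x * g x \<partial>M) = \<phi> * \<gamma> * (\<integral>\<^sup>+x. (f x / \<phi>) * (g x / \<gamma>) \<partial>M)"
      by (subst *, subst nn_integral_cmult) auto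
    also have "\<dots> \<le> \<phi> * \<gamma> * 1"
      by (rule mult_left_mono[OF le]) auto
    finally show ?thesis
      by (simp add: \<phi>_def \<gamma>_def)
  qed
qed

section \<open>Maximal operators over an engulfing family\<close>

text \<open>Upper half of a discrete layer-cake formula: the terms switched on at \<open>x\<close>
  form a geometric progression with ratio \<open>2 powr s\<close>, which is controlled by its last
  term, and that term is below \<open>x\<close> to the power \<open>s\<close>.\<close>

lemma suminf_dyadic_le:
  assumes s: "0 < s"
  shows "(\<Sum>k. ennreal (2 powr (real k * s)) * indicator {y. ennreal (2 ^ k) < y} x)
    \<le> ennreal (2 powr s / (2 powr s - 1)) * epow x s" (is "suminf ?f \<le> ennreal ?C * _")
proof (cases x)
  case (real r)
  define u where "u = (2::real) powr s"
  have u: "1 < u"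
    using s by (simp add: u_def)
  have pw: "2 powr (real k * s) = u ^ k" for k
    by (simp add: u_def powr_powr[symmetric] powr_realpow mult.commute)
  have "(\<Sum>k<n. ?f k) \<le> ennreal ?C * epow x s" for n
  proof (induction n)
    case (Suc n)
    show ?case
    proof (cases "2 ^ n < r")
      case True
      \<comment> \<open>The whole sum is at most \<open>u / (u - 1)\<close> times its last power;
        the induction hypothesis serves only when the last term is switched off.\<close>
      have "(\<Sum>k<Suc n. ?f k) \<le> (\<Sum>k<Suc n. ennreal (u ^ k))"
        by (intro sum_mono) (auto simp: pw indicator_def)
      also have "\<dots> = ennreal (\<Sum>k<Suc n. u ^ k)"
        using u by (intro sum_ennreal) auto
      also have "(\<Sum>k<Suc n. u ^ k) = (u ^ Suc n - 1) / (u - 1)"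
        using u by (intro geometric_sum) auto
      also have "\<dots> \<le> u / (u - 1) * u ^ n"
        using u by (simp add: divide_right_mono)
      also have "u ^ n = (2 ^ n) powr s"
        by (simp add: pw[symmetric] powr_powr powr_realpow[symmetric])
      also have "u / (u - 1) * (2 ^ n) powr s \<le> u / (u - 1) * r powr s"
        using u s True by (intro mult_left_mono powr_mono2) auto
      finally show ?thesis
        using real u by (simp add: u_def[symmetric] ennreal_mult[symmetric] ennreal_leI)
    next
      case False
      then have "?f n = 0"
        using real by (simp add: indicator_def ennreal_less_iff)
      then show ?thesis
        using Suc.IH by simp
    qed
  qed simp
  then show ?thesis
    by (simp add: suminf_eq_SUP SUP_least)
next
  case top
  moreover have "0 < 2 powr s / (2 powr s - 1)"
    using s by simp
  then have "ennreal ?C * top = top"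
    by (intro ennreal_top_mult_left) (simp only: ennreal_eq_0_iff not_le)
  ultimately show ?thesis
    by simp
qed

text \<open>Lower half of the layer-cake formula: for x between 2^(k+1) and 2^(k+2) the term of
  index k alone dominates. Values up to 2 go into the constant, which later costs the total
  mass.\<close>

lemma epow_le_suminf_dyadic:
  assumes q: "0 < q"
  shows "epow x q \<le> ennreal (2 powr q) +
    (\<Sum>k. ennreal (2 powr ((real k + 2) * q)) * indicator {y. ennreal (2 ^ (k + 1)) < y} x)"
    (is "_ \<le> _ + suminf ?f")
proof (cases x)
  case (real r)
  show ?thesis
  proof (cases "r \<le> 2")
    case True
    then have "epow x q \<le> ennreal (2 powr q)"
      using q real by (simp add: powr_mono2 ennreal_leI)
    then show ?thesis by (meson add_increasing2 zero_le)
  next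
    case False
    define N where "N = (LEAST n. r \<le> 2 ^ n)"
    have ex: "\<exists>n. r \<le> 2 ^ n"
      using real_arch_pow[of 2 r] by (auto intro: less_imp_le)
    have N: "r \<le> 2 ^ N"
      unfolding N_def using ex by (rule LeastI_ex)
    have "N \<noteq> 0" "N \<noteq> 1"
      using N False by (auto intro!: Nat.gr0I)
    then obtain k where k: "N = k + 2"
      by (metis One_nat_def add_2_eq_Suc' not0_implies_Suc)
    have "\<not> r \<le> 2 ^ (k + 1)"
      unfolding k using not_less_Least[of "k + 1" "\<lambda>n. r \<le> 2 ^ n"] by (simp add: N_def[symmetric] k)
    then have fk: "?f k = ennreal (2 powr ((real k + 2) * q))"
      by (simp add: real indicator_def ennreal_less_iff)
    have "r powr q \<le> (2 ^ N) powr q"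
      using N real q by (intro powr_mono2) auto
    moreover have "(2 ^ N) powr q = (2::real) powr ((real k + 2) * q)"
    proof -
      have "(2::real) ^ N = 2 powr (real k + 2)"
        using powr_realpow[of 2 N] by (simp add: k add.commute)
      then show ?thesis
        by (simp only: powr_powr)
    qed
    ultimately have le: "epow x q \<le> ennreal (2 powr ((real k + 2) * q))"
      using real by (simp add: ennreal_leI)
    have "epow x q \<le> ?f k"
      using le fk by simp
    also have "?f k \<le> suminf ?f"
      using ennreal_suminf_lessD[of ?f "?f k" k] by (meson not_le less_irrefl)
    finally show ?thesis
      by (meson add_increasing zero_le)
  qed
next
  case top
  \<comment> \<open>At \<open>x = top\<close> all terms are switched on, and each is at least
    1.\<close>
  have "of_nat n \<le> suminf ?f" for n
  proof -
    have "of_nat n = (\<Sum>k<n. 1::ennreal)"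
      by simp
    also have "\<dots> \<le> (\<Sum>k<n. ?f k)"
      using q by (intro sum_mono) (auto simp: top indicator_def ge_one_powr_ge_zero)
    also have "\<dots> \<le> suminf ?f"
      by (rule sum_le_suminf) auto
    finally show ?thesis .
  qed
  then have "suminf ?f = top"
    using ennreal_Ex_less_of_nat[of "suminf ?f"] by (meson less_top not_le)
  then show ?thesis by simp
qed

text \<open>Balls are indexed because one set can be a pseudo-ball for several centres and radii;
  \<open>rad\<close> only has to order them for the covering argument. \<open>Lindelof_basis\<close>
  stands in for openness, which can fail for pseudo-balls at the origin: it gives measurability of
  maximal functions and reduces unions to countable ones.\<close>

locale ball_basis =
  fixes M :: "'a measure" and I :: "'i set" and B B' :: "'i \<Rightarrow> 'a set" and rad :: "'i \<Rightarrow> real"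
  assumes B_sets [measurable]: "i \<in> I \<Longrightarrow> B i \<in> sets M"
    and B'_sets [measurable]: "i \<in> I \<Longrightarrow> B' i \<in> sets M"
    and engulf: "i \<in> I \<Longrightarrow> j \<in> I \<Longrightarrow> rad j \<le> rad i \<Longrightarrow> B i \<inter> B j \<noteq> {} \<Longrightarrow> B j \<subseteq> B' i"
    and Lindelof_basis: "J \<subseteq> I \<Longrightarrow> \<exists>J0\<subseteq>J. countable J0 \<and> (\<Union>j\<in>J0. B j) = (\<Union>j\<in>J. B j)"
begin

text \<open>Greedy selection: take a ball of maximal radius, drop all balls that meet it, since
  \<open>engulf\<close> puts them into its enlargement, and continue with the rest.\<close>

lemma finite_Vitali:
  assumes "finite F" "F \<subseteq> I"
  shows "\<exists>G\<subseteq>F. disjoint_family_on B G \<and> (\<Union>i\<in>F. B i) \<subseteq> (\<Union>i\<in>G. B' i)"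
  using assms
proof (induction F rule: finite_psubset_induct)
  case (psubset F)
  show ?case
  proof (cases "F = {}")
    case False
    obtain i where i: "i \<in> F" "\<And>j. j \<in> F \<Longrightarrow> rad j \<le> rad i"
      using obtains_MAX[OF psubset.hyps(1) False, of rad] Max_ge[OF finite_imageI[OF psubset.hyps(1)]]
      by (metis imageI)
    define F' where "F' = {j \<in> F - {i}. B i \<inter> B j = {}}"
    have "F' \<subset> F" "F' \<subseteq> I"
      using i psubset.prems by (auto simp: F'_def)
    from psubset.IH[OF this] obtain G where G: "G \<subseteq> F'" "disjoint_family_on B G"
        "(\<Union>j\<in>F'. B j) \<subseteq> (\<Union>j\<in>G. B' j)"
      by blast
    have "B j \<subseteq> B' i" if "j \<in> F" "j \<notin> F'" for j
      using engulf[of i j] i that psubset.prems by (auto simp: F'_def)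
    then have "(\<Union>j\<in>F. B j) \<subseteq> (\<Union>j\<in>insert i G. B' j)"
      using G(3) by blast
    moreover have "disjoint_family_on B (insert i G)"
      using G(1,2) by (auto simp: disjoint_family_on_def F'_def)
    moreover have "insert i G \<subseteq> F"
      using G(1) i(1) by (auto simp: F'_def)
    ultimately show ?thesis by blast
  qed (simp add: disjoint_family_on_def)
qed

text \<open>The measure is a parameter because the same balls are averaged with respect to
  \<open>M\<close>, \<open>density M w\<close> and \<open>density M \<sigma>\<close>.\<close>

definition average :: "'a measure \<Rightarrow> ('a \<Rightarrow> ennreal) \<Rightarrow> 'i \<Rightarrow> ennreal" where
  "average \<nu> f i = (\<integral>\<^sup>+y\<in>B i. f y \<partial>\<nu>) / emeasure \<nu> (B i)"

definition maxop :: "'a measure \<Rightarrow> ('a \<Rightarrow> ennreal) \<Rightarrow> 'a \<Rightarrow> ennreal" where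
  "maxop \<nu> f x = (SUP i\<in>I. indicator (B i) x * average \<nu> f i)"

lemma average_le_maxop: "i \<in> I \<Longrightarrow> x \<in> B i \<Longrightarrow> average \<nu> f i \<le> maxop \<nu> f x"
  unfolding maxop_def by (rule SUP_upper2[of i]) auto

lemma maxop_le_iff: "maxop \<nu> f x \<le> c \<longleftrightarrow> (\<forall>i\<in>I. x \<in> B i \<longrightarrow> average \<nu> f i \<le> c)"
  unfolding maxop_def by (auto simp: SUP_le_iff indicator_def)

lemma maxop_superlevel: "{x. t < maxop \<nu> f x} = (\<Union>i\<in>{i\<in>I. t < average \<nu> f i}. B i)"
  by (auto simp: maxop_def less_SUP_iff indicator_def split: if_splits)

lemma Union_basis_sets:
  assumes "J \<subseteq> I"
  shows "(\<Union>j\<in>J. B j) \<in> sets M"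
proof -
  obtain J0 where J0: "J0 \<subseteq> J" "countable J0" "(\<Union>j\<in>J0. B j) = (\<Union>j\<in>J. B j)"
    using Lindelof_basis[OF assms] by blast
  have "(\<Union>j\<in>J0. B j) \<in> sets M"
    using J0(1,2) assms by (intro sets.countable_UN') auto
  then show ?thesis
    by (simp only: J0(3))
qed

lemma maxop_measurable [measurable]: "maxop \<nu> f \<in> borel_measurable M"
proof (rule borel_measurableI_greater)
  fix t
  have "{x. t < maxop \<nu> f x} \<in> sets M"
    unfolding maxop_superlevel by (rule Union_basis_sets) auto
  moreover from sets.sets_into_space[OF this]
  have "{x \<in> space M. t < maxop \<nu> f x} = {x. t < maxop \<nu> f x}" by auto
  ultimately show "{x \<in> space M. t < maxop \<nu> f x} \<in> sets M" by simp
qed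

lemma maxop_mono: "(\<And>x. f x \<le> g x) \<Longrightarrow> maxop \<nu> f x \<le> maxop \<nu> g x"
  unfolding maxop_def average_def
  by (intro SUP_mono' mult_left_mono divide_right_mono_ennreal nn_integral_mono mult_right_mono) auto

text \<open>Monotone convergence in each average, followed by an exchange of suprema. This
  continuity lets the fixed-point iteration pass to its limit.\<close>

lemma maxop_SUP:
  assumes "incseq f" "\<And>n. f n \<in> borel_measurable M" "sets \<nu> = sets M"
  shows "maxop \<nu> (\<lambda>x. SUP n. f n x) x = (SUP n. maxop \<nu> (f n) x)"
proof -
  have "average \<nu> (\<lambda>x. SUP n. f n x) i = (SUP n. average \<nu> (f n) i)" if "i \<in> I" for i
  proof -
    note assms(3)[measurable_cong] assms(2)[measurable] that[measurable]
    have "(\<integral>\<^sup>+y\<in>B i. (SUP n. f n y) \<partial>\<nu>) = (\<integral>\<^sup>+y. (SUP n. f n y * indicator (B i) y) \<partial>\<nu>)"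
      by (simp add: SUP_mult_right_ennreal)
    also have "\<dots> = (SUP n. \<integral>\<^sup>+y\<in>B i. f n y \<partial>\<nu>)"
      using assms(1) by (intro nn_integral_monotone_convergence_SUP)
        (auto simp: incseq_def le_fun_def intro!: mult_right_mono)
    finally show ?thesis
      by (simp add: average_def SUP_divide_ennreal)
  qed
  then show ?thesis
    unfolding maxop_def by (subst SUP_commute) (simp add: SUP_mult_left_ennreal)
qed

text \<open>Finitely many balls with average above \<open>t\<close> are covered by enlargements of
  disjoint ones, and over disjoint balls the integrals of \<open>f\<close> add up to at most the
  whole integral. The general case exhausts a countable subcover.\<close>

lemma weak_type:
  assumes sets_eq [measurable_cong]: "sets \<nu> = sets M"
    and doubling: "\<And>i. i \<in> I \<Longrightarrow> emeasure \<nu> (B' i) \<le> D * emeasure \<nu> (B i)"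
    and f [measurable]: "f \<in> borel_measurable M"
  shows "t * emeasure \<nu> {x. t < maxop \<nu> f x} \<le> D * (\<integral>\<^sup>+x. f x \<partial>\<nu>)"
proof -
  define J where "J = {i\<in>I. t < average \<nu> f i}"
  have tB: "t * emeasure \<nu> (B i) \<le> (\<integral>\<^sup>+y\<in>B i. f y \<partial>\<nu>)" if "i \<in> J" for i
  proof -
    have *: "t < (\<integral>\<^sup>+y\<in>B i. f y \<partial>\<nu>) / emeasure \<nu> (B i)"
      using that by (simp add: J_def average_def)
    then have "emeasure \<nu> (B i) \<noteq> top"
      by auto
    moreover have "t * emeasure \<nu> (B i) \<le> (\<integral>\<^sup>+y\<in>B i. f y \<partial>\<nu>) / emeasure \<nu> (B i) * emeasure \<nu> (B i)"
      using * by (intro mult_right_mono) auto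
    ultimately show ?thesis
      by (cases "emeasure \<nu> (B i) = 0")
        (auto simp: less_top ennreal_divide_times)
  qed
  have finite_case: "t * emeasure \<nu> (\<Union>i\<in>F. B i) \<le> D * (\<integral>\<^sup>+x. f x \<partial>\<nu>)" if F: "finite F" "F \<subseteq> J" for F
  proof -
    obtain G where G: "G \<subseteq> F" "disjoint_family_on B G" "(\<Union>i\<in>F. B i) \<subseteq> (\<Union>i\<in>G. B' i)"
      using finite_Vitali[of F] F by (auto simp: J_def)
    have GI: "G \<subseteq> I" and fG: "finite G"
      using G(1) F by (auto simp: J_def intro: finite_subset)
    have "emeasure \<nu> (\<Union>i\<in>F. B i) \<le> emeasure \<nu> (\<Union>i\<in>G. B' i)"
      using G(3) GI fG by (intro emeasure_mono) (auto simp: sets_eq intro!: sets.finite_UN)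
    also have "\<dots> \<le> (\<Sum>i\<in>G. emeasure \<nu> (B' i))"
      using fG GI by (intro emeasure_subadditive_finite) (auto simp: sets_eq)
    also have "\<dots> \<le> (\<Sum>i\<in>G. D * emeasure \<nu> (B i))"
      using GI by (intro sum_mono doubling) auto
    finally have "t * emeasure \<nu> (\<Union>i\<in>F. B i) \<le> t * (\<Sum>i\<in>G. D * emeasure \<nu> (B i))"
      by (rule mult_left_mono) simp
    also have "\<dots> = D * (\<Sum>i\<in>G. t * emeasure \<nu> (B i))"
      by (simp add: sum_distrib_left ac_simps)
    also have "(\<Sum>i\<in>G. t * emeasure \<nu> (B i)) \<le> (\<Sum>i\<in>G. \<integral>\<^sup>+y\<in>B i. f y \<partial>\<nu>)"
      using G(1) F(2) by (intro sum_mono tB) auto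
    also have "\<dots> = (\<integral>\<^sup>+y. (\<Sum>i\<in>G. f y * indicator (B i) y) \<partial>\<nu>)"
      using GI by (intro nn_integral_sum[symmetric]) auto
    also have "\<dots> \<le> (\<integral>\<^sup>+y. f y \<partial>\<nu>)"
    proof (intro nn_integral_mono)
      fix y
      have "(\<Sum>i\<in>G. f y * indicator (B i) y) = f y * indicator (\<Union>i\<in>G. B i) y"
        by (simp add: indicator_UN_disjoint[OF fG G(2)] sum_distrib_left)
      also have "\<dots> \<le> f y"
        by (simp add: indicator_def)
      finally show "(\<Sum>i\<in>G. f y * indicator (B i) y) \<le> f y" .
    qed
    finally show ?thesis
      by (simp add: mult_left_mono)
  qed
  obtain J0 where J0: "J0 \<subseteq> J" "countable J0" "(\<Union>j\<in>J0. B j) = (\<Union>j\<in>J. B j)"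
    using Lindelof_basis[of J] by (auto simp: J_def)
  show ?thesis
  proof (cases "J0 = {}")
    case True
    then show ?thesis
      using J0(3) by (simp add: maxop_superlevel J_def[symmetric])
  next
    case False
    define F where "F n = from_nat_into J0 ` {..n}" for n :: nat
    define A where "A n = (\<Union>i\<in>F n. B i)" for n
    have F: "finite (F n)" "F n \<subseteq> J" for n
      using J0(1) from_nat_into[OF False] by (auto simp: F_def)
    have "(\<Union>n. F n) = from_nat_into J0 ` UNIV"
      by (auto simp: F_def)
    also have "\<dots> = J0"
      using J0(2) False by (simp add: range_from_nat_into)
    finally have "(\<Union>n. A n) = {x. t < maxop \<nu> f x}"
      unfolding maxop_superlevel J_def[symmetric] J0(3)[symmetric] A_def by blast
    moreover have "incseq A"
      unfolding incseq_def A_def F_def by (intro allI impI UN_mono image_mono) auto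
    moreover have "range A \<subseteq> sets \<nu>"
      using F unfolding A_def sets_eq J_def
      by (intro image_subsetI sets.finite_UN) (blast intro: B_sets)+
    ultimately have "emeasure \<nu> {x. t < maxop \<nu> f x} = (SUP n. emeasure \<nu> (A n))"
      by (simp add: SUP_emeasure_incseq)
    then show ?thesis
      using finite_case[OF F] by (simp add: SUP_mult_left_ennreal A_def SUP_least)
  qed
qed

text \<open>Marcinkiewicz interpolation between the weak bound and the trivial sup bound, carried
  out on dyadic levels. The bound is affine because values up to 2 are estimated by the total mass
  alone; the fixed-point iteration is content with that.\<close>

lemma strong_type:
  assumes sets_eq [measurable_cong]: "sets \<nu> = sets M"
    and fin: "emeasure \<nu> (space \<nu>) < top" and D: "D < top" and q: "1 < q"
    and doubling: "\<And>i. i \<in> I \<Longrightarrow> emeasure \<nu> (B' i) \<le> D * emeasure \<nu> (B i)"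
  shows "\<exists>K<top. \<forall>f\<in>borel_measurable M.
    (\<integral>\<^sup>+x. epow (maxop \<nu> f x) q \<partial>\<nu>) \<le> K + K * (\<integral>\<^sup>+x. epow (f x) q \<partial>\<nu>)"
proof -
  define K1 where "K1 = ennreal (2 powr q) * emeasure \<nu> (space \<nu>)"
  define K2 where "K2 = ennreal (4 powr q) * D * ennreal (2 powr (q - 1) / (2 powr (q - 1) - 1))"
  have "(\<integral>\<^sup>+x. epow (maxop \<nu> f x) q \<partial>\<nu>) \<le> K1 + K2 * (\<integral>\<^sup>+x. epow (f x) q \<partial>\<nu>)"
    if f [measurable]: "f \<in> borel_measurable M" for f
  proof -
    \<comment> \<open>Cutting \<open>f\<close> at \<open>2 ^ k\<close> lowers every average by at
      most \<open>2 ^ k\<close>, so a maximal value above \<open>2 ^ (k + 1)\<close> leaves more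
      than \<open>2 ^ k\<close> for \<open>g k\<close>.\<close>
    define g where "g k x = f x * indicator {y. ennreal (2 ^ k) < y} (f x)" for k :: nat and x
    have g_meas [measurable]: "g k \<in> borel_measurable M" for k
      unfolding g_def by measurable
    have sub: "{x. ennreal (2 ^ (k + 1)) < maxop \<nu> f x} \<subseteq> {x. ennreal (2 ^ k) < maxop \<nu> (g k) x}" for k
    proof -
      have "average \<nu> f i \<le> average \<nu> (g k) i + ennreal (2 ^ k)" if [measurable]: "i \<in> I" for i
      proof -
        have "(\<integral>\<^sup>+y\<in>B i. f y \<partial>\<nu>) \<le> (\<integral>\<^sup>+y. g k y * indicator (B i) y + ennreal (2 ^ k) * indicator (B i) y \<partial>\<nu>)"
          by (intro nn_integral_mono) (auto simp: g_def indicator_def not_less)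
        also have "\<dots> = (\<integral>\<^sup>+y\<in>B i. g k y \<partial>\<nu>) + ennreal (2 ^ k) * emeasure \<nu> (B i)"
          by (simp add: nn_integral_add nn_integral_cmult_indicator)
        finally have "average \<nu> f i \<le> average \<nu> (g k) i + ennreal (2 ^ k) * (emeasure \<nu> (B i) / emeasure \<nu> (B i))"
          unfolding average_def
          by (simp add: add_divide_distrib_ennreal[symmetric] ennreal_times_divide divide_right_mono_ennreal)
        also have "emeasure \<nu> (B i) / emeasure \<nu> (B i) \<le> 1"
          by (metis divide_eq_1_ennreal ennreal_divide_top ennreal_zero_divide order_refl zero_le)
        finally show ?thesis
          by (simp add: mult_left_mono add_left_mono)
      qed
      then have *: "maxop \<nu> f x \<le> maxop \<nu> (g k) x + ennreal (2 ^ k)" for x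
        unfolding maxop_le_iff by (meson add_right_mono average_le_maxop order_trans)
      have "ennreal (2 ^ k) < maxop \<nu> (g k) x" if "ennreal (2 ^ (k + 1)) < maxop \<nu> f x" for x
      proof (rule ccontr)
        assume "\<not> ?thesis"
        then have "maxop \<nu> (g k) x + ennreal (2 ^ k) \<le> ennreal (2 ^ k) + ennreal (2 ^ k)"
          by (intro add_right_mono) simp
        also have "\<dots> = ennreal (2 ^ (k + 1))"
          by (simp flip: ennreal_plus)
        finally show False
          using that *[of x] by simp
      qed
      then show ?thesis by auto
    qed
    have level: "ennreal (2 powr ((real k + 2) * q)) * emeasure \<nu> {x. ennreal (2 ^ (k + 1)) < maxop \<nu> f x}
        \<le> ennreal (4 powr q) * D * (\<integral>\<^sup>+x. f x * (ennreal (2 powr (real k * (q - 1))) * indicator {y. ennreal (2 ^ k) < y} (f x)) \<partial>\<nu>)" for k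
    proof -
      \<comment> \<open>The factor is split as 4^q times 2^(k(q-1)) times 2^k: the last part is the
        level consumed by \<open>weak_type\<close>, the middle one is kept for the geometric
        sum.\<close>
      have "(4::real) powr q = 2 powr (2 * q)"
        by (simp add: powr_powr[symmetric])
      then have "2 powr ((real k + 2) * q) = 4 powr q * 2 powr (real k * (q - 1)) * 2 ^ k"
        by (simp add: powr_realpow[symmetric] powr_add[symmetric] algebra_simps)
      then have "ennreal (2 powr ((real k + 2) * q)) * emeasure \<nu> {x. ennreal (2 ^ (k + 1)) < maxop \<nu> f x}
          = ennreal (4 powr q) * ennreal (2 powr (real k * (q - 1))) * (ennreal (2 ^ k) * emeasure \<nu> {x. ennreal (2 ^ (k + 1)) < maxop \<nu> f x})"
        by (simp add: ennreal_mult ac_simps)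
      also have "ennreal (2 ^ k) * emeasure \<nu> {x. ennreal (2 ^ (k + 1)) < maxop \<nu> f x}
          \<le> ennreal (2 ^ k) * emeasure \<nu> {x. ennreal (2 ^ k) < maxop \<nu> (g k) x}"
        unfolding maxop_superlevel by (intro mult_left_mono emeasure_mono sub[unfolded maxop_superlevel])
          (auto simp: sets_eq intro!: Union_basis_sets)
      also have "\<dots> \<le> D * (\<integral>\<^sup>+x. g k x \<partial>\<nu>)"
        by (rule weak_type[OF sets_eq doubling]) auto
      finally have "ennreal (2 powr ((real k + 2) * q)) * emeasure \<nu> {x. ennreal (2 ^ (k + 1)) < maxop \<nu> f x}
          \<le> ennreal (4 powr q) * ennreal (2 powr (real k * (q - 1))) * (D * (\<integral>\<^sup>+x. g k x \<partial>\<nu>))"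
        by (simp add: mult_left_mono)
      also have "\<dots> = ennreal (4 powr q) * D * (\<integral>\<^sup>+x. ennreal (2 powr (real k * (q - 1))) * g k x \<partial>\<nu>)"
        by (subst nn_integral_cmult) (simp_all add: ac_simps)
      finally show ?thesis
        by (simp add: g_def ac_simps)
    qed
    have "(\<integral>\<^sup>+x. epow (maxop \<nu> f x) q \<partial>\<nu>) \<le> (\<integral>\<^sup>+x. ennreal (2 powr q) +
        (\<Sum>k. ennreal (2 powr ((real k + 2) * q)) * indicator {y. ennreal (2 ^ (k + 1)) < y} (maxop \<nu> f x)) \<partial>\<nu>)"
      using q by (intro nn_integral_mono epow_le_suminf_dyadic) auto
    also have "\<dots> = K1 + (\<Sum>k. \<integral>\<^sup>+x. ennreal (2 powr ((real k + 2) * q)) * indicator {y. ennreal (2 ^ (k + 1)) < y} (maxop \<nu> f x) \<partial>\<nu>)"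
      by (simp add: nn_integral_add nn_integral_suminf K1_def)
    also have "\<dots> = K1 + (\<Sum>k. ennreal (2 powr ((real k + 2) * q)) * emeasure \<nu> {x. ennreal (2 ^ (k + 1)) < maxop \<nu> f x})"
    proof -
      have "(\<integral>\<^sup>+x. c * indicator {y. t < y} (maxop \<nu> f x) \<partial>\<nu>) = c * emeasure \<nu> {x. t < maxop \<nu> f x}" for c t
      proof -
        have [measurable]: "{x. t < maxop \<nu> f x} \<in> sets \<nu>"
          unfolding maxop_superlevel sets_eq by (rule Union_basis_sets) auto
        have "(\<integral>\<^sup>+x. c * indicator {y. t < y} (maxop \<nu> f x) \<partial>\<nu>) = (\<integral>\<^sup>+x. c * indicator {x. t < maxop \<nu> f x} x \<partial>\<nu>)"
          by (simp add: indicator_def)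
        then show ?thesis
          by (simp add: nn_integral_cmult_indicator)
      qed
      then show ?thesis by simp
    qed
    also have "\<dots> \<le> K1 + (\<Sum>k. ennreal (4 powr q) * D * (\<integral>\<^sup>+x. f x * (ennreal (2 powr (real k * (q - 1))) * indicator {y. ennreal (2 ^ k) < y} (f x)) \<partial>\<nu>))"
      by (intro add_left_mono suminf_le level) auto
    also have "\<dots> = K1 + ennreal (4 powr q) * D * (\<integral>\<^sup>+x. f x * (\<Sum>k. ennreal (2 powr (real k * (q - 1))) * indicator {y. ennreal (2 ^ k) < y} (f x)) \<partial>\<nu>)"
      by (simp add: nn_integral_suminf[symmetric])
    also have "\<dots> \<le> K1 + ennreal (4 powr q) * D * (\<integral>\<^sup>+x. f x * (ennreal (2 powr (q - 1) / (2 powr (q - 1) - 1)) * epow (f x) (q - 1)) \<partial>\<nu>)"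
      using q by (intro add_left_mono mult_left_mono nn_integral_mono suminf_dyadic_le) auto
    also have "\<dots> = K1 + ennreal (4 powr q) * D * (\<integral>\<^sup>+x. ennreal (2 powr (q - 1) / (2 powr (q - 1) - 1)) * epow (f x) q \<partial>\<nu>)"
    proof -
      have "f x * (c * epow (f x) (q - 1)) = c * epow (f x) q" for c x
        using epow_add[of "f x" 1 "q - 1"] by (simp add: mult.left_commute)
      then show ?thesis by (simp only:)
    qed
    also have "\<dots> = K1 + K2 * (\<integral>\<^sup>+x. epow (f x) q \<partial>\<nu>)"
      by (subst nn_integral_cmult) (auto simp: K2_def ac_simps)
    finally show ?thesis .
  qed
  moreover have "K1 + K2 * u \<le> (K1 + K2) + (K1 + K2) * u" for u
    by (intro add_mono mult_right_mono) auto
  moreover have "K1 + K2 < top"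
    using fin D by (simp add: K1_def K2_def ennreal_mult_less_top)
  ultimately show ?thesis
    by (meson order_trans)
qed

end

text \<open>\<open>B'_basis\<close> makes an enlargement a ball of the basis again, so that a
  condition imposed on all balls can be used on enlargements. \<open>B_top\<close> supplies a ball
  of full measure, from which finiteness of the weighted mass is read off.\<close>

locale doubling_basis = ball_basis M I B B' rad
  for M :: "'a measure" and I :: "'i set" and B B' :: "'i \<Rightarrow> 'a set" and rad :: "'i \<Rightarrow> real" +
  fixes D :: ennreal
  assumes finite_total: "emeasure M (space M) < top"
    and D_fin: "D < top"
    and B_pos: "i \<in> I \<Longrightarrow> 0 < emeasure M (B i)"
    and B_doubling: "i \<in> I \<Longrightarrow> emeasure M (B' i) \<le> D * emeasure M (B i)"
    and B'_basis: "i \<in> I \<Longrightarrow> \<exists>j\<in>I. B j = B' i"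
    and B_top: "\<exists>i\<in>I. AE x in M. x \<in> B i"
begin

lemma B_subset_B': "i \<in> I \<Longrightarrow> B i \<subseteq> B' i"
  using engulf[of i i] by (cases "B i = {}") auto

lemma B_fin: "i \<in> I \<Longrightarrow> emeasure M (B i) < top"
  using emeasure_space[of M "B i"] finite_total by (rule le_less_trans)

end

section \<open>Densities and the fixed-point iteration\<close>

lemma emeasure_density_pos:
  assumes [measurable]: "f \<in> borel_measurable M" "A \<in> sets M"
    and "0 < emeasure M A" "\<And>x. 0 < f x"
  shows "0 < emeasure (density M f) A"
proof (rule ccontr)
  assume "\<not> ?thesis"
  then have "AE x in M. f x * indicator A x = 0"
    by (simp add: emeasure_density nn_integral_0_iff_AE)
  then have "AE x in M. x \<notin> A"
    using assms(4) by (auto simp: indicator_def zero_less_iff_neq_zero split: if_splits elim!: eventually_mono)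
  then have "emeasure M A = 0"
    by (simp add: AE_iff_null_sets[symmetric] null_setsD1)
  then show False
    using assms(3) by simp
qed

text \<open>The iteration \<^term>\<open>\<eta> = 1 + c * T \<eta>\<close> replaces the series of iterates of Rubio de Francia: with
  a small factor \<^term>\<open>c\<close> the norms stay bounded, and no subadditivity of \<^term>\<open>T\<close> is needed.\<close>

lemma ex_fixpoint_majorant:
  fixes T :: "('a \<Rightarrow> ennreal) \<Rightarrow> 'a \<Rightarrow> ennreal"
  assumes w [measurable]: "w \<in> borel_measurable M" and p: "0 < p" and K: "K < top"
    and w_fin: "(\<integral>\<^sup>+x. w x \<partial>M) < top"
    and T_meas: "\<And>f. f \<in> borel_measurable M \<Longrightarrow> T f \<in> borel_measurable M"
    and T_mono: "\<And>f g x. (\<And>x. f x \<le> g x) \<Longrightarrow> T f x \<le> T g x"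
    and T_SUP: "\<And>f x. incseq f \<Longrightarrow> (\<And>n. f n \<in> borel_measurable M) \<Longrightarrow> T (\<lambda>x. SUP n. f n x) x = (SUP n. T (f n) x)"
    and T_bound: "\<And>f. f \<in> borel_measurable M \<Longrightarrow>
      (\<integral>\<^sup>+x. epow (T f x) p * w x \<partial>M) \<le> K + K * (\<integral>\<^sup>+x. epow (f x) p * w x \<partial>M)"
  shows "\<exists>\<eta>\<in>borel_measurable M. \<exists>C<top. (\<forall>x. 1 \<le> \<eta> x) \<and> (\<forall>x. T \<eta> x \<le> C * \<eta> x) \<and>
    (\<integral>\<^sup>+x. epow (\<eta> x) p * w x \<partial>M) < top"
proof -
  obtain K' where K': "K = ennreal K'" "0 \<le> K'"
    using K by (cases K) auto
  \<comment> \<open>Chosen so that \<open>2 powr p * e powr p * K'\<close> is at most 1/2: the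
    previous iterate then enters with a factor of at most one half. \<open>K' + 1\<close> keeps the
    denominator positive.\<close>
  define e where "e = (1 / (2 * 2 powr p * (K' + 1))) powr (1 / p)"
  have e: "0 < e" "e powr p = 1 / (2 * 2 powr p * (K' + 1))"
    using K' p by (auto simp: e_def powr_powr)
  define \<eta> where "\<eta> = rec_nat (\<lambda>x. 0) (\<lambda>n g x. 1 + ennreal e * T g x)"
  have \<eta>0: "\<eta> 0 x = 0" and \<eta>Suc: "\<eta> (Suc n) x = 1 + ennreal e * T (\<eta> n) x" for n x
    by (simp_all add: \<eta>_def)
  have meas [measurable]: "\<eta> n \<in> borel_measurable M" for n
  proof (induction n)
    case 0
    then show ?case by (simp add: \<eta>_def)
  next
    case (Suc n)
    then have [measurable]: "T (\<eta> n) \<in> borel_measurable M"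
      by (rule T_meas)
    have "\<eta> (Suc n) = (\<lambda>x. 1 + ennreal e * T (\<eta> n) x)"
      by (simp add: \<eta>Suc fun_eq_iff)
    then show ?case by simp
  qed
  have step: "\<eta> n x \<le> \<eta> (Suc n) x" for n x
  proof (induction n arbitrary: x)
    case (Suc n)
    show ?case
      unfolding \<eta>Suc[of n x] \<eta>Suc[of "Suc n" x]
      by (intro add_left_mono mult_left_mono T_mono Suc.IH) auto
  qed (simp add: \<eta>0)
  then have inc: "incseq \<eta>"
    by (intro incseq_SucI) (auto simp: le_fun_def)
  define W where "W = (\<integral>\<^sup>+x. w x \<partial>M)"
  \<comment> \<open>With V for \<open>ennreal (2 powr p) * W\<close>, the value L = 2V + 2 satisfies
    V + (1 + L)/2 \<le> L, so the bound reproduces itself along the iteration.\<close>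
  define L where "L = 2 * (ennreal (2 powr p) * W + 1)"
  have bound: "(\<integral>\<^sup>+x. epow (\<eta> n x) p * w x \<partial>M) \<le> L" for n
  proof (induction n)
    case (Suc n)
    have [measurable]: "T (\<eta> n) \<in> borel_measurable M"
      using meas by (rule T_meas)
    have "(\<integral>\<^sup>+x. epow (\<eta> (Suc n) x) p * w x \<partial>M)
        \<le> (\<integral>\<^sup>+x. ennreal (2 powr p) * (epow 1 p + epow (ennreal e * T (\<eta> n) x) p) * w x \<partial>M)"
      unfolding \<eta>Suc using p by (intro nn_integral_mono mult_right_mono epow_plus_le) auto
    also have "\<dots> = (\<integral>\<^sup>+x. ennreal (2 powr p) * w x + ennreal (2 powr p * e powr p) * (epow (T (\<eta> n) x) p * w x) \<partial>M)"
      using e(1) by (simp add: epow_mult distrib_left distrib_right ennreal_mult ac_simps)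
    also have "\<dots> = ennreal (2 powr p) * W + ennreal (2 powr p * e powr p) * (\<integral>\<^sup>+x. epow (T (\<eta> n) x) p * w x \<partial>M)"
      by (simp add: nn_integral_add nn_integral_cmult W_def)
    also have "\<dots> \<le> ennreal (2 powr p) * W + ennreal (2 powr p * e powr p) * (K + K * L)"
      using Suc.IH by (intro add_left_mono mult_left_mono order_trans[OF T_bound]) auto
    also have "\<dots> = ennreal (2 powr p) * W + ennreal (2 powr p * e powr p * K') * (1 + L)"
      using K' by (simp add: ennreal_mult distrib_left mult.assoc)
    also have "2 powr p * e powr p * K' \<le> 1 / 2"
      using K' by (simp add: e divide_simps add_nonneg_eq_0_iff)
    also have "ennreal (2 powr p) * W + ennreal (1 / 2) * (1 + L) \<le> L"
    proof -
      have "ennreal (1 / 2) * 2 = 1"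
        using ennreal_mult[of "1/2" 2] by simp
      then have "ennreal (1 / 2) * L = ennreal (2 powr p) * W + 1"
        by (simp only: L_def mult.assoc[symmetric] mult_1_left)
      moreover have "ennreal (1 / 2) \<le> 1"
        by (simp del: ennreal_half)
      ultimately have "ennreal (2 powr p) * W + ennreal (1 / 2) * (1 + L)
          \<le> ennreal (2 powr p) * W + (1 + (ennreal (2 powr p) * W + 1))"
        by (simp add: distrib_left add_left_mono add_right_mono del: ennreal_half)
      also have "\<dots> = L"
        unfolding L_def mult_2 by (simp only: ac_simps)
      finally show ?thesis .
    qed
    finally show ?case
      by (simp add: add_left_mono mult_right_mono ennreal_leI)
  qed (simp add: \<eta>0)
  define H where "H x = (SUP n. \<eta> n x)" for x
  have [measurable]: "H \<in> borel_measurable M"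
    unfolding H_def by measurable
  have "1 \<le> H x" for x
    unfolding H_def by (rule SUP_upper2[of 1]) (simp_all add: \<eta>Suc[of 0, simplified])
  moreover have "T H x \<le> ennreal (1 / e) * H x" for x
  proof -
    have "T H x = (SUP n. T (\<eta> n) x)"
      unfolding H_def by (rule T_SUP[OF inc meas])
    also have "\<dots> \<le> ennreal (1 / e) * H x"
    proof (rule SUP_least)
      fix n
      have "ennreal e * T (\<eta> n) x \<le> \<eta> (Suc n) x"
        by (simp add: \<eta>Suc)
      also have "\<dots> \<le> H x"
        unfolding H_def by (rule SUP_upper) simp
      finally have "ennreal (1 / e) * (ennreal e * T (\<eta> n) x) \<le> ennreal (1 / e) * H x"
        by (rule mult_left_mono) simp
      then show "T (\<eta> n) x \<le> ennreal (1 / e) * H x"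
        using e by (simp add: mult.assoc[symmetric] ennreal_mult[symmetric])
    qed
    finally show ?thesis .
  qed
  moreover have "(\<integral>\<^sup>+x. epow (H x) p * w x \<partial>M) < top"
  proof -
    have "(\<integral>\<^sup>+x. epow (H x) p * w x \<partial>M) = (\<integral>\<^sup>+x. (SUP n. epow (\<eta> n x) p * w x) \<partial>M)"
      unfolding H_def using p by (simp add: epow_SUP SUP_mult_right_ennreal)
    also have "\<dots> = (SUP n. \<integral>\<^sup>+x. epow (\<eta> n x) p * w x \<partial>M)"
      using step p by (intro nn_integral_monotone_convergence_SUP incseq_SucI)
        (auto simp: le_fun_def intro!: mult_right_mono epow_mono)
    also have "\<dots> \<le> L"
      using bound by (rule SUP_least)
    also have "L < top"
      using w_fin by (simp add: L_def W_def ennreal_mult_less_top)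
    finally show ?thesis .
  qed
  ultimately show ?thesis
    by (intro bexI[of _ H] exI[of _ "ennreal (1 / e)"]) auto
qed

text \<open>\<open>Ap\<close> is the averaged condition multiplied by the power \<open>p\<close> of
  the measure of the ball, which removes all divisions. Positivity of \<open>w\<close> at every
  point is arranged in the application by changing the weight on a null set.\<close>

locale muckenhoupt = doubling_basis M I B B' rad D
  for M :: "'a measure" and I :: "'i set" and B B' :: "'i \<Rightarrow> 'a set" and rad :: "'i \<Rightarrow> real"
    and D :: ennreal +
  fixes p q :: real and w \<sigma> :: "'a \<Rightarrow> real" and A :: ennreal
  assumes pq: "1 < p" "1 < q" "1/p + 1/q = 1"
    and w_meas [measurable]: "w \<in> borel_measurable M"
    and \<sigma>_meas [measurable]: "\<sigma> \<in> borel_measurable M"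
    and w_pos: "0 < w x"
    and dual_eq: "\<sigma> x = w x powr (- 1 / (p - 1))"
    and A_fin: "A < top"
    and Ap: "i \<in> I \<Longrightarrow> emeasure (density M w) (B i) * epow (emeasure (density M \<sigma>) (B i)) (p - 1)
      \<le> A * epow (emeasure M (B i)) p"
begin

lemma conjugate_exponents: "(p - 1) * (q - 1) = 1" "1 / (p - 1) = q - 1" "p * (q - 1) = q" "(p - 1) * q = p" "p / q = p - 1"
proof -
  have *: "p + q = p * q"
    using pq by (simp add: field_simps)
  show 1: "(p - 1) * (q - 1) = 1"
    using * by (simp add: algebra_simps)
  show "p * (q - 1) = q" "(p - 1) * q = p"
    using * by (simp_all add: algebra_simps)
  then show "1 / (p - 1) = q - 1" "p / q = p - 1"
    using pq 1 by (auto simp: field_simps)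
qed

lemma \<sigma>_pos: "0 < \<sigma> x"
  using w_pos[of x] by (simp add: dual_eq)

text \<open>Raising \<open>Ap\<close> to the power \<open>q - 1\<close> exchanges the two weights,
  because (p-1)(q-1) = 1. Every result of the locale thereby holds for \<open>\<sigma>\<close> and
  the exponent \<open>q\<close> too.\<close>

lemma muckenhoupt_dual: "muckenhoupt M I B B' rad D q p \<sigma> w (epow A (q - 1))"
proof unfold_locales
  show "1 < q" "1 < p" "1/q + 1/p = 1"
    using pq by auto
  show "w x = \<sigma> x powr (- 1 / (q - 1))" for x
    using pq w_pos[of x] conjugate_exponents(1) by (simp add: dual_eq powr_powr minus_mult_minus)
  show "epow A (q - 1) < top"
    using A_fin by simp
  show "emeasure (density M \<sigma>) (B i) * epow (emeasure (density M w) (B i)) (q - 1)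
      \<le> epow A (q - 1) * epow (emeasure M (B i)) q" if "i \<in> I" for i
    using epow_mono[OF Ap[OF that], of "q - 1"] pq
    by (simp add: epow_mult epow_epow conjugate_exponents ac_simps)
qed (use \<sigma>_pos in auto)

text \<open>On the ball from \<open>B_top\<close> the product in \<open>Ap\<close> is finite and its
  \<open>\<sigma>\<close> factor is positive, so the \<open>w\<close> factor is finite.\<close>

lemma density_fin: "emeasure (density M w) (space M) < top"
proof -
  obtain i where i: "i \<in> I" "AE x in M. x \<in> B i"
    using B_top by blast
  note [measurable] = B_sets[OF i(1)]
  have "emeasure (density M w) (B i) * epow (emeasure (density M \<sigma>) (B i)) (p - 1) < top"
    using B_fin[OF i(1)] A_fin by (intro le_less_trans[OF Ap[OF i(1)]]) (simp add: ennreal_mult_less_top)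
  moreover have "0 < emeasure (density M \<sigma>) (B i)"
    using \<sigma>_pos B_pos[OF i(1)] by (intro emeasure_density_pos) auto
  ultimately have "emeasure (density M w) (B i) < top"
    by (auto simp: ennreal_mult_less_top)
  also have "emeasure (density M w) (B i) = emeasure (density M w) (space M)"
    using i(2) by (intro emeasure_eq_AE) (auto simp: AE_density)
  finally show ?thesis .
qed

text \<open>The reverse of \<open>Ap\<close> with constant 1: Hoelder's inequality for the product
  w^(1/p) \<sigma>^(1/q) = 1 on the ball.\<close>

lemma Holder_basis:
  assumes [measurable]: "i \<in> I"
  shows "epow (emeasure M (B i)) p
    \<le> emeasure (density M w) (B i) * epow (emeasure (density M \<sigma>) (B i)) (p - 1)"
proof -
  let ?f = "\<lambda>x. epow (ennreal (w x) * indicator (B i) x) (1/p)"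
  let ?g = "\<lambda>x. epow (ennreal (\<sigma> x) * indicator (B i) x) (1/q)"
  have "(- 1 / (p - 1)) * (1 / q) = - (1 / p)"
    using conjugate_exponents(4) pq by (simp add: field_simps)
  then have *: "w x powr (1/p) * \<sigma> x powr (1/q) = 1" for x
    using w_pos[of x] by (simp add: dual_eq powr_powr powr_add[symmetric])
  have "?f x * ?g x = indicator (B i) x" for x
    using w_pos[of x] \<sigma>_pos[of x] *[of x] by (simp add: indicator_def ennreal_mult[symmetric])
  then have "emeasure M (B i) = (\<integral>\<^sup>+x. ?f x * ?g x \<partial>M)"
    by simp
  also have "\<dots> \<le> epow (\<integral>\<^sup>+x. epow (?f x) p \<partial>M) (1/p) * epow (\<integral>\<^sup>+x. epow (?g x) q \<partial>M) (1/q)"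
    by (intro nn_integral_Holder pq) measurable
  also have "\<dots> = epow (emeasure (density M w) (B i)) (1/p) * epow (emeasure (density M \<sigma>) (B i)) (1/q)"
    using pq by (simp add: epow_epow emeasure_density)
  finally have "epow (emeasure M (B i)) p \<le> epow (\<dots>) p"
    using pq by (intro epow_mono) auto
  then show ?thesis
    using pq by (simp add: epow_mult epow_epow conjugate_exponents)
qed

text \<open>\<open>Holder_basis\<close> on \<open>B i\<close> is combined with \<open>Ap\<close> on
  \<open>B' i\<close>, itself a ball of the basis. Enlarging the \<open>\<sigma>\<close> factor from
  \<open>B i\<close> to \<open>B' i\<close> links the two, and the power \<open>p\<close> of the
  measure of \<open>B i\<close> cancels.\<close>

lemma density_doubling:
  assumes i: "i \<in> I"
  shows "emeasure (density M w) (B' i) \<le> A * epow D p * emeasure (density M w) (B i)"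
proof -
  obtain j where j: "j \<in> I" "B j = B' i"
    using B'_basis[OF i] by blast
  let ?W = "emeasure (density M w)" and ?S = "emeasure (density M \<sigma>)" and ?m = "epow (emeasure M (B i)) p"
  have "?W (B' i) * ?m \<le> ?W (B' i) * (?W (B i) * epow (?S (B i)) (p - 1))"
    by (intro mult_left_mono Holder_basis i) auto
  also have "epow (?S (B i)) (p - 1) \<le> epow (?S (B' i)) (p - 1)"
    using pq i B_subset_B'[OF i] by (intro epow_mono emeasure_mono) auto
  also have "?W (B' i) * (?W (B i) * epow (?S (B' i)) (p - 1)) = ?W (B i) * (?W (B j) * epow (?S (B j)) (p - 1))"
    by (simp add: j ac_simps)
  also have "\<dots> \<le> ?W (B i) * (A * epow (D * emeasure M (B i)) p)"
    using B_doubling[OF i] pq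
    by (intro mult_left_mono order_trans[OF Ap[OF j(1)]] epow_mono) (auto simp: j)
  also have "\<dots> = ?m * (A * epow D p * ?W (B i))"
    by (simp add: epow_mult ac_simps)
  finally have "?W (B' i) * ?m \<le> ?m * (A * epow D p * ?W (B i))"
    by (simp add: mult_left_mono)
  then have "?m * ?W (B' i) \<le> ?m * (A * epow D p * ?W (B i))"
    by (simp only: mult.commute[of ?m "?W (B' i)"])
  moreover have "?m \<noteq> 0" "?m \<noteq> top"
    using B_pos[OF i] B_fin[OF i] by auto
  ultimately show ?thesis
    using ennreal_mult_le_mult_iff[of ?m "?W (B' i)" "A * epow D p * ?W (B i)"] by blast
qed

text \<open>The exponent is \<open>q\<close> because \<open>maxop_Lerner\<close> controls a power
  \<open>p - 1\<close> and (p-1)q = p; the dual instance provides the exponent \<open>p\<close> for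
  \<open>\<sigma>\<close>.\<close>

lemma maxop_density_bound:
  shows "\<exists>K<top. \<forall>f\<in>borel_measurable M.
    (\<integral>\<^sup>+x. epow (maxop (density M w) f x) q * w x \<partial>M) \<le> K + K * (\<integral>\<^sup>+x. epow (f x) q * w x \<partial>M)"
proof -
  have "\<exists>K<top. \<forall>f\<in>borel_measurable M.
    (\<integral>\<^sup>+x. epow (maxop (density M w) f x) q \<partial>density M w) \<le> K + K * (\<integral>\<^sup>+x. epow (f x) q \<partial>density M w)"
    using density_doubling density_fin A_fin D_fin pq
    by (intro strong_type[where D = "A * epow D p"]) (auto simp: ennreal_mult_less_top)
  then show ?thesis
    by (simp add: nn_integral_density mult.commute cong: conj_cong)
qed

text \<open>Lerner's pointwise bound, which reduces the weighted estimate for the maximal operator to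
  maximal operators whose averages are taken with respect to the weights themselves.\<close>

lemma maxop_Lerner:
  assumes [measurable]: "f \<in> borel_measurable M"
  shows "epow (maxop M f x) (p - 1)
    \<le> A * maxop (density M w) (\<lambda>y. epow (maxop (density M \<sigma>) (\<lambda>z. f z / \<sigma> z) y) (p - 1) / w y) x"
    (is "_ \<le> A * maxop _ ?g x")
proof -
  have "epow (average M f i) (p - 1) \<le> A * average (density M w) ?g i" if [measurable]: "i \<in> I" for i
  proof -
    let ?W = "emeasure (density M w) (B i)" and ?S = "emeasure (density M \<sigma>) (B i)" and ?m = "emeasure M (B i)"
    define F where "F = (\<integral>\<^sup>+y\<in>B i. f y \<partial>M)"
    have m: "0 < ?m" "?m < top"
      using B_pos B_fin that by auto
    have W: "0 < ?W" "?W < top"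
      using m w_pos density_fin emeasure_space[of "density M w" "B i"]
      by (auto intro!: emeasure_density_pos intro: le_less_trans)
    interpret dual: muckenhoupt M I B B' rad D q p \<sigma> w "epow A (q - 1)"
      by (rule muckenhoupt_dual)
    have S: "0 < ?S" "?S < top"
      using m \<sigma>_pos dual.density_fin emeasure_space[of "density M \<sigma>" "B i"]
      by (auto intro!: emeasure_density_pos intro: le_less_trans)
    have can: "ennreal a * (b / ennreal a) = b" if "0 < a" for a b
      using that by (simp add: ennreal_times_divide ennreal_mult_divide_eq[of "ennreal a" b] mult.commute)
    have avS: "average (density M \<sigma>) (\<lambda>z. f z / \<sigma> z) i = F / ?S"
      unfolding average_def F_def using can[OF \<sigma>_pos]
      by (simp add: nn_integral_density mult.assoc[symmetric])
    have avW: "average (density M w) ?g i = (\<integral>\<^sup>+y\<in>B i. epow (maxop (density M \<sigma>) (\<lambda>z. f z / \<sigma> z) y) (p - 1) \<partial>M) / ?W"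
      unfolding average_def using can[OF w_pos]
      by (simp add: nn_integral_density mult.assoc[symmetric])
    \<comment> \<open>\<open>F / ?S\<close> is the \<open>\<sigma>\<close>-average of
      \<open>f / \<sigma>\<close>, so the \<open>\<sigma>\<close>-maximal function is at least this
      number everywhere on \<open>B i\<close>.\<close>
    have "epow (F / ?S) (p - 1) * ?m = (\<integral>\<^sup>+y\<in>B i. epow (F / ?S) (p - 1) \<partial>M)"
      by (simp add: nn_integral_cmult_indicator)
    also have "\<dots> \<le> (\<integral>\<^sup>+y\<in>B i. epow (maxop (density M \<sigma>) (\<lambda>z. f z / \<sigma> z) y) (p - 1) \<partial>M)"
      using pq that by (intro nn_integral_mono)
        (auto simp: indicator_def avS[symmetric] intro!: epow_mono average_le_maxop)
    finally have le: "epow (F / ?S) (p - 1) * ?m / ?W \<le> average (density M w) ?g i"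
      unfolding avW by (rule divide_right_mono_ennreal)
    \<comment> \<open>Passing to the \<open>\<sigma>\<close>-average costs the factor
      \<open>?S / ?m\<close>. By \<open>Ap\<close> its power \<open>p - 1\<close> is at most
      \<open>A * (?m / ?W)\<close>, just what turns the preceding integral into a
      \<open>w\<close>-average.\<close>
    have "average M f i = F / ?S * (?S / ?m)"
      using S by (simp add: average_def F_def ennreal_times_divide ennreal_divide_times)
    then have "epow (average M f i) (p - 1) = epow (F / ?S) (p - 1) * (epow ?S (p - 1) / epow ?m (p - 1))"
      using m by (simp add: epow_mult epow_divide)
    also have "epow ?S (p - 1) = ?W * epow ?S (p - 1) / ?W"
      using W by (simp add: ennreal_mult_divide_eq mult.commute[of ?W])
    also have "\<dots> \<le> A * epow ?m p / ?W"
      by (intro divide_right_mono_ennreal Ap that)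
    also have "A * epow ?m p / ?W / epow ?m (p - 1) = A * (?m / ?W)"
    proof -
      have "epow ?m p = ?m * epow ?m (p - 1)"
        using epow_add[of ?m 1 "p - 1"] by simp
      moreover have "epow ?m (p - 1) * inverse (epow ?m (p - 1)) = 1"
        using m ennreal_divide_self[of "epow ?m (p - 1)"] by (simp add: divide_ennreal_def)
      moreover have "A * (?m * e) * inverse ?W * e' = A * (?m * inverse ?W) * (e * e')" for e e'
        by (simp only: ac_simps)
      ultimately show ?thesis
        by (simp only: divide_ennreal_def mult_1_right)
    qed
    finally have "epow (average M f i) (p - 1) \<le> epow (F / ?S) (p - 1) * (A * (?m / ?W))"
      by (simp add: mult_left_mono divide_right_mono_ennreal)
    also have "\<dots> = A * (epow (F / ?S) (p - 1) * ?m / ?W)"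
      by (simp add: divide_ennreal_def ac_simps)
    also have "\<dots> \<le> A * average (density M w) ?g i"
      by (rule mult_left_mono[OF le]) simp
    finally show ?thesis .
  qed
  then have "epow (average M f i) (p - 1) \<le> A * maxop (density M w) ?g x" if "i \<in> I" "x \<in> B i" for i
    using that by (meson average_le_maxop mult_left_mono order_trans zero_le)
  then show ?thesis
    using pq by (simp add: epow_le_iff_le_epow maxop_le_iff)
qed

text \<open>After raising \<open>maxop_Lerner\<close> to the power \<open>q\<close>, the operator
  for \<open>w\<close> acts on L^q(w) and the one for \<open>\<sigma>\<close> on L^p(\<sigma>). The
  divisions by \<open>w\<close> and \<open>\<sigma>\<close> convert the first space into the second
  and then into L^p(w).\<close>

lemma maxop_bounded:
  "\<exists>K<top. \<forall>f\<in>borel_measurable M.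
    (\<integral>\<^sup>+x. epow (maxop M f x) p * w x \<partial>M) \<le> K + K * (\<integral>\<^sup>+x. epow (f x) p * w x \<partial>M)"
proof -
  interpret dual: muckenhoupt M I B B' rad D q p \<sigma> w "epow A (q - 1)"
    by (rule muckenhoupt_dual)
  obtain K where K: "K < top" "\<And>f. f \<in> borel_measurable M \<Longrightarrow>
      (\<integral>\<^sup>+x. epow (maxop (density M w) f x) q * w x \<partial>M) \<le> K + K * (\<integral>\<^sup>+x. epow (f x) q * w x \<partial>M)"
    using maxop_density_bound by blast
  obtain L where L: "L < top" "\<And>f. f \<in> borel_measurable M \<Longrightarrow>
      (\<integral>\<^sup>+x. epow (maxop (density M \<sigma>) f x) p * \<sigma> x \<partial>M) \<le> L + L * (\<integral>\<^sup>+x. epow (f x) p * \<sigma> x \<partial>M)"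
    using dual.maxop_density_bound by blast
  \<comment> \<open>Nesting the two affine bounds gives the constant part \<open>K + K * L\<close>
    and the slope \<open>K * L\<close>, each times \<open>epow A q\<close>; \<open>C\<close> covers
    both.\<close>
  define C where "C = epow A q * (K + K * L)"
  have "(\<integral>\<^sup>+x. epow (maxop M f x) p * w x \<partial>M) \<le> C + C * (\<integral>\<^sup>+x. epow (f x) p * w x \<partial>M)"
    if f [measurable]: "f \<in> borel_measurable M" for f
  proof -
    define h where "h = maxop (density M \<sigma>) (\<lambda>z. f z / \<sigma> z)"
    define g where "g y = epow (h y) (p - 1) / w y" for y
    have [measurable]: "h \<in> borel_measurable M"
      unfolding h_def by simp
    have [measurable]: "g \<in> borel_measurable M"
      unfolding g_def by measurable
    have "1 - q = - 1 / (p - 1)"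
      using conjugate_exponents(2) by (simp add: minus_divide_left[symmetric])
    then have wq: "w y / w y powr q = \<sigma> y" for y
      using w_pos[of y] powr_diff[of "w y" 1 q] by (simp add: dual_eq)
    have g: "epow (g y) q * w y = epow (h y) p * \<sigma> y" for y
    proof -
      have "epow (g y) q = epow (h y) p / ennreal (w y powr q)"
        using w_pos[of y] by (simp add: g_def epow_divide epow_epow conjugate_exponents(4))
      then have "epow (g y) q * w y = epow (h y) p * (ennreal (w y) / ennreal (w y powr q))"
        by (simp add: divide_ennreal_def ac_simps)
      then show ?thesis
        using w_pos[of y] by (simp add: divide_ennreal wq)
    qed
    have "(- 1 / (p - 1)) * (1 - p) = 1"
      using pq by (simp add: field_simps)
    then have "\<sigma> y powr (1 - p) = w y" for y
      using w_pos[of y] by (simp add: dual_eq powr_powr)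
    then have \<sigma>p: "\<sigma> y / \<sigma> y powr p = w y" for y
      using \<sigma>_pos[of y] powr_diff[of "\<sigma> y" 1 p] by simp
    have fs: "epow (f y / \<sigma> y) p * \<sigma> y = epow (f y) p * w y" for y
    proof -
      have "epow (f y / \<sigma> y) p = epow (f y) p / ennreal (\<sigma> y powr p)"
        using \<sigma>_pos[of y] by (simp add: epow_divide)
      then have "epow (f y / \<sigma> y) p * \<sigma> y = epow (f y) p * (ennreal (\<sigma> y) / ennreal (\<sigma> y powr p))"
        by (simp add: divide_ennreal_def ac_simps)
      then show ?thesis
        using \<sigma>_pos[of y] by (simp add: divide_ennreal \<sigma>p)
    qed
    have "epow (maxop M f x) p \<le> epow A q * epow (maxop (density M w) g x) q" for x
      using epow_mono[OF maxop_Lerner[OF f, of x], of q] pq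
      by (simp add: epow_epow epow_mult conjugate_exponents(4) h_def[symmetric] g_def[abs_def, symmetric])
    then have "(\<integral>\<^sup>+x. epow (maxop M f x) p * w x \<partial>M) \<le> (\<integral>\<^sup>+x. epow A q * (epow (maxop (density M w) g x) q * w x) \<partial>M)"
      by (intro nn_integral_mono) (simp add: mult.assoc[symmetric] mult_right_mono)
    also have "\<dots> = epow A q * (\<integral>\<^sup>+x. epow (maxop (density M w) g x) q * w x \<partial>M)"
      by (rule nn_integral_cmult) measurable
    also have "\<dots> \<le> epow A q * (K + K * (\<integral>\<^sup>+x. epow (g x) q * w x \<partial>M))"
      by (intro mult_left_mono K) auto
    also have "(\<integral>\<^sup>+x. epow (g x) q * w x \<partial>M) = (\<integral>\<^sup>+x. epow (h x) p * \<sigma> x \<partial>M)"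
      by (simp add: g)
    also have "\<dots> \<le> L + L * (\<integral>\<^sup>+x. epow (f x / \<sigma> x) p * \<sigma> x \<partial>M)"
      unfolding h_def by (rule L) measurable
    also have "(\<integral>\<^sup>+x. epow (f x / \<sigma> x) p * \<sigma> x \<partial>M) = (\<integral>\<^sup>+x. epow (f x) p * w x \<partial>M)"
      by (simp add: fs)
    finally have "(\<integral>\<^sup>+x. epow (maxop M f x) p * w x \<partial>M)
        \<le> epow A q * (K + K * (L + L * (\<integral>\<^sup>+x. epow (f x) p * w x \<partial>M)))"
      by (simp add: mult_left_mono add_left_mono)
    also have "\<dots> \<le> C + C * (\<integral>\<^sup>+x. epow (f x) p * w x \<partial>M)"
      unfolding C_def distrib_left distrib_right
      by (simp add: ac_simps add_increasing2)
    finally show ?thesis .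
  qed
  moreover have "C < top"
    using K L A_fin by (simp add: C_def ennreal_mult_less_top)
  ultimately show ?thesis by blast
qed

text \<open>A single bound \<open>T \<eta> x \<le> C * \<eta> x\<close> for a sum of two operators
  gives both conclusions: the first summand yields the bound for \<open>\<eta>\<close>, the second
  the one for w \<eta>^(p-1).\<close>

lemma Jones_factor:
  "\<exists>\<eta>\<in>borel_measurable M. \<exists>C<top. (\<forall>x. 1 \<le> \<eta> x) \<and> (AE x in M. \<eta> x < top) \<and>
    (\<forall>x. maxop M \<eta> x \<le> C * \<eta> x) \<and>
    (\<forall>x. maxop M (\<lambda>y. w y * epow (\<eta> y) (p - 1)) x \<le> C * (w x * epow (\<eta> x) (p - 1)))"
proof -
  interpret dual: muckenhoupt M I B B' rad D q p \<sigma> w "epow A (q - 1)"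
    by (rule muckenhoupt_dual)
  obtain K where K: "K < top" "\<And>f. f \<in> borel_measurable M \<Longrightarrow>
      (\<integral>\<^sup>+x. epow (maxop M f x) p * w x \<partial>M) \<le> K + K * (\<integral>\<^sup>+x. epow (f x) p * w x \<partial>M)"
    using maxop_bounded by blast
  obtain L where L: "L < top" "\<And>f. f \<in> borel_measurable M \<Longrightarrow>
      (\<integral>\<^sup>+x. epow (maxop M f x) q * \<sigma> x \<partial>M) \<le> L + L * (\<integral>\<^sup>+x. epow (f x) q * \<sigma> x \<partial>M)"
    using dual.maxop_bounded by blast
  define G where "G f y = ennreal (w y) * epow (f y) (p - 1)" for f y
  \<comment> \<open>The second summand is the maximal operator on L^q(\<sigma>) transported to
    L^p(w): \<open>G\<close> carries the integral of L^p(w) to that of L^q(\<sigma>), as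
    \<open>G\<sigma>\<close> shows, and the outer division and power carry it back, as
    \<open>Gw\<close> shows.\<close>
  define T where "T f x = maxop M f x + epow (maxop M (G f) x / w x) (q - 1)" for f x
  have G_meas [measurable]: "G f \<in> borel_measurable M" if [measurable]: "f \<in> borel_measurable M" for f
    unfolding G_def by measurable
  have p1: "0 < p - 1" "0 < q - 1"
    using pq by auto
  have "1 - q = - 1 / (p - 1)"
    using conjugate_exponents(2) by (simp add: minus_divide_left[symmetric])
  then have wq: "w y / w y powr q = \<sigma> y" for y
    using w_pos[of y] powr_diff[of "w y" 1 q] by (simp add: dual_eq)
  have G\<sigma>: "epow (G f y) q * \<sigma> y = epow (f y) p * w y" for f y
  proof -
    have "w y powr q * \<sigma> y = w y"
      using w_pos[of y] by (simp add: wq[symmetric])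
    then have "ennreal (w y powr q) * ennreal (\<sigma> y) = ennreal (w y)"
      using \<sigma>_pos[of y] by (simp add: ennreal_mult[symmetric])
    moreover have "epow (G f y) q * \<sigma> y = epow (f y) p * (ennreal (w y powr q) * ennreal (\<sigma> y))"
      using w_pos[of y] by (simp add: G_def epow_mult epow_epow conjugate_exponents(4) mult.assoc mult.left_commute)
    ultimately show ?thesis by simp
  qed
  have Gw: "epow (epow (u / w y) (q - 1)) p * w y = epow u q * \<sigma> y" for u :: ennreal and y
  proof -
    have "epow (epow (u / w y) (q - 1)) p = epow u q / ennreal (w y powr q)"
      using w_pos[of y] conjugate_exponents(3) by (simp add: epow_epow mult.commute epow_divide powr_powr)
    then have "epow (epow (u / w y) (q - 1)) p * w y = epow u q * (ennreal (w y) / ennreal (w y powr q))"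
      by (simp add: divide_ennreal_def ac_simps)
    then show ?thesis
      using w_pos[of y] by (simp add: divide_ennreal wq)
  qed
  have "\<exists>\<eta>\<in>borel_measurable M. \<exists>C<top. (\<forall>x. 1 \<le> \<eta> x) \<and> (\<forall>x. T \<eta> x \<le> C * \<eta> x) \<and>
    (\<integral>\<^sup>+x. epow (\<eta> x) p * w x \<partial>M) < top"
  proof (rule ex_fixpoint_majorant[where K = "ennreal (2 powr p) * (K + L)"])
    show "0 < p" using pq by simp
    show "(\<integral>\<^sup>+x. w x \<partial>M) < top"
      using density_fin by (simp add: emeasure_density cong: nn_integral_cong)
    show "T f \<in> borel_measurable M" if [measurable]: "f \<in> borel_measurable M" for f
      unfolding T_def by measurable
    show "T f x \<le> T g x" if "\<And>x. f x \<le> g x" for f g x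
      unfolding T_def G_def using that p1
      by (intro add_mono epow_mono divide_right_mono_ennreal maxop_mono mult_left_mono) auto
    show "T (\<lambda>x. SUP n. f n x) x = (SUP n. T (f n) x)"
      if f: "incseq f" "\<And>n. f n \<in> borel_measurable M" for f x
    proof -
      have le: "f m x \<le> f n x" if "m \<le> n" for m n x
        using f(1) that by (auto simp: incseq_def le_fun_def)
      have "G (\<lambda>x. SUP n. f n x) = (\<lambda>x. SUP n. G (f n) x)"
        using p1 by (simp add: G_def fun_eq_iff epow_SUP SUP_mult_left_ennreal)
      moreover have "maxop M (\<lambda>x. SUP n. G (f n) x) x = (SUP n. maxop M (G (f n)) x)"
        using f le p1 by (intro maxop_SUP)
          (auto simp: incseq_def le_fun_def G_def intro!: mult_left_mono epow_mono)
      ultimately have "T (\<lambda>x. SUP n. f n x) x =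
          (SUP n. maxop M (f n) x) + (SUP n. epow (maxop M (G (f n)) x / w x) (q - 1))"
        using p1 by (simp add: T_def maxop_SUP[OF f] SUP_divide_ennreal epow_SUP)
      also have "\<dots> = (SUP n. T (f n) x)"
        unfolding T_def using le p1
        by (intro ennreal_SUP_add[symmetric])
          (auto simp: incseq_def G_def intro!: maxop_mono epow_mono divide_right_mono_ennreal mult_left_mono)
      finally show ?thesis .
    qed
    show "(\<integral>\<^sup>+x. epow (T f x) p * w x \<partial>M)
        \<le> ennreal (2 powr p) * (K + L) + ennreal (2 powr p) * (K + L) * (\<integral>\<^sup>+x. epow (f x) p * w x \<partial>M)"
      if f [measurable]: "f \<in> borel_measurable M" for f
    proof -
      let ?N = "\<integral>\<^sup>+x. epow (f x) p * w x \<partial>M"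
      have "(\<integral>\<^sup>+x. epow (T f x) p * w x \<partial>M) \<le> (\<integral>\<^sup>+x. ennreal (2 powr p) *
          (epow (maxop M f x) p + epow (epow (maxop M (G f) x / w x) (q - 1)) p) * w x \<partial>M)"
        unfolding T_def using pq by (intro nn_integral_mono mult_right_mono epow_plus_le) auto
      also have "\<dots> = (\<integral>\<^sup>+x. ennreal (2 powr p) *
          (epow (maxop M f x) p * w x + epow (maxop M (G f) x) q * \<sigma> x) \<partial>M)"
        by (simp only: mult.assoc distrib_right Gw)
      also have "\<dots> = ennreal (2 powr p) *
          ((\<integral>\<^sup>+x. epow (maxop M f x) p * w x \<partial>M) + (\<integral>\<^sup>+x. epow (maxop M (G f) x) q * \<sigma> x \<partial>M))"
        by (simp add: nn_integral_cmult nn_integral_add)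
      also have "\<dots> \<le> ennreal (2 powr p) * ((K + K * ?N) + (L + L * ?N))"
        using K(2)[OF f] L(2)[OF G_meas[OF f]] by (intro mult_left_mono add_mono) (auto simp: G\<sigma>)
      also have "\<dots> = ennreal (2 powr p) * (K + L) + ennreal (2 powr p) * (K + L) * ?N"
        by (simp add: distrib_left distrib_right ac_simps)
      finally show ?thesis .
    qed
    show "ennreal (2 powr p) * (K + L) < top"
      using K L by (simp add: ennreal_mult_less_top)
  qed (rule measurable_compose[OF w_meas measurable_ennreal])
  then obtain \<eta> C where \<eta> [measurable]: "\<eta> \<in> borel_measurable M" and C: "C < top" and ge1: "\<And>x. 1 \<le> \<eta> x"
    and T\<eta>: "\<And>x. T \<eta> x \<le> C * \<eta> x" and fin: "(\<integral>\<^sup>+x. epow (\<eta> x) p * w x \<partial>M) < top"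
    by blast
  have "AE x in M. epow (\<eta> x) p * w x \<noteq> top"
    using fin by (intro nn_integral_noteq_infinite[unfolded infinity_ennreal_def]) auto
  then have "AE x in M. \<eta> x < top"
  proof (rule eventually_mono)
    fix x
    assume "epow (\<eta> x) p * w x \<noteq> top"
    then show "\<eta> x < top"
      using w_pos[of x] by (auto simp: ennreal_mult_eq_top_iff less_top)
  qed
  moreover have "maxop M \<eta> x \<le> (C + epow C (p - 1)) * \<eta> x" for x
  proof -
    have "maxop M \<eta> x \<le> T \<eta> x"
      by (simp add: T_def)
    also have "\<dots> \<le> (C + epow C (p - 1)) * \<eta> x"
      by (intro order_trans[OF T\<eta>] mult_right_mono) auto
    finally show ?thesis .
  qed
  moreover have "maxop M (G \<eta>) x \<le> (C + epow C (p - 1)) * G \<eta> x" for x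
  proof -
    \<comment> \<open>Raising this to the power \<open>p - 1\<close> undoes \<open>q - 1\<close> and
      is the origin of \<open>epow C (p - 1)\<close> in the final constant.\<close>
    have "epow (maxop M (G \<eta>) x / w x) (q - 1) \<le> C * \<eta> x"
      using T\<eta>[of x] unfolding T_def by (meson add_increasing order_trans order_refl zero_le)
    moreover have "1 / (q - 1) = p - 1"
      using p1 conjugate_exponents(1) by (simp add: field_simps)
    ultimately have "maxop M (G \<eta>) x / w x \<le> epow (C * \<eta> x) (p - 1)"
      using p1 by (simp add: epow_le_iff_le_epow)
    then have "w x * (maxop M (G \<eta>) x / w x) \<le> w x * epow (C * \<eta> x) (p - 1)"
      by (rule mult_left_mono) simp
    also have "ennreal (w x) * (maxop M (G \<eta>) x / w x) = maxop M (G \<eta>) x"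
      using w_pos[of x] by (simp add: ennreal_times_divide ennreal_mult_divide_eq mult.commute[of "ennreal (w x)"])
    also have "w x * epow (C * \<eta> x) (p - 1) = epow C (p - 1) * G \<eta> x"
      by (simp add: G_def epow_mult ac_simps)
    also have "\<dots> \<le> (C + epow C (p - 1)) * G \<eta> x"
      by (intro mult_right_mono) auto
    finally show ?thesis .
  qed
  moreover have "C + epow C (p - 1) < top"
    using C by simp
  ultimately show ?thesis
    using ge1 unfolding G_def by (intro bexI[OF _ \<eta>]) blast
qed

end

section \<open>Pseudo-balls\<close>

lemma cinner_self: "cinner z z = complex_of_real ((norm z)\<^sup>2)"
  by (simp add: cinner_def norm_vec_def L2_set_def sum_nonneg complex_norm_square del: of_real_power)

lemma cnj_cinner: "cnj (cinner z w) = cinner w z"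
  by (simp add: cinner_def mult.commute)

lemma cinner_diff_left: "cinner (x - y) z = cinner x z - cinner y z"
  by (simp add: cinner_def left_diff_distrib sum_subtractf)

lemma cinner_add_left: "cinner (x + y) z = cinner x z + cinner y z"
  by (simp add: cinner_def distrib_right sum.distrib)

lemma cinner_diff_right: "cinner z (x - y) = cinner z x - cinner z y"
  by (simp add: cinner_def right_diff_distrib sum_subtractf)

lemma cinner_smult_left: "cinner (c *s x) y = c * cinner x y"
  by (simp add: cinner_def sum_distrib_left mult.assoc)

lemma cinner_smult_right: "cinner x (c *s y) = cnj c * cinner x y"
  by (simp add: cinner_def sum_distrib_left ac_simps)

lemma cinner_scaleR_left: "cinner (c *\<^sub>R x) y = complex_of_real c * cinner x y"
  by (simp add: cinner_def sum_distrib_left scaleR_conv_of_real[where 'a = complex] mult.assoc)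

lemma cinner_scaleR_right: "cinner x (c *\<^sub>R y) = complex_of_real c * cinner x y"
  by (simp add: cinner_def sum_distrib_left scaleR_conv_of_real[where 'a = complex] ac_simps)

lemma cmod_cinner_le: "cmod (cinner z w) \<le> norm z * norm w"
proof -
  have "cmod (cinner z w) \<le> (\<Sum>i\<in>UNIV. \<bar>cmod (z $ i)\<bar> * \<bar>cmod (w $ i)\<bar>)"
    unfolding cinner_def by (rule order_trans[OF norm_sum]) (simp add: norm_mult)
  also have "\<dots> \<le> L2_set (\<lambda>i. cmod (z $ i)) UNIV * L2_set (\<lambda>i. cmod (w $ i)) UNIV"
    by (rule L2_set_mult_ineq)
  finally show ?thesis
    by (simp add: norm_vec_def)
qed

lemma cmod_one_minus_cinner_commute: "cmod (1 - cinner z w) = cmod (1 - cinner w z)"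
  by (metis cnj_cinner complex_cnj_diff complex_cnj_one complex_mod_cnj)

lemma continuous_on_cinner [continuous_intros]:
  assumes "continuous_on A f" "continuous_on A g"
  shows "continuous_on A (\<lambda>x. cinner (f x) (g x))"
  unfolding cinner_def by (intro continuous_intros assms)

text \<open>Splitting \<open>a\<close> and \<open>c\<close> along \<open>b\<close> gives
  \<open>cinner a c = \<alpha> * \<gamma> + cinner a' c'\<close>. Both |1 - \<alpha>\<gamma>| and
  the product of the norms of \<open>a'\<close> and \<open>c'\<close> are at most |1 - \<alpha>| +
  |1 - \<gamma>|, whence the factor 2. For the orthogonal parts this rests on 1 - |\<alpha>|^2 \<le>
  2 |1 - \<alpha>|.\<close>

lemma sphere_quasi_triangle:
  assumes "norm a = 1" "norm b = 1" "norm c = 1"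
  shows "cmod (1 - cinner a c) \<le> 2 * (cmod (1 - cinner a b) + cmod (1 - cinner b c))"
proof -
  define \<alpha> where "\<alpha> = cinner a b"
  define \<gamma> where "\<gamma> = cinner b c"
  define a' where "a' = a - \<alpha> *s b"
  define c' where "c' = c - cnj \<gamma> *s b"
  have bb: "cinner b b = 1"
    using assms by (simp add: cinner_self)
  have cb: "cinner c b = cnj \<gamma>" and ba: "cinner b a = cnj \<alpha>"
    by (simp_all add: \<gamma>_def \<alpha>_def cnj_cinner)
  have \<alpha>1: "cmod \<alpha> \<le> 1" and \<gamma>1: "cmod \<gamma> \<le> 1"
    using cmod_cinner_le[of a b] cmod_cinner_le[of b c] assms by (simp_all add: \<alpha>_def \<gamma>_def)
  have ac: "cinner a' c' = cinner a c - \<alpha> * \<gamma>"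
    by (simp add: a'_def c'_def cinner_diff_left cinner_diff_right cinner_smult_left cinner_smult_right
        bb \<alpha>_def[symmetric] \<gamma>_def[symmetric] algebra_simps)
  have "complex_of_real ((norm a')\<^sup>2) = 1 - \<alpha> * cnj \<alpha>"
    unfolding cinner_self[symmetric]
    by (simp add: a'_def cinner_diff_left cinner_diff_right cinner_smult_left cinner_smult_right
        bb \<alpha>_def[symmetric] ba algebra_simps) (simp add: cinner_self assms)
  then have a': "(norm a')\<^sup>2 = 1 - (cmod \<alpha>)\<^sup>2"
    by (metis complex_norm_square of_real_1 of_real_diff of_real_eq_iff)
  have "complex_of_real ((norm c')\<^sup>2) = 1 - \<gamma> * cnj \<gamma>"
    unfolding cinner_self[symmetric]
    by (simp add: c'_def cinner_diff_left cinner_diff_right cinner_smult_left cinner_smult_right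
        bb \<gamma>_def[symmetric] cb algebra_simps) (simp add: cinner_self assms)
  then have c': "(norm c')\<^sup>2 = 1 - (cmod \<gamma>)\<^sup>2"
    by (metis complex_norm_square of_real_1 of_real_diff of_real_eq_iff)
  have sq: "1 - (cmod u)\<^sup>2 \<le> 2 * cmod (1 - u)" if "cmod u \<le> 1" for u :: complex
  proof -
    have "1 - cmod u \<le> cmod (1 - u)"
      using norm_triangle_ineq2[of 1 u] by simp
    moreover have "(1 - cmod u) * (1 + cmod u) \<le> (1 - cmod u) * 2"
      using that by (intro mult_left_mono) auto
    ultimately show ?thesis
      by (simp add: power2_eq_square algebra_simps)
  qed
  have "2 * (norm a' * norm c') \<le> (norm a')\<^sup>2 + (norm c')\<^sup>2"
    using sum_squares_bound[of "norm a'" "norm c'"] by simp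
  then have "norm a' * norm c' \<le> cmod (1 - \<alpha>) + cmod (1 - \<gamma>)"
    using sq[OF \<alpha>1] sq[OF \<gamma>1] a' c' by simp
  moreover have "cmod (1 - \<alpha> * \<gamma>) \<le> cmod (1 - \<alpha>) + cmod (1 - \<gamma>)"
  proof -
    have "1 - \<alpha> * \<gamma> = (1 - \<alpha>) + \<alpha> * (1 - \<gamma>)"
      by (simp add: algebra_simps)
    then have "cmod (1 - \<alpha> * \<gamma>) \<le> cmod (1 - \<alpha>) + cmod \<alpha> * cmod (1 - \<gamma>)"
      by (metis norm_mult norm_triangle_ineq)
    also have "cmod \<alpha> * cmod (1 - \<gamma>) \<le> 1 * cmod (1 - \<gamma>)"
      by (intro mult_right_mono \<alpha>1) auto
    finally show ?thesis by simp
  qed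
  moreover have "cmod (1 - cinner a c) \<le> cmod (1 - \<alpha> * \<gamma>) + norm a' * norm c'"
  proof -
    have "1 - cinner a c = (1 - \<alpha> * \<gamma>) - cinner a' c'"
      by (simp add: ac)
    then have "cmod (1 - cinner a c) \<le> cmod (1 - \<alpha> * \<gamma>) + cmod (cinner a' c')"
      by (simp only: norm_triangle_ineq4)
    then show ?thesis
      using cmod_cinner_le[of a' c'] by simp
  qed
  ultimately show ?thesis
    by (simp add: \<alpha>_def \<gamma>_def)
qed

section \<open>The pseudo-distance and its pseudo-balls\<close>

lemma pdist_nonzero:
  assumes "z \<noteq> 0" "w \<noteq> 0"
  shows "pdist z w = \<bar>norm z - norm w\<bar> + cmod (1 - cinner (sgn z) (sgn w))"
  using assms
  by (simp add: pdist_def sgn_div_norm cinner_scaleR_left cinner_scaleR_right divide_inverse ac_simps)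

lemma pdist_commute: "pdist z w = pdist w z"
  by (cases "z \<noteq> 0 \<and> w \<noteq> 0")
    (auto simp: pdist_nonzero cmod_one_minus_cinner_commute[of "sgn z"] abs_minus_commute, auto simp: pdist_def)

lemma pdist_less_3:
  assumes "norm z < 1" "norm w < 1"
  shows "pdist z w < 3"
proof (cases "z \<noteq> 0 \<and> w \<noteq> 0")
  case True
  have "cmod (1 - cinner (sgn z) (sgn w)) \<le> 1 + cmod (cinner (sgn z) (sgn w))"
    using norm_triangle_ineq4[of 1 "cinner (sgn z) (sgn w)"] by simp
  also have "cmod (cinner (sgn z) (sgn w)) \<le> 1"
    using cmod_cinner_le[of "sgn z" "sgn w"] True by (simp add: norm_sgn)
  finally have "cmod (1 - cinner (sgn z) (sgn w)) \<le> 2" by simp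
  moreover have "\<bar>norm z - norm w\<bar> < 1"
    using assms norm_ge_zero[of z] norm_ge_zero[of w] by linarith
  ultimately show ?thesis
    using True by (simp add: pdist_nonzero)
qed (use assms in \<open>auto simp: pdist_def\<close>)

lemma pdist_quasi_triangle:
  assumes "x \<noteq> 0" "y \<noteq> 0" "z \<noteq> 0"
  shows "pdist x z \<le> 2 * (pdist x y + pdist y z)"
proof -
  have double: "0 \<le> u \<Longrightarrow> u \<le> 2 * u" for u :: real
    by simp
  have "\<bar>norm x - norm z\<bar> \<le> \<bar>norm x - norm y\<bar> + \<bar>norm y - norm z\<bar>"
    using abs_triangle_ineq[of "norm x - norm y" "norm y - norm z"] by simp
  also have "\<dots> \<le> 2 * (\<bar>norm x - norm y\<bar> + \<bar>norm y - norm z\<bar>)"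
    by (rule double) simp
  finally have "\<bar>norm x - norm z\<bar> \<le> 2 * (\<bar>norm x - norm y\<bar> + \<bar>norm y - norm z\<bar>)" .
  then show ?thesis
    using sphere_quasi_triangle[of "sgn x" "sgn y" "sgn z"] assms
    by (simp add: pdist_nonzero norm_sgn)
qed

lemma pball_subset_ball: "pball z r \<subseteq> ball 0 1"
  by (auto simp: pball_def)

lemma pball_eq_ball: "norm z < 1 \<Longrightarrow> 3 \<le> r \<Longrightarrow> pball z r = ball 0 1"
  using pdist_less_3[of z] by (force simp: pball_def)

lemma pball_zero_eq_ball: "1 \<le> r \<Longrightarrow> pball 0 r = ball 0 1"
  by (auto simp: pball_def pdist_def)

text \<open>Two quasi-triangle inequalities give 2(1 + 2(1 + 1)) = 10. They need nonzero points: if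
  \<open>10 * r1 < 3\<close>, both radii are below 1/2 and both centres have norm above 1/2, so the
  origin is in neither ball. Otherwise the enlarged ball is everything.\<close>

lemma pball_engulf:
  assumes z1: "norm z1 < 1" "1 - norm z1 < r1" and z2: "norm z2 < 1" "1 - norm z2 < r2"
    and "r2 \<le> r1" and meet: "pball z1 r1 \<inter> pball z2 r2 \<noteq> {}"
  shows "pball z2 r2 \<subseteq> pball z1 (10 * r1)"
proof (cases "3 \<le> 10 * r1")
  case True
  then show ?thesis
    using pball_subset_ball by (simp add: pball_eq_ball z1)
next
  case False
  then have small: "r1 < 1/2" "r2 < 1/2"
    using assms by auto
  have nz: "x \<noteq> 0" if "x \<in> pball z r" "1 - norm z < r" "r < 1/2" for x z :: "complex^'a" and r
    using that by (auto simp: pball_def pdist_def)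
  have z0: "z1 \<noteq> 0" "z2 \<noteq> 0"
    using small z1 z2 by auto
  obtain w where w: "w \<in> pball z1 r1" "w \<in> pball z2 r2"
    using meet by blast
  have w0: "w \<noteq> 0"
    using nz[OF w(1)] z1 small by simp
  show ?thesis
  proof
    fix x
    assume x: "x \<in> pball z2 r2"
    have x0: "x \<noteq> 0"
      using nz[OF x] z2 small by simp
    have "pdist z1 x \<le> 2 * (pdist z1 w + pdist w x)"
      using z0 w0 x0 by (intro pdist_quasi_triangle)
    also have "pdist w x \<le> 2 * (pdist w z2 + pdist z2 x)"
      using z0 w0 x0 by (intro pdist_quasi_triangle)
    finally have "pdist z1 x \<le> 2 * (pdist z1 w + 2 * (pdist w z2 + pdist z2 x))"
      by simp
    then show "x \<in> pball z1 (10 * r1)"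
      using w x \<open>r2 \<le> r1\<close> by (auto simp: pball_def pdist_commute[of w])
  qed
qed

text \<open>The origin has to be removed: \<^const>\<open>pdist\<close> is discontinuous there, and it may be an
  isolated point of a pseudo-ball.\<close>

lemma open_pball_minus_0:
  fixes z :: "complex^'n"
  shows "open (pball z r - {0})"
proof (cases "z = 0")
  case True
  then have "pball z r - {0} = ball 0 1 \<inter> ball 0 r - {0}"
    by (auto simp: pball_def pdist_def)
  moreover have "open (ball 0 1 \<inter> ball 0 r - {0 :: complex^'n})"
    by (intro open_Diff open_Int open_ball closed_singleton)
  ultimately show ?thesis by simp
next
  case False
  have "continuous_on (ball 0 1 - {0}) (\<lambda>w. \<bar>norm z - norm w\<bar> + cmod (1 - cinner (sgn z) (sgn w)))"
    by (intro continuous_intros) auto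
  then have "open ((ball 0 1 - {0}) \<inter> (\<lambda>w. \<bar>norm z - norm w\<bar> + cmod (1 - cinner (sgn z) (sgn w))) -` {..<r})"
    by (intro continuous_open_preimage) (auto simp: open_Diff)
  also have "(ball 0 1 - {0}) \<inter> (\<lambda>w. \<bar>norm z - norm w\<bar> + cmod (1 - cinner (sgn z) (sgn w))) -` {..<r}
      = pball z r - {0}"
    using False by (auto simp: pball_def pdist_nonzero)
  finally show ?thesis .
qed

lemma pball_borel [measurable]: "pball z r \<in> sets borel"
proof -
  have "pball z r = (pball z r - {0}) \<union> (pball z r \<inter> {0})"
    by blast
  also have "\<dots> \<in> sets borel"
    by (rule sets.Un[OF borel_open[OF open_pball_minus_0]]) (simp add: Int_insert_right)
  finally show ?thesis .
qed

text \<open>Lindelof's theorem is applied to the balls without the origin, which are open; one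
  further ball takes care of the origin if it is covered at all.\<close>

lemma Lindelof_pball:
  fixes J :: "((complex^'n) \<times> real) set"
  shows "\<exists>J0\<subseteq>J. countable J0 \<and> (\<Union>(z, r)\<in>J0. pball z r) = (\<Union>(z, r)\<in>J. pball z r)"
proof -
  define O' where "O' = (\<lambda>j::(complex^'n) \<times> real. pball (fst j) (snd j) - {0})"
  obtain \<F> where \<F>: "\<F> \<subseteq> O' ` J" "countable \<F>" "\<Union>\<F> = \<Union>(O' ` J)"
    using Lindelof[of "O' ` J"] open_pball_minus_0 by (auto simp: O'_def)
  then obtain J1 where J1: "J1 \<subseteq> J" "countable J1" "\<F> = O' ` J1"
    by (metis countable_subset_image)
  obtain J2 where J2: "J2 \<subseteq> J" "countable J2" "(\<exists>j\<in>J. 0 \<in> pball (fst j) (snd j)) \<Longrightarrow> \<exists>j\<in>J2. 0 \<in> pball (fst j) (snd j)"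
  proof (cases "\<exists>j\<in>J. 0 \<in> pball (fst j) (snd j)")
    case True
    then obtain j where "j \<in> J" "0 \<in> pball (fst j) (snd j)" by blast
    then show ?thesis by (intro that[of "{j}"]) auto
  next
    case False
    then show ?thesis by (intro that[of "{}"]) auto
  qed
  have "x \<in> (\<Union>j\<in>J1 \<union> J2. pball (fst j) (snd j))" if "j \<in> J" "x \<in> pball (fst j) (snd j)" for j x
  proof (cases "x = 0")
    case True
    then show ?thesis using J2 that by blast
  next
    case False
    then have "x \<in> \<Union>(O' ` J)"
      using that by (auto simp: O'_def)
    then have "x \<in> \<Union>(O' ` J1)"
      using \<F>(3) J1(3) by simp
    then show ?thesis
      by (auto simp: O'_def)
  qed
  then have "(\<Union>(z, r)\<in>J1 \<union> J2. pball z r) = (\<Union>(z, r)\<in>J. pball z r)"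
    using J1(1) J2(1) by (fastforce simp: case_prod_beta)
  then show ?thesis
    using J1 J2 by (intro exI[of _ "J1 \<union> J2"]) auto
qed

section \<open>Lebesgue and weighted measure of caps, sectors and pseudo-balls\<close>

declare emeasure_completion [simp del]

text \<open>The absolute value of \<open>b\<close> serves both signs of \<open>a - 1\<close>, that
  is, densities that vanish and densities that blow up at the boundary.\<close>

lemma powr_comparable:
  fixes K u s b :: real
  assumes "1 \<le> K" "0 < u" "0 < s" "u \<le> K * s" "s \<le> K * u"
  shows "u powr b \<le> K powr \<bar>b\<bar> * s powr b"
proof (cases "0 \<le> b")
  case True
  then have "u powr b \<le> (K * s) powr b"
    using assms by (intro powr_mono2) auto
  then show ?thesis
    using assms True by (simp add: powr_mult)
next
  case False
  then have "s powr - b \<le> (K * u) powr - b"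
    using assms by (intro powr_mono2) auto
  then have "1 / s powr b \<le> K powr \<bar>b\<bar> / u powr b"
    using assms False by (simp add: powr_mult powr_minus_divide)
  then show ?thesis
    using assms by (simp add: field_simps)
qed

lemma mu_alpha_density_measurable:
  "(\<lambda>z::complex^'n. indicator (ball 0 1) z * ennreal ((1 - (norm z)\<^sup>2) powr (a - 1)))
    \<in> borel_measurable lebesgue"
proof (rule measurable_completion)
  have [measurable]: "ball 0 1 \<in> sets (borel :: (complex^'n) measure)"
    by simp
  show "(\<lambda>z::complex^'n. indicator (ball 0 1) z * ennreal ((1 - (norm z)\<^sup>2) powr (a - 1)))
      \<in> borel_measurable lborel"
    unfolding measurable_lborel1 by measurable
qed

lemma emeasure_mu_alpha:
  "A \<in> sets lebesgue \<Longrightarrow>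
    emeasure (mu_alpha a) A = (\<integral>\<^sup>+z\<in>A \<inter> ball 0 1. ennreal ((1 - (norm z)\<^sup>2) powr (a - 1)) \<partial>lebesgue)"
  unfolding mu_alpha_def
  by (subst emeasure_density)
    (auto simp: indicator_inter_arith ac_simps mu_alpha_density_measurable intro!: nn_integral_cong)

lemma sets_mu_alpha [simp, measurable_cong]: "sets (mu_alpha a) = sets lebesgue"
  by (simp add: mu_alpha_def)

lemma space_mu_alpha [simp]: "space (mu_alpha a) = UNIV"
  by (simp add: mu_alpha_def)

lemma mu_alpha_le:
  assumes [measurable]: "A \<in> sets lebesgue"
    and "\<And>z. z \<in> A \<Longrightarrow> norm z < 1 \<Longrightarrow> (1 - (norm z)\<^sup>2) powr (a - 1) \<le> c"
  shows "emeasure (mu_alpha a) A \<le> ennreal c * emeasure lebesgue A"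
proof -
  have "emeasure (mu_alpha a) A \<le> (\<integral>\<^sup>+z. ennreal c * indicator A z \<partial>lebesgue)"
    unfolding emeasure_mu_alpha[OF assms(1)]
    using assms(2) by (intro nn_integral_mono) (auto simp: indicator_def ennreal_leI)
  then show ?thesis
    by (simp add: nn_integral_cmult_indicator)
qed

lemma mu_alpha_ge:
  assumes [measurable]: "A \<in> sets lebesgue"
    and "\<And>z. z \<in> A \<Longrightarrow> norm z < 1 \<and> c \<le> (1 - (norm z)\<^sup>2) powr (a - 1)"
  shows "ennreal c * emeasure lebesgue A \<le> emeasure (mu_alpha a) A"
proof -
  have "ennreal c * emeasure lebesgue A = (\<integral>\<^sup>+z. ennreal c * indicator A z \<partial>lebesgue)"
    by (simp add: nn_integral_cmult_indicator)
  also have "\<dots> \<le> emeasure (mu_alpha a) A"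
    unfolding emeasure_mu_alpha[OF assms(1)]
    using assms(2) by (intro nn_integral_mono) (auto simp: indicator_def ennreal_leI)
  finally show ?thesis .
qed

text \<open>Unlike in \<open>pdist\<close>, the inner product is not divided by
  \<open>norm z\<close>: \<open>1 - cinner z e\<close> is then affine in \<open>z\<close> and scales
  under homotheties centred at \<open>e\<close>. Caps serve for lower bounds.\<close>

definition cap :: "complex^'n \<Rightarrow> real \<Rightarrow> (complex^'n) set" where
  "cap e \<rho> = {z \<in> ball 0 1. cmod (1 - cinner z e) < \<rho>}"

lemma open_cap: "open (cap e \<rho>)"
proof -
  have "continuous_on (ball 0 1) (\<lambda>z. cmod (1 - cinner z e))"
    by (intro continuous_intros)
  then have "open (ball 0 1 \<inter> (\<lambda>z. cmod (1 - cinner z e)) -` {..<\<rho>})"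
    by (intro continuous_open_preimage) auto
  moreover have "cap e \<rho> = ball 0 1 \<inter> (\<lambda>z. cmod (1 - cinner z e)) -` {..<\<rho>}"
    by (auto simp: cap_def)
  ultimately show ?thesis by simp
qed

lemma cap_sets [measurable]: "cap e \<rho> \<in> sets lebesgue"
  by (simp add: open_cap borel_open sets_completionI_sets)

lemma cap_eq_ball:
  assumes "norm e = 1" "2 \<le> \<rho>"
  shows "cap e \<rho> = ball 0 1"
proof -
  have "cmod (1 - cinner z e) < \<rho>" if "norm z < 1" for z
    using norm_triangle_ineq4[of 1 "cinner z e"] cmod_cinner_le[of z e] assms that by simp
  then show ?thesis by (auto simp: cap_def)
qed

text \<open>Caps at \<^term>\<open>e\<close> are doubling because the ball is stable under homotheties towards
  the boundary point \<^term>\<open>e\<close>.\<close>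

lemma cap_homothety:
  fixes e :: "complex^'n"
  assumes e: "norm e = 1" and t: "0 < t" "t \<le> 1"
  shows "ennreal (t ^ DIM(complex^'n)) * emeasure lebesgue (cap e \<rho>) \<le> emeasure lebesgue (cap e (t * \<rho>))"
proof -
  have "(\<lambda>z. t *\<^sub>R z + (1 - t) *\<^sub>R e) ` cap e \<rho> \<subseteq> cap e (t * \<rho>)"
  proof clarify
    fix z
    assume z: "z \<in> cap e \<rho>"
    have "norm (t *\<^sub>R z + (1 - t) *\<^sub>R e) \<le> t * norm z + (1 - t)"
      using t e by (intro order_trans[OF norm_triangle_ineq]) simp
    also have "\<dots> < t * 1 + (1 - t)"
      using t z by (intro add_strict_right_mono mult_strict_left_mono) (auto simp: cap_def)
    finally have "norm (t *\<^sub>R z + (1 - t) *\<^sub>R e) < 1" by simp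
    moreover have "1 - cinner (t *\<^sub>R z + (1 - t) *\<^sub>R e) e = of_real t * (1 - cinner z e)"
      by (simp add: cinner_add_left cinner_scaleR_left cinner_self e) (simp add: algebra_simps)
    then have "cmod (1 - cinner (t *\<^sub>R z + (1 - t) *\<^sub>R e) e) < t * \<rho>"
      using t z by (simp add: norm_mult cap_def)
    ultimately show "t *\<^sub>R z + (1 - t) *\<^sub>R e \<in> cap e (t * \<rho>)"
      by (simp add: cap_def)
  qed
  then have "emeasure lebesgue ((\<lambda>z. t *\<^sub>R z + (1 - t) *\<^sub>R e) ` cap e \<rho>) \<le> emeasure lebesgue (cap e (t * \<rho>))"
    by (rule emeasure_mono) measurable
  then show ?thesis
    unfolding emeasure_lebesgue_affine using t by (simp add: ennreal_power[symmetric])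
qed

text \<open>Radius and direction are decoupled, so scaling by \<open>b\<close> maps the unit sector
  onto this one and shells have explicit volume. Sectors serve for upper bounds.\<close>

definition sector :: "complex^'n \<Rightarrow> real \<Rightarrow> real \<Rightarrow> (complex^'n) set" where
  "sector e \<rho> b = {z. z \<noteq> 0 \<and> norm z < b \<and> cmod (1 - cinner (sgn z) e) < \<rho>}"

lemma sector_sets [measurable]: "sector e \<rho> b \<in> sets lebesgue"
proof -
  have "continuous_on (- {0}) (\<lambda>z. cmod (1 - cinner (sgn z) e))"
    by (intro continuous_intros) auto
  then have "open (- {0} \<inter> (\<lambda>z. cmod (1 - cinner (sgn z) e)) -` {..<\<rho>})"
    by (intro continuous_open_preimage) auto
  then have "open ((- {0} \<inter> (\<lambda>z. cmod (1 - cinner (sgn z) e)) -` {..<\<rho>}) \<inter> ball 0 b)"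
    by (rule open_Int[OF _ open_ball])
  moreover have "sector e \<rho> b = (- {0} \<inter> (\<lambda>z. cmod (1 - cinner (sgn z) e)) -` {..<\<rho>}) \<inter> ball 0 b"
    by (auto simp: sector_def)
  ultimately show ?thesis by auto
qed

lemma emeasure_sector:
  fixes e :: "complex^'n"
  assumes "0 \<le> b"
  shows "emeasure lebesgue (sector e \<rho> b) = ennreal (b ^ DIM(complex^'n)) * emeasure lebesgue (sector e \<rho> 1)"
proof (cases "b = 0")
  case True
  then have "sector e \<rho> b = {}"
    by (auto simp: sector_def)
  then show ?thesis
    using True by (simp add: power_0_left)
next
  case False
  then have b: "0 < b" using assms by simp
  have "sector e \<rho> b = (\<lambda>z. b *\<^sub>R z + 0) ` sector e \<rho> 1"
  proof (intro set_eqI iffI)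
    fix z
    assume z: "z \<in> sector e \<rho> b"
    then have "(1 / b) *\<^sub>R z \<in> sector e \<rho> 1"
      using b by (auto simp: sector_def sgn_scaleR)
    moreover have "z = b *\<^sub>R ((1 / b) *\<^sub>R z) + 0"
      using b by simp
    ultimately show "z \<in> (\<lambda>z. b *\<^sub>R z + 0) ` sector e \<rho> 1"
      by blast
  qed (use b in \<open>auto simp: sector_def sgn_scaleR\<close>)
  then show ?thesis
    unfolding emeasure_lebesgue_affine using b
    by (simp add: emeasure_lebesgue_affine[of b 0, simplified] ennreal_power[symmetric])
qed

lemma emeasure_sector_fin: "emeasure lebesgue (sector e \<rho> 1) < top"
proof -
  have "emeasure lebesgue (sector e \<rho> 1) \<le> emeasure lebesgue (ball 0 1 :: (complex^'n) set)" for e :: "complex^'n"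
    by (intro emeasure_mono) (auto simp: sector_def)
  also have "emeasure lebesgue (ball 0 1 :: (complex^'n) set) < top"
    using emeasure_bounded_finite[of "ball 0 1 :: (complex^'n) set"] by (simp add: emeasure_completion)
  finally show ?thesis .
qed

lemma emeasure_sector_shell:
  fixes e :: "complex^'n"
  assumes "0 \<le> b" "b \<le> c"
  shows "emeasure lebesgue (sector e \<rho> c - sector e \<rho> b)
    = ennreal (c ^ DIM(complex^'n) - b ^ DIM(complex^'n)) * emeasure lebesgue (sector e \<rho> 1)"
proof -
  have fin: "emeasure lebesgue (sector e \<rho> b) < top"
    using emeasure_sector_fin[of e \<rho>] by (simp add: emeasure_sector[OF assms(1)] ennreal_mult_less_top)
  have "emeasure lebesgue (sector e \<rho> c - sector e \<rho> b)
      = emeasure lebesgue (sector e \<rho> c) - emeasure lebesgue (sector e \<rho> b)"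
  proof (rule emeasure_Diff)
    show "sector e \<rho> b \<subseteq> sector e \<rho> c"
      using assms by (auto simp: sector_def)
  qed (use fin in simp_all)
  also have "\<dots> = (ennreal (c ^ DIM(complex^'n)) - ennreal (b ^ DIM(complex^'n))) * emeasure lebesgue (sector e \<rho> 1)"
    using emeasure_sector_fin[of e \<rho>] assms
    by (simp add: emeasure_sector[of b e] emeasure_sector[of c e] mult.commute[of _ "emeasure lebesgue (sector e \<rho> 1)"] ennreal_right_diff_distrib)
  finally show ?thesis
    using assms by (simp add: ennreal_minus)
qed

lemma power_diff_le:
  fixes b c :: real
  assumes "0 \<le> b" "b \<le> c" "c \<le> 1"
  shows "c ^ n - b ^ n \<le> real n * (c - b)"
proof (induction n)
  case (Suc n)
  have "c ^ Suc n - b ^ Suc n = c * (c ^ n - b ^ n) + (c - b) * b ^ n"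
    by (simp add: algebra_simps)
  also have "\<dots> \<le> 1 * (c ^ n - b ^ n) + (c - b) * 1"
    using assms by (intro add_mono mult_right_mono mult_left_mono) (auto intro: power_mono power_le_one)
  finally show ?case
    using Suc.IH by (simp add: algebra_simps)
qed simp

text \<open>Summing over the shells where \<^term>\<open>1 - norm z\<close> is comparable to \<^term>\<open>t / 2 ^ k\<close>.\<close>

lemma mu_alpha_sector_shell_le:
  assumes a: "0 < a"
  shows "\<exists>C\<ge>0. \<forall>(e :: complex^'n) \<rho> t. 0 < t \<and> t \<le> 1 \<longrightarrow>
    emeasure (mu_alpha a) (sector e \<rho> 1 - sector e \<rho> (1 - t)) \<le> ennreal (C * t powr a) * emeasure lebesgue (sector e \<rho> 1)"
proof -
  define d where "d = DIM(complex^'n)"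
  define c where "c = 2 powr \<bar>a - 1\<bar> * real d"
  have c0: "0 \<le> c"
    by (simp add: c_def)
  \<comment> \<open>The shell of index k, of depth s = t/2^k, has density of order s^(a-1) and
    volume of order s, hence measure of order s^a. The geometric series with ratio 2^(-a) converges
    because \<open>a\<close> is positive.\<close>
  define C where "C = c * (1 / (1 - 1 / 2 powr a))"
  have geo: "1 / 2 powr a < 1"
    using a by simp
  have "emeasure (mu_alpha a) (sector e \<rho> 1 - sector e \<rho> (1 - t)) \<le> ennreal (C * t powr a) * emeasure lebesgue (sector e \<rho> 1)"
    if t: "0 < t" "t \<le> 1" for e :: "complex^'n" and \<rho> t
  proof -
    define V where "V = emeasure lebesgue (sector e \<rho> 1)"
    define L where "L k = sector e \<rho> (1 - t / 2 ^ Suc k) - sector e \<rho> (1 - t / 2 ^ k)" for k :: nat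
    have Lm [measurable]: "L k \<in> sets lebesgue" for k
      unfolding L_def by measurable
    have Lk: "emeasure (mu_alpha a) (L k) \<le> ennreal (c * t powr a * (1 / 2 powr a) ^ k) * V" for k
    proof -
      define s where "s = t / 2 ^ k"
      have s: "0 < s" "s \<le> 1"
        using t by (auto simp: s_def divide_le_eq intro: order_trans[OF _ one_le_power])
      have sS: "t / 2 ^ Suc k = s / 2"
        by (simp add: s_def)
      have "emeasure (mu_alpha a) (L k) \<le> ennreal (2 powr \<bar>a - 1\<bar> * s powr (a - 1)) * emeasure lebesgue (L k)"
      proof (rule mu_alpha_le)
        fix z
        assume z: "z \<in> L k" "norm z < 1"
        then have n: "1 - s \<le> norm z" "norm z < 1 - s / 2"
          unfolding L_def sS s_def[symmetric] by (auto simp: sector_def)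
        \<comment> \<open>On this shell 1 - |z|^2 lies between s/2 and 2s, so
          \<open>powr_comparable\<close> applies with constant 2.\<close>
        have "1 - (norm z)\<^sup>2 = (1 - norm z) * (1 + norm z)"
          by (simp add: power2_eq_square algebra_simps)
        moreover have "(1 - norm z) * (1 + norm z) \<le> s * 2"
          using n z s by (intro mult_mono) auto
        moreover have "s / 2 * 1 \<le> (1 - norm z) * (1 + norm z)"
          using n z s by (intro mult_mono) auto
        ultimately show "(1 - (norm z)\<^sup>2) powr (a - 1) \<le> 2 powr \<bar>a - 1\<bar> * s powr (a - 1)"
          using s by (intro powr_comparable) auto
      qed measurable
      also have "emeasure lebesgue (L k) = ennreal ((1 - s / 2) ^ d - (1 - s) ^ d) * V"
        unfolding L_def sS s_def[symmetric] d_def V_def using s by (intro emeasure_sector_shell) auto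
      also have "(1 - s / 2) ^ d - (1 - s) ^ d \<le> real d * ((1 - s / 2) - (1 - s))"
        using s by (intro power_diff_le) auto
      also have "\<dots> \<le> real d * s"
        using s by (intro mult_left_mono) auto
      finally have "emeasure (mu_alpha a) (L k) \<le> ennreal (2 powr \<bar>a - 1\<bar> * s powr (a - 1)) * (ennreal (real d * s) * V)"
        by (simp add: mult_left_mono mult_right_mono ennreal_leI)
      also have "\<dots> = ennreal (c * (s powr (a - 1) * s)) * V"
        using s by (simp add: c_def ennreal_mult ac_simps)
      also have "s powr (a - 1) * s = s powr a"
        using s powr_add[of s "a - 1" 1] by simp
      also have "s powr a = t powr a * (1 / 2 powr a) ^ k"
      proof -
        have "(2 ^ k) powr a = (2 powr a) ^ k" for a :: real
          by (simp add: powr_realpow[symmetric] powr_powr mult.commute)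
        then show ?thesis
          using t by (simp add: s_def powr_divide power_one_over)
      qed
      finally show ?thesis
        by (simp add: mult.assoc)
    qed
    have cover: "sector e \<rho> 1 - sector e \<rho> (1 - t) \<subseteq> (\<Union>k. L k)"
    proof
      fix z
      assume z: "z \<in> sector e \<rho> 1 - sector e \<rho> (1 - t)"
      then have "0 < (1 - norm z) / t"
        using t by (auto simp: sector_def)
      then obtain N where N: "(1 / 2) ^ N < (1 - norm z) / t"
        using real_arch_pow_inv[of "(1 - norm z) / t" "1/2"] by auto
      \<comment> \<open>\<open>m\<close> is not 0 because the point lies outside
        \<open>sector e \<rho> (1 - t)\<close>; the shell containing it has index
        \<open>m - 1\<close>.\<close>
      define m where "m = (LEAST N. norm z < 1 - t / 2 ^ N)"
      have "norm z < 1 - t / 2 ^ N"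
        using N t by (simp add: field_simps power_one_over)
      then have m: "norm z < 1 - t / 2 ^ m"
        unfolding m_def by (rule LeastI)
      then have "m \<noteq> 0"
        using z t by (auto simp: sector_def intro!: Nat.gr0I)
      then obtain k where k: "m = Suc k"
        by (metis not0_implies_Suc)
      then have "\<not> norm z < 1 - t / 2 ^ k"
        using not_less_Least[of k "\<lambda>N. norm z < 1 - t / 2 ^ N"] by (simp add: m_def[symmetric])
      then have "z \<in> L k"
        using z m k by (auto simp: L_def sector_def)
      then show "z \<in> (\<Union>k. L k)" by blast
    qed
    have "emeasure (mu_alpha a) (sector e \<rho> 1 - sector e \<rho> (1 - t)) \<le> emeasure (mu_alpha a) (\<Union>k. L k)"
      by (intro emeasure_mono cover) simp
    also have "\<dots> \<le> (\<Sum>k. emeasure (mu_alpha a) (L k))"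
      by (rule emeasure_subadditive_countably) auto
    also have "\<dots> \<le> (\<Sum>k. ennreal (c * t powr a * (1 / 2 powr a) ^ k) * V)"
      by (intro suminf_le Lk) auto
    also have "\<dots> = ennreal (\<Sum>k. c * t powr a * (1 / 2 powr a) ^ k) * V"
      using geo c0 by (simp add: suminf_ennreal2 summable_mult summable_geometric)
    also have "(\<Sum>k. c * t powr a * (1 / 2 powr a) ^ k) = C * t powr a"
      using geo by (simp add: suminf_mult summable_geometric suminf_geometric C_def)
    finally show ?thesis
      by (simp add: V_def)
  qed
  moreover have "0 \<le> C"
    using geo c0 by (simp add: C_def)
  ultimately show ?thesis by blast
qed

text \<open>As the centre has norm above \<open>1 - R\<close>, the points have norm above
  \<open>1 - 2 * R\<close>. The origin is excluded because its pseudo-distance to \<open>z\<close>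
  is \<open>norm z\<close>, which exceeds 1/2.\<close>

lemma pball_subset_sector_shell:
  assumes "norm z < 1" "1 - norm z < R" "R \<le> 1 / 2"
  shows "pball z R \<subseteq> sector (sgn z) R 1 - sector (sgn z) R (1 - 2 * R)"
proof
  fix w
  assume w: "w \<in> pball z R"
  have z: "z \<noteq> 0"
    using assms by auto
  have w0: "w \<noteq> 0"
    using w assms by (auto simp: pball_def pdist_def split: if_splits)
  have *: "norm w < 1" "\<bar>norm z - norm w\<bar> + cmod (1 - cinner (sgn z) (sgn w)) < R"
    using w by (auto simp: pball_def pdist_nonzero[OF z w0])
  have "\<bar>norm z - norm w\<bar> < R" "cmod (1 - cinner (sgn z) (sgn w)) < R"
    using *(2) norm_ge_zero[of "1 - cinner (sgn z) (sgn w)"] abs_ge_zero[of "norm z - norm w"]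
    by linarith+
  then show "w \<in> sector (sgn z) R 1 - sector (sgn z) R (1 - 2 * R)"
    using *(1) w0 assms by (auto simp: sector_def cmod_one_minus_cinner_commute[of "sgn z"])
qed

text \<open>The outermost shell of thickness \<open>R\<close> lies in the cap and holds at least the
  fraction \<open>R\<close> of the sector, because 1 - (1-R)^d \<ge> R. This leads from the sectors
  of the upper bounds to the caps of the lower bounds.\<close>

lemma emeasure_sector_le_cap:
  fixes e :: "complex^'n"
  assumes R: "0 < R" "R \<le> 1"
  shows "ennreal R * emeasure lebesgue (sector e R 1) \<le> emeasure lebesgue (cap e (2 * R))"
proof -
  have "(1 - R) ^ DIM(complex^'n) \<le> (1 - R) ^ 1"
    using R by (intro power_decreasing) (auto simp: Suc_le_eq)
  then have "ennreal R * emeasure lebesgue (sector e R 1)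
      \<le> ennreal (1 ^ DIM(complex^'n) - (1 - R) ^ DIM(complex^'n)) * emeasure lebesgue (sector e R 1)"
    by (intro mult_right_mono ennreal_leI) auto
  also have "\<dots> = emeasure lebesgue (sector e R 1 - sector e R (1 - R))"
    using R by (intro emeasure_sector_shell[symmetric]) auto
  also have "\<dots> \<le> emeasure lebesgue (cap e (2 * R))"
  proof (intro emeasure_mono subsetI)
    fix z
    assume z: "z \<in> sector e R 1 - sector e R (1 - R)"
    then have n: "z \<noteq> 0" "1 - R \<le> norm z" "norm z < 1" "cmod (1 - cinner (sgn z) e) < R"
      by (auto simp: sector_def)
    have "1 - cinner z e = of_real (1 - norm z) + of_real (norm z) * (1 - cinner (sgn z) e)"
      using n(1) by (simp add: sgn_div_norm cinner_scaleR_left algebra_simps)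
    then have "cmod (1 - cinner z e) \<le> cmod (of_real (1 - norm z)) + cmod (of_real (norm z) * (1 - cinner (sgn z) e))"
      by (simp only: norm_triangle_ineq)
    also have "cmod (of_real (1 - norm z)) = 1 - norm z"
      unfolding norm_of_real using n(3) by simp
    also have "cmod (of_real (norm z) * (1 - cinner (sgn z) e)) = norm z * cmod (1 - cinner (sgn z) e)"
      by (simp add: norm_mult)
    also have "norm z * cmod (1 - cinner (sgn z) e) \<le> 1 * cmod (1 - cinner (sgn z) e)"
      using n by (intro mult_right_mono) auto
    finally show "z \<in> cap e (2 * R)"
      using n by (simp add: cap_def)
  qed simp
  finally show ?thesis .
qed

text \<open>A copy of the cap, shrunk towards the origin by the factor \<open>s\<close>, fits into
  the pseudo-ball. It is confined to norms between \<open>s - \<rho>\<close> and \<open>s\<close>,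
  hence stays off the boundary, and the density on it is comparable to
  \<open>(1 - s) powr (a - 1)\<close>.\<close>

lemma mu_alpha_pball_ge:
  fixes z :: "complex^'n"
  assumes z: "z \<noteq> 0" and s: "1/4 \<le> s" "s < 1" and \<rho>: "0 < \<rho>" "\<rho> \<le> 1/16" "\<rho> \<le> 1 - s"
    and r: "\<bar>norm z - s\<bar> + 4 * \<rho> \<le> r"
  shows "ennreal ((1/4) powr \<bar>a - 1\<bar> * (1 - s) powr (a - 1) * (1/4) ^ DIM(complex^'n)) * emeasure lebesgue (cap (sgn z) \<rho>)
    \<le> emeasure (mu_alpha a) (pball z r)"
proof -
  define A where "A = (\<lambda>x. s *\<^sub>R x + 0) ` cap (sgn z) \<rho>"
  have A: "A = (*\<^sub>R) (1 / s) -` cap (sgn z) \<rho>"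
  proof (intro set_eqI iffI)
    fix x
    assume "x \<in> (*\<^sub>R) (1 / s) -` cap (sgn z) \<rho>"
    moreover have "x = s *\<^sub>R ((1 / s) *\<^sub>R x) + 0"
      using s by simp
    ultimately show "x \<in> A"
      unfolding A_def by blast
  qed (use s in \<open>auto simp: A_def\<close>)
  have [measurable]: "A \<in> sets lebesgue"
    unfolding A using measurable_sets[OF lebesgue_measurable_scaling[of "1 / s"] cap_sets] by simp
  have A_bounds: "norm x < s" "s - \<rho> < norm x" "x \<in> pball z r" if x: "x \<in> A" for x
  proof -
    obtain y where y: "x = s *\<^sub>R y" "norm y < 1" "cmod (1 - cinner y (sgn z)) < \<rho>"
      using x by (auto simp: A_def cap_def)
    have "cmod (cinner y (sgn z)) \<le> norm y"
      using cmod_cinner_le[of y "sgn z"] z by (simp add: norm_sgn)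
    moreover have "1 - cmod (cinner y (sgn z)) \<le> cmod (1 - cinner y (sgn z))"
      using norm_triangle_ineq2[of 1 "cinner y (sgn z)"] by simp
    ultimately have ny: "1 - \<rho> < norm y"
      using y(3) by simp
    then have y0: "y \<noteq> 0"
      using \<rho> by auto
    have nx: "norm x = s * norm y"
      using s by (simp add: y(1))
    show 1: "norm x < s"
      using y(2) s by (simp add: nx)
    have "s * (1 - norm y) \<le> 1 * (1 - norm y)"
      using s y(2) by (intro mult_right_mono) auto
    then have "s - norm x \<le> 1 - norm y"
      by (simp add: nx algebra_simps)
    then show 2: "s - \<rho> < norm x"
      using ny by simp
    have "of_real (norm y) * (1 - cinner (sgn y) (sgn z)) = (1 - cinner y (sgn z)) - of_real (1 - norm y)"
      using y0 by (simp add: sgn_div_norm[of y] cinner_scaleR_left algebra_simps)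
    then have "cmod (of_real (norm y) * (1 - cinner (sgn y) (sgn z))) \<le> cmod (1 - cinner y (sgn z)) + cmod (of_real (1 - norm y))"
      by (simp only: norm_triangle_ineq4)
    also have "cmod (of_real (1 - norm y)) = 1 - norm y"
      unfolding norm_of_real using y(2) by simp
    finally have "norm y * cmod (1 - cinner (sgn y) (sgn z)) < 2 * \<rho>"
      using y(3) ny by (simp add: norm_mult)
    \<comment> \<open>From \<rho> \<le> 1/16 the norm of \<open>y\<close> exceeds 15/16, and 2\<rho>
      divided by 15/16 is below 3\<rho>. Together with the radial error \<rho> this explains
      \<open>4 * \<rho>\<close> in the hypothesis on \<open>r\<close>.\<close>
    moreover have "15/16 * cmod (1 - cinner (sgn y) (sgn z)) \<le> norm y * cmod (1 - cinner (sgn y) (sgn z))"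
      using ny \<rho> by (intro mult_right_mono) auto
    ultimately have ang: "cmod (1 - cinner (sgn y) (sgn z)) < 3 * \<rho>"
      using \<rho> by simp
    have "sgn x = sgn y"
      using s by (simp add: y(1) sgn_scaleR)
    moreover have "x \<noteq> 0"
      using y0 s by (simp add: y(1))
    ultimately have "pdist z x < r"
      using z 1 2 r ang by (simp add: pdist_nonzero cmod_one_minus_cinner_commute[of "sgn z"])
    then show "x \<in> pball z r"
      using 1 s by (simp add: pball_def)
  qed
  have "ennreal ((1/4) powr \<bar>a - 1\<bar> * (1 - s) powr (a - 1)) * emeasure lebesgue A \<le> emeasure (mu_alpha a) A"
  proof (rule mu_alpha_ge)
    fix x
    assume x: "x \<in> A"
    have n: "norm x < s" "s - \<rho> < norm x"
      using A_bounds[OF x] by auto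
    have eq: "1 - (norm x)\<^sup>2 = (1 - norm x) * (1 + norm x)"
      by (simp add: power2_eq_square algebra_simps)
    have 1: "(1 - norm x) * (1 + norm x) \<le> (2 * (1 - s)) * 2"
      using n s \<rho> by (intro mult_mono) auto
    have 2: "(1 - s) * 1 \<le> (1 - norm x) * (1 + norm x)"
      using n s by (intro mult_mono) auto
    have "(1 - s) powr (a - 1) \<le> 4 powr \<bar>a - 1\<bar> * (1 - (norm x)\<^sup>2) powr (a - 1)"
      unfolding eq using 1 2 s by (intro powr_comparable) auto
    then have "(1/4) powr \<bar>a - 1\<bar> * (1 - s) powr (a - 1) \<le> (1 - (norm x)\<^sup>2) powr (a - 1)"
      by (simp add: powr_divide field_simps)
    then show "norm x < 1 \<and> (1/4) powr \<bar>a - 1\<bar> * (1 - s) powr (a - 1) \<le> (1 - (norm x)\<^sup>2) powr (a - 1)"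
      using n s by simp
  qed measurable
  also have "emeasure (mu_alpha a) A \<le> emeasure (mu_alpha a) (pball z r)"
    using A_bounds(3) by (intro emeasure_mono) (auto intro!: sets_completionI_sets)
  finally have le: "ennreal ((1/4) powr \<bar>a - 1\<bar> * (1 - s) powr (a - 1)) * emeasure lebesgue A \<le> emeasure (mu_alpha a) (pball z r)" .
  have "ennreal ((1/4) ^ DIM(complex^'n)) * emeasure lebesgue (cap (sgn z) \<rho>) \<le> emeasure lebesgue A"
    unfolding A_def emeasure_lebesgue_affine using s
    by (auto simp: ennreal_power[symmetric] intro!: mult_right_mono power_mono_ennreal ennreal_leI)
  then have "ennreal ((1/4) powr \<bar>a - 1\<bar> * (1 - s) powr (a - 1)) * (ennreal ((1/4) ^ DIM(complex^'n)) * emeasure lebesgue (cap (sgn z) \<rho>))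
      \<le> ennreal ((1/4) powr \<bar>a - 1\<bar> * (1 - s) powr (a - 1)) * emeasure lebesgue A"
    by (rule mult_left_mono) simp
  from order_trans[OF this le] show ?thesis
    by (simp only: mult.assoc[symmetric]) (simp add: ennreal_mult)
qed

text \<open>The angular term never exceeds 2, so the sector shell of width 3 and depth 1 is the
  whole ball without the origin.\<close>

lemma mu_alpha_ball_fin:
  assumes "0 < a"
  shows "emeasure (mu_alpha a) (ball 0 1 :: (complex^'n) set) < top"
proof -
  obtain e :: "complex^'n" where e: "norm e = 1"
    using vector_choose_size[of 1] by auto
  obtain C where C: "emeasure (mu_alpha a) (sector e 3 1 - sector e 3 (1 - 1)) \<le> ennreal (C * 1 powr a) * emeasure lebesgue (sector e 3 1)"
    using mu_alpha_sector_shell_le[OF assms, where 'n = 'n] by (metis order_refl zero_less_one)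
  have "cmod (1 - cinner (sgn z) e) < 3" if "z \<noteq> 0" for z
    using norm_triangle_ineq4[of 1 "cinner (sgn z) e"] cmod_cinner_le[of "sgn z" e] e that by (simp add: norm_sgn)
  then have "ball 0 1 = insert 0 (sector e 3 1 - sector e 3 (1 - 1))"
    by (auto simp: sector_def)
  moreover have "emeasure (mu_alpha a) {0 :: complex^'n} = 0"
    using mu_alpha_le[of "{0 :: complex^'n}" a 1] by (simp add: emeasure_completion)
  ultimately have "emeasure (mu_alpha a) (ball 0 1 :: (complex^'n) set) \<le> 0 + emeasure (mu_alpha a) (sector e 3 1 - sector e 3 (1 - 1))"
    using emeasure_subadditive[of "{0}" "mu_alpha a" "sector e 3 1 - sector e 3 (1 - 1)"] by simp
  also have "\<dots> < top"
    using le_less_trans[OF C] emeasure_sector_fin[of e 3] by (simp add: ennreal_mult_less_top)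
  finally show ?thesis .
qed

lemma mu_alpha_ball_pos: "0 < emeasure (mu_alpha a) (ball 0 1 :: (complex^'n) set)"
proof (rule ccontr)
  assume "\<not> ?thesis"
  then have "(\<integral>\<^sup>+z\<in>ball 0 1. ennreal ((1 - (norm z)\<^sup>2) powr (a - 1)) \<partial>(lebesgue :: (complex^'n) measure)) = 0"
    by (simp add: emeasure_mu_alpha)
  then have "AE z in (lebesgue :: (complex^'n) measure). indicator (ball 0 1) z * ennreal ((1 - (norm z)\<^sup>2) powr (a - 1)) = 0"
    by (subst (asm) nn_integral_0_iff_AE) (simp_all add: mu_alpha_density_measurable mult.commute)
  then have "AE z in (lebesgue :: (complex^'n) measure). z \<notin> ball 0 1"
  proof (rule eventually_mono)
    fix z :: "complex^'n"
    assume *: "indicator (ball 0 1) z * ennreal ((1 - (norm z)\<^sup>2) powr (a - 1)) = 0"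
    show "z \<notin> ball 0 1"
    proof
      assume z: "z \<in> ball 0 1"
      then have "(norm z)\<^sup>2 < 1"
        by (simp add: power_less_one_iff)
      then show False
        using * z by (auto simp: ennreal_eq_0_iff not_le)
    qed
  qed
  then have "(ball 0 1 :: (complex^'n) set) \<in> null_sets lebesgue"
    by (subst AE_iff_null_sets) simp_all
  then show False
    using open_not_negligible[of "ball 0 1 :: (complex^'n) set"] by (simp add: negligible_iff_null_sets)
qed

text \<open>For small \<open>r\<close>, a sector shell from above and a shrunken cap from below give
  bounds of order r^(a-1) times the volume of a cap, and caps are doubling. For large
  \<open>r\<close> the measure is bounded below, while the enlargement has at most the finite total
  mass.\<close>

lemma mu_alpha_pball_doubling:
  assumes a: "0 < a"
  shows "\<exists>D<top. \<forall>(z :: complex^'n) r. norm z < 1 \<and> 1 - norm z < r \<longrightarrow>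
    emeasure (mu_alpha a) (pball z (10 * r)) \<le> D * emeasure (mu_alpha a) (pball z r)"
proof -
  define d where "d = DIM(complex^'n)"
  define m0 where "m0 = emeasure lebesgue (ball 0 1 :: (complex^'n) set)"
  define \<mu>0 where "\<mu>0 = emeasure (mu_alpha a) (ball 0 1 :: (complex^'n) set)"
  obtain C where C: "0 \<le> C" "\<And>(e :: complex^'n) \<rho> t. 0 < t \<Longrightarrow> t \<le> 1 \<Longrightarrow>
      emeasure (mu_alpha a) (sector e \<rho> 1 - sector e \<rho> (1 - t)) \<le> ennreal (C * t powr a) * emeasure lebesgue (sector e \<rho> 1)"
    using mu_alpha_sector_shell_le[OF a, where 'n = 'n] by blast
  have le_\<mu>0: "emeasure (mu_alpha a) (pball z r) \<le> \<mu>0" for z :: "complex^'n" and r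
    unfolding \<mu>0_def by (intro emeasure_mono pball_subset_ball) simp
  \<comment> \<open>The threshold 1/20 makes \<open>10 * r \<le> 1/2\<close>, as
    \<open>pball_subset_sector_shell\<close> requires, and the depth \<open>20 * r\<close> at most
    1.\<close>
  have small: "\<exists>D1<top. \<forall>(z :: complex^'n) r. norm z < 1 \<and> 1 - norm z < r \<and> r \<le> 1/20 \<longrightarrow>
    emeasure (mu_alpha a) (pball z (10 * r)) \<le> D1 * emeasure (mu_alpha a) (pball z r)"
  proof -
    define c where "c = (1/4) powr \<bar>a - 1\<bar> * (1/4) powr \<bar>a - 1\<bar> * (1/4) ^ d"
    define c' where "c' = C * 20 powr a / 10 * 320 ^ d"
    have c: "0 < c" "0 \<le> c'"
      using C by (auto simp: c_def c'_def)
    have "emeasure (mu_alpha a) (pball z (10 * r)) \<le> ennreal (c' / c) * emeasure (mu_alpha a) (pball z r)"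
      if z: "norm z < 1" "1 - norm z < r" and r: "r \<le> 1/20" for z :: "complex^'n" and r
    proof -
      have z0: "z \<noteq> 0" and r0: "0 < r"
        using z r by auto
      define e where "e = sgn z"
      have e: "norm e = 1"
        using z0 by (simp add: e_def norm_sgn)
      \<comment> \<open>Moving inwards by r/4 keeps \<open>1 - s\<close> comparable to
        \<open>r\<close>; with a cap of radius r/16 the condition of
        \<open>mu_alpha_pball_ge\<close> reads r/4 + r/4 \<le> r.\<close>
      define s where "s = norm z - r / 4"
      have "ennreal ((1/4) powr \<bar>a - 1\<bar> * (1 - s) powr (a - 1) * (1/4) ^ d) * emeasure lebesgue (cap e (r / 16))
          \<le> emeasure (mu_alpha a) (pball z r)"
        unfolding d_def e_def using z r r0 by (intro mu_alpha_pball_ge z0) (auto simp: s_def)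
      moreover have "r powr (a - 1) \<le> 4 powr \<bar>a - 1\<bar> * (1 - s) powr (a - 1)"
        using z r r0 by (intro powr_comparable) (auto simp: s_def)
      then have "(1/4) powr \<bar>a - 1\<bar> * r powr (a - 1) \<le> (1 - s) powr (a - 1)"
        by (simp add: powr_divide field_simps)
      then have "c * r powr (a - 1) \<le> (1/4) powr \<bar>a - 1\<bar> * (1 - s) powr (a - 1) * (1/4) ^ d"
        by (simp add: c_def mult.assoc mult_left_mono)
      ultimately have lower: "ennreal (c * r powr (a - 1)) * emeasure lebesgue (cap e (r / 16)) \<le> emeasure (mu_alpha a) (pball z r)"
        by (meson ennreal_leI mult_right_mono order_trans zero_le)
      have "emeasure (mu_alpha a) (pball z (10 * r)) \<le> emeasure (mu_alpha a) (sector e (10 * r) 1 - sector e (10 * r) (1 - 20 * r))"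
        unfolding e_def using pball_subset_sector_shell[of z "10 * r"] z r by (intro emeasure_mono) auto
      also have "\<dots> \<le> ennreal (C * (20 * r) powr a) * emeasure lebesgue (sector e (10 * r) 1)"
        using C(2)[of "20 * r" e "10 * r"] r r0 by simp
      \<comment> \<open>The factor \<open>10 * r\<close> is split off for
        \<open>emeasure_sector_le_cap\<close>; what is left has the exponent \<open>a - 1\<close> of
        the lower bound.\<close>
      also have "C * (20 * r) powr a = C * 20 powr a / 10 * r powr (a - 1) * (10 * r)"
        using r0 powr_add[of r "a - 1" 1] by (simp add: powr_mult)
      also have "ennreal (C * 20 powr a / 10 * r powr (a - 1) * (10 * r)) * emeasure lebesgue (sector e (10 * r) 1)
          = ennreal (C * 20 powr a / 10 * r powr (a - 1)) * (ennreal (10 * r) * emeasure lebesgue (sector e (10 * r) 1))"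
        using C(1) r0 by (subst ennreal_mult) (auto simp: mult.assoc)
      also have "ennreal (10 * r) * emeasure lebesgue (sector e (10 * r) 1) \<le> emeasure lebesgue (cap e (20 * r))"
        using emeasure_sector_le_cap[of "10 * r" e] r r0 by simp
      \<comment> \<open>320 is the quotient of the radii \<open>20 * r\<close> and
        \<open>r / 16\<close>.\<close>
      also have "emeasure lebesgue (cap e (20 * r)) \<le> ennreal (320 ^ d) * emeasure lebesgue (cap e (r / 16))"
      proof -
        have "ennreal (320 ^ d) * (ennreal ((1/320) ^ d) * emeasure lebesgue (cap e (20 * r)))
            \<le> ennreal (320 ^ d) * emeasure lebesgue (cap e (r / 16))"
          using cap_homothety[OF e, of "1/320" "20 * r"] by (intro mult_left_mono) (simp_all add: d_def)
        moreover have "ennreal (320 ^ d) * ennreal ((1/320) ^ d) = 1"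
          by (simp add: ennreal_mult[symmetric] power_mult_distrib[symmetric])
        ultimately show ?thesis
          by (simp add: mult.assoc[symmetric])
      qed
      also have "ennreal (C * 20 powr a / 10 * r powr (a - 1)) * (ennreal (320 ^ d) * emeasure lebesgue (cap e (r / 16)))
          = ennreal (c' / c) * (ennreal (c * r powr (a - 1)) * emeasure lebesgue (cap e (r / 16)))"
      proof -
        have "C * 20 powr a / 10 * r powr (a - 1) * 320 ^ d = c' / c * (c * r powr (a - 1))"
          using c by (simp add: c'_def)
        moreover have "ennreal (C * 20 powr a / 10 * r powr (a - 1)) * ennreal (320 ^ d)
            = ennreal (C * 20 powr a / 10 * r powr (a - 1) * 320 ^ d)"
          using C by (intro ennreal_mult[symmetric]) auto
        moreover have "ennreal (c' / c) * ennreal (c * r powr (a - 1)) = ennreal (c' / c * (c * r powr (a - 1)))"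
          using c by (intro ennreal_mult[symmetric]) auto
        ultimately show ?thesis
          by (simp only: mult.assoc[symmetric])
      qed
      also have "\<dots> \<le> ennreal (c' / c) * emeasure (mu_alpha a) (pball z r)"
        by (rule mult_left_mono[OF lower]) simp
      finally show ?thesis
        by (simp add: mult_left_mono)
    qed
    then show ?thesis
      by (intro exI[of _ "ennreal (c' / c)"]) auto
  qed
  have large: "\<exists>c>0. \<forall>(z :: complex^'n) r. norm z < 1 \<and> 1 - norm z < r \<and> 1/20 < r \<longrightarrow>
    c \<le> emeasure (mu_alpha a) (pball z r)"
  proof -
    define c where "c = (1/4) powr \<bar>a - 1\<bar> * (1/80) powr \<bar>a - 1\<bar> * (1/4) ^ d * (1/640) ^ d"
    have c: "0 < c"
      by (simp add: c_def)
    have "min \<mu>0 (ennreal c * m0) \<le> emeasure (mu_alpha a) (pball z r)"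
      if z: "norm z < 1" "1 - norm z < r" and r: "1/20 < r" for z :: "complex^'n" and r
    proof (cases "z = 0")
      case True
      then show ?thesis
        using z by (simp add: pball_zero_eq_ball \<mu>0_def)
    next
      case False
      define e where "e = sgn z"
      have e: "norm e = 1"
        using False by (simp add: e_def norm_sgn)
      \<comment> \<open>The shift keeps away from the origin and from the boundary. If
        \<open>norm z < 1/2\<close>, then \<open>r > 1/2\<close> affords a shift by 1/4; otherwise
        1/80 + 4/320 = 1/40 is below \<open>r\<close>.\<close>
      define s where "s = (if norm z < 1/2 then norm z + 1/4 else norm z - 1/80)"
      have s: "1/4 \<le> s" "1/80 \<le> 1 - s" "\<bar>norm z - s\<bar> + 4 * (1/320) \<le> r"
        using z r by (auto simp: s_def)
      have "ennreal ((1/4) powr \<bar>a - 1\<bar> * (1 - s) powr (a - 1) * (1/4) ^ d) * emeasure lebesgue (cap e (1/320))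
          \<le> emeasure (mu_alpha a) (pball z r)"
        unfolding d_def e_def using s by (intro mu_alpha_pball_ge False) auto
      moreover have "1 powr (a - 1) \<le> 80 powr \<bar>a - 1\<bar> * (1 - s) powr (a - 1)"
        using s by (intro powr_comparable) auto
      then have "(1/80) powr \<bar>a - 1\<bar> \<le> (1 - s) powr (a - 1)"
        by (simp add: powr_divide field_simps)
      then have "(1/4) powr \<bar>a - 1\<bar> * (1/80) powr \<bar>a - 1\<bar> * (1/4) ^ d \<le> (1/4) powr \<bar>a - 1\<bar> * (1 - s) powr (a - 1) * (1/4) ^ d"
        by (intro mult_right_mono mult_left_mono) auto
      ultimately have 1: "ennreal ((1/4) powr \<bar>a - 1\<bar> * (1/80) powr \<bar>a - 1\<bar> * (1/4) ^ d) * emeasure lebesgue (cap e (1/320))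
          \<le> emeasure (mu_alpha a) (pball z r)"
        by (meson ennreal_leI mult_right_mono order_trans zero_le)
      \<comment> \<open>A cap of radius 2 is the whole ball, and the ratio 1/640 takes it to radius
        1/320.\<close>
      have "ennreal ((1/640) ^ d) * m0 \<le> emeasure lebesgue (cap e (1/320))"
        using cap_homothety[OF e, of "1/640" 2] by (simp add: cap_eq_ball[OF e] m0_def d_def)
      then have "ennreal ((1/4) powr \<bar>a - 1\<bar> * (1/80) powr \<bar>a - 1\<bar> * (1/4) ^ d) * (ennreal ((1/640) ^ d) * m0)
          \<le> ennreal ((1/4) powr \<bar>a - 1\<bar> * (1/80) powr \<bar>a - 1\<bar> * (1/4) ^ d) * emeasure lebesgue (cap e (1/320))"
        by (rule mult_left_mono) simp
      from order_trans[OF this 1] have "ennreal c * m0 \<le> emeasure (mu_alpha a) (pball z r)"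
        unfolding c_def by (subst ennreal_mult) (auto simp: mult.assoc)
      then show ?thesis
        by (simp add: min.coboundedI2)
    qed
    moreover have "m0 \<noteq> 0"
      using open_not_negligible[of "ball 0 1 :: (complex^'n) set"]
      by (auto simp: negligible_iff_null_sets null_sets_def m0_def)
    then have "0 < min \<mu>0 (ennreal c * m0)"
      using c mu_alpha_ball_pos[where 'n = 'n] by (simp add: \<mu>0_def ennreal_zero_less_mult_iff zero_less_iff_neq_zero)
    ultimately show ?thesis by blast
  qed
  obtain D1 where D1: "D1 < top" "\<And>(z :: complex^'n) r. norm z < 1 \<Longrightarrow> 1 - norm z < r \<Longrightarrow> r \<le> 1/20 \<Longrightarrow>
    emeasure (mu_alpha a) (pball z (10 * r)) \<le> D1 * emeasure (mu_alpha a) (pball z r)"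
    using small by blast
  obtain c where c: "0 < c" "\<And>(z :: complex^'n) r. norm z < 1 \<Longrightarrow> 1 - norm z < r \<Longrightarrow> 1/20 < r \<Longrightarrow>
    c \<le> emeasure (mu_alpha a) (pball z r)"
    using large by blast
  have \<mu>0: "\<mu>0 < top"
    unfolding \<mu>0_def by (rule mu_alpha_ball_fin[OF a])
  have c_fin: "c < top"
    using c(2)[of 0 2] le_\<mu>0[of 0 2] \<mu>0 by auto
  have "emeasure (mu_alpha a) (pball z (10 * r)) \<le> (D1 + \<mu>0 / c) * emeasure (mu_alpha a) (pball z r)"
    if z: "norm z < 1" "1 - norm z < r" for z :: "complex^'n" and r
  proof (cases "r \<le> 1/20")
    case True
    show ?thesis
      by (rule order_trans[OF D1(2)[OF z True]]) (intro mult_right_mono, auto)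
  next
    case False
    have "emeasure (mu_alpha a) (pball z (10 * r)) \<le> \<mu>0"
      by (rule le_\<mu>0)
    also have "\<mu>0 = \<mu>0 / c * c"
      using c(1) c_fin by (simp add: ennreal_divide_times)
    also have "\<dots> \<le> (D1 + \<mu>0 / c) * emeasure (mu_alpha a) (pball z r)"
      using c(2)[OF z] False by (intro mult_mono) auto
    finally show ?thesis .
  qed
  moreover have "D1 + \<mu>0 / c < top"
    using D1(1) \<mu>0 c(1) by (auto simp: ennreal_divide_eq_top_iff less_top[symmetric])
  ultimately show ?thesis by blast
qed

text \<open>By doubling, a null pseudo-ball would have null enlargements of every size, and one of
  these is the unit ball.\<close>

lemma mu_alpha_pball_pos:
  assumes a: "0 < a" and z: "norm (z :: complex^'n) < 1" "1 - norm z < r"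
  shows "0 < emeasure (mu_alpha a) (pball z r)"
proof (rule ccontr)
  assume not_pos: "\<not> ?thesis"
  obtain D where D: "\<And>(z :: complex^'n) r. norm z < 1 \<Longrightarrow> 1 - norm z < r \<Longrightarrow>
      emeasure (mu_alpha a) (pball z (10 * r)) \<le> D * emeasure (mu_alpha a) (pball z r)"
    using mu_alpha_pball_doubling[OF a, where 'n = 'n] by blast
  have r: "0 < r"
    using z by simp
  have "emeasure (mu_alpha a) (pball z (10 ^ k * r)) = 0" for k
  proof (induction k)
    case (Suc k)
    have "1 * r \<le> 10 ^ k * r"
      using r by (intro mult_right_mono one_le_power) auto
    then have "1 - norm z < 10 ^ k * r"
      using z by linarith
    from D[OF z(1) this] show ?case
      by (simp add: Suc.IH mult.assoc)
  qed (use not_pos in simp)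
  moreover obtain k where "3 / r < 10 ^ k"
    using real_arch_pow[of 10 "3 / r"] by auto
  then have "pball z (10 ^ k * r) = ball 0 1"
    using r by (intro pball_eq_ball z) (simp add: field_simps)
  ultimately show False
    using mu_alpha_ball_pos[of a, where 'n = 'n] by (metis less_irrefl)
qed

section \<open>Factorization\<close>

definition pball_index :: "((complex^'n) \<times> real) set" where
  "pball_index = {j. norm (fst j) < 1 \<and> 1 - norm (fst j) < snd j}"

lemma pballs_eq_image: "pballs = (\<lambda>j. pball (fst j) (snd j)) ` pball_index"
  by (auto simp: set_eq_iff pballs_def pball_index_def image_iff Bex_def split_paired_Ex)

lemma ball_in_pballs: "ball 0 1 \<in> pballs"
  using pball_zero_eq_ball[of 2] by (force simp: pballs_def)

lemma pballs_subset_ball: "B \<in> pballs \<Longrightarrow> B \<subseteq> ball 0 1"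
  using pball_subset_ball by (auto simp: pballs_def)

lemma pballs_sets: "B \<in> pballs \<Longrightarrow> B \<in> sets lebesgue"
  by (auto simp: pballs_def intro!: sets_completionI_sets)

lemma pballs_pos: "0 < a \<Longrightarrow> B \<in> pballs \<Longrightarrow> 0 < emeasure (mu_alpha a) B"
  by (auto simp: pballs_def intro!: mu_alpha_pball_pos)

lemma AE_mu_alpha_ball: "AE z in mu_alpha a. z \<in> ball 0 1"
  unfolding mu_alpha_def by (subst AE_density[OF mu_alpha_density_measurable]) (auto simp: indicator_def intro!: AE_I2)

lemma emeasure_mu_alpha_UNIV:
  "emeasure (mu_alpha a) (UNIV :: (complex^'n) set) = emeasure (mu_alpha a) (ball 0 1 :: (complex^'n) set)"
  by (rule emeasure_eq_AE) (use AE_mu_alpha_ball in auto)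

lemma pballs_fin:
  assumes "0 < a" "B \<in> pballs"
  shows "emeasure (mu_alpha a) B < top"
  using emeasure_mono[OF pballs_subset_ball[OF assms(2)], of "mu_alpha a"] mu_alpha_ball_fin[OF assms(1)]
  by (auto intro: le_less_trans)

lemma doubling_basis_pball:
  assumes a: "0 < a"
  shows "\<exists>D. doubling_basis (mu_alpha a :: (complex^'n) measure) pball_index
    (\<lambda>j. pball (fst j) (snd j)) (\<lambda>j. pball (fst j) (10 * snd j)) snd D"
proof -
  obtain D where D: "D < top" "\<And>(z :: complex^'n) r. norm z < 1 \<Longrightarrow> 1 - norm z < r \<Longrightarrow>
      emeasure (mu_alpha a) (pball z (10 * r)) \<le> D * emeasure (mu_alpha a) (pball z r)"
    using mu_alpha_pball_doubling[OF a, where 'n = 'n] by blast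
  have "doubling_basis (mu_alpha a :: (complex^'n) measure) pball_index
    (\<lambda>j. pball (fst j) (snd j)) (\<lambda>j. pball (fst j) (10 * snd j)) snd D"
  proof
    fix i j :: "(complex^'n) \<times> real"
    assume "i \<in> pball_index" "j \<in> pball_index" "snd j \<le> snd i"
      "pball (fst i) (snd i) \<inter> pball (fst j) (snd j) \<noteq> {}"
    then show "pball (fst j) (snd j) \<subseteq> pball (fst i) (10 * snd i)"
      by (intro pball_engulf) (auto simp: pball_index_def)
  next
    fix J :: "((complex^'n) \<times> real) set"
    show "\<exists>J0\<subseteq>J. countable J0 \<and> (\<Union>j\<in>J0. pball (fst j) (snd j)) = (\<Union>j\<in>J. pball (fst j) (snd j))"
      using Lindelof_pball[of J] by (simp add: case_prod_beta)
  next
    fix i :: "(complex^'n) \<times> real"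
    assume i: "i \<in> pball_index"
    have "(fst i, 10 * snd i) \<in> pball_index"
      using i norm_ge_zero[of "fst i"] by (auto simp: pball_index_def)
    then show "\<exists>j\<in>pball_index. pball (fst j) (snd j) = pball (fst i) (10 * snd i)"
      by (intro bexI[of _ "(fst i, 10 * snd i)"]) auto
  next
    have "(0, 2) \<in> (pball_index :: ((complex^'n) \<times> real) set)"
      by (simp add: pball_index_def)
    moreover have "AE x in (mu_alpha a :: (complex^'n) measure). x \<in> pball 0 2"
      using AE_mu_alpha_ball by (simp add: pball_zero_eq_ball)
    ultimately show "\<exists>i\<in>pball_index. AE x in (mu_alpha a :: (complex^'n) measure). x \<in> pball (fst i) (snd i)"
      by force
  qed (use D mu_alpha_ball_fin[OF a, where 'n = 'n] mu_alpha_pball_pos[OF a] in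
      \<open>auto simp: pball_index_def emeasure_mu_alpha_UNIV intro!: sets_completionI_sets\<close>)
  then show ?thesis by blast
qed

section \<open>Averages, the \<open>B1\<close> condition and degenerate weights\<close>

lemma max_alpha_le_iff: "max_alpha a f z \<le> c \<longleftrightarrow> (\<forall>B\<in>pballs. z \<in> B \<longrightarrow> avg a B (\<lambda>x. ennreal \<bar>f x\<bar>) \<le> c)"
  unfolding max_alpha_def by (auto simp: SUP_le_iff indicator_def)

lemma avg_cong_AE:
  assumes "B \<in> pballs" "AE z in mu_alpha a. z \<in> ball 0 1 \<longrightarrow> f z = g z"
  shows "avg a B f = avg a B g"
proof -
  have "(\<integral>\<^sup>+z\<in>B. f z \<partial>mu_alpha a) = (\<integral>\<^sup>+z\<in>B. g z \<partial>mu_alpha a)"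
    using assms(2) pballs_subset_ball[OF assms(1)]
    by (intro nn_integral_cong_AE) (auto simp: indicator_def elim!: eventually_mono)
  then show ?thesis by (simp add: avg_def)
qed

lemma avg_le_cmult:
  assumes "(\<lambda>z. g z * indicator B z) \<in> borel_measurable lebesgue"
    and "AE z in mu_alpha a. z \<in> B \<longrightarrow> f z \<le> c * g z"
  shows "avg a B f \<le> c * avg a B g"
proof -
  have "(\<integral>\<^sup>+z\<in>B. f z \<partial>mu_alpha a) \<le> (\<integral>\<^sup>+z. c * (g z * indicator B z) \<partial>mu_alpha a)"
    using assms(2) by (intro nn_integral_mono_AE) (auto simp: indicator_def elim!: eventually_mono)
  also have "\<dots> = c * (\<integral>\<^sup>+z\<in>B. g z \<partial>mu_alpha a)"
    using assms(1) by (intro nn_integral_cmult) (simp add: measurable_cong_sets[OF sets_mu_alpha refl])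
  finally show ?thesis
    by (simp add: avg_def ennreal_times_divide divide_right_mono_ennreal)
qed

text \<open>\<open>weight\<close> constrains \<open>w\<close> on the unit ball only, so
  \<open>w\<close> itself may fail to be measurable; the product with the indicator of a subset of
  the ball is safe.\<close>

lemma weight_measurable:
  assumes "weight w" "B \<in> pballs"
  shows "(\<lambda>z. ennreal (w z) * indicator B z) \<in> borel_measurable lebesgue"
proof -
  have [measurable]: "(\<lambda>z. indicator (ball 0 1) z *\<^sub>R w z) \<in> borel_measurable lebesgue" "B \<in> sets lebesgue"
    using assms by (simp_all add: weight_def set_borel_measurable_def pballs_sets)
  have "(\<lambda>z. ennreal (w z) * indicator B z) = (\<lambda>z. ennreal (indicator (ball 0 1) z *\<^sub>R w z) * indicator B z)"
    using pballs_subset_ball[OF assms(2)] by (auto simp: indicator_def fun_eq_iff)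
  also have "\<dots> \<in> borel_measurable lebesgue"
    by measurable
  finally show ?thesis .
qed

text \<open>Finiteness of \<open>c\<close> settles \<open>y = 0\<close>: the quotient is then finite
  only for \<open>x = 0\<close>, where \<open>0 / 0 = 0\<close>.\<close>

lemma divide_le_iff_le_times:
  fixes x y c :: ennreal
  assumes "y < top" "c < top"
  shows "x / y \<le> c \<longleftrightarrow> x \<le> c * y"
proof (cases "y = 0")
  case True
  then show ?thesis
    using assms by (auto simp: top_unique)
next
  case False
  then show ?thesis
    using assms by (subst ennreal_mult_le_mult_iff[of y "x / y" c, symmetric])
      (auto simp: ennreal_times_divide mult.commute[of y] ennreal_mult_divide_eq)
qed

lemma B1_iff:
  "B1 a w \<longleftrightarrow> (\<exists>C<top. AE z in mu_alpha a. z \<in> ball 0 1 \<longrightarrow> max_alpha a w z \<le> C * ennreal (w z))"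
proof -
  have "B1 a w \<longleftrightarrow> (\<exists>C<top. AE z in mu_alpha a. z \<in> ball 0 1 \<longrightarrow> max_alpha a w z / ennreal (w z) \<le> C)"
    unfolding B1_def B1_const_def by (auto simp: Inf_less_iff)
  also have "\<dots> \<longleftrightarrow> (\<exists>C<top. AE z in mu_alpha a. z \<in> ball 0 1 \<longrightarrow> max_alpha a w z \<le> C * ennreal (w z))"
    by (intro ex_cong1 conj_cong refl) (simp add: divide_le_iff_le_times)
  finally show ?thesis .
qed

lemma weight_one: "weight (\<lambda>_ :: complex^'n. 1)"
proof -
  have "set_integrable lebesgue K (\<lambda>_. 1 :: real)" if "compact K" for K :: "(complex^'n) set"
    using lmeasurable_compact[OF that] by (simp add: set_integrable_def fmeasurable_def)
  then show ?thesis
    by (simp add: weight_def set_borel_measurable_def borel_measurable_indicator)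
qed

lemma AE_exists_in:
  assumes "AE z in M. P z" "A \<in> sets M" "0 < emeasure M A"
  obtains z where "z \<in> A" "P z"
proof (rule ccontr)
  assume "\<not> thesis"
  with that have "AE z in M. z \<notin> A"
    using assms(1) by (auto elim!: eventually_mono)
  then have "emeasure M A = 0"
    using assms(2) by (simp add: AE_iff_null_sets[symmetric] null_setsD1)
  then show False
    using assms(3) by simp
qed

lemma avg_eq_0_iff:
  assumes "0 < a" "B \<in> pballs" "(\<lambda>z. f z * indicator B z) \<in> borel_measurable lebesgue"
  shows "avg a B f = 0 \<longleftrightarrow> (AE z in mu_alpha a. z \<in> B \<longrightarrow> f z = 0)"
proof -
  have "avg a B f = 0 \<longleftrightarrow> (\<integral>\<^sup>+z\<in>B. f z \<partial>mu_alpha a) = 0"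
    using pballs_fin[OF assms(1,2)] by (simp add: avg_def less_top[symmetric])
  also have "\<dots> \<longleftrightarrow> (AE z in mu_alpha a. f z * indicator B z = 0)"
    using assms(3) by (intro nn_integral_0_iff_AE) (simp add: measurable_cong_sets[OF sets_mu_alpha refl])
  also have "\<dots> \<longleftrightarrow> (AE z in mu_alpha a. z \<in> B \<longrightarrow> f z = 0)"
    by (intro AE_cong) (auto simp: indicator_def)
  finally show ?thesis .
qed

text \<open>The dual average is infinite here, but it is multiplied by the vanishing average of
  \<open>w\<close>, and \<open>0 * top = 0\<close>.\<close>

lemma Bp_of_AE_zero:
  assumes "AE z in mu_alpha a. z \<in> ball 0 1 \<longrightarrow> w z = 0"
  shows "Bp a p w"
proof -
  have "avg a B (\<lambda>z. ennreal (w z)) = 0" if "B \<in> pballs" for B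
  proof -
    have "avg a B (\<lambda>z. ennreal (w z)) = avg a B (\<lambda>_. 0)"
      using assms by (intro avg_cong_AE that) (auto elim!: eventually_mono)
    then show ?thesis by (simp add: avg_def)
  qed
  then have "(SUP B\<in>pballs. avg a B (\<lambda>z. ennreal (w z)) * epow (avg a B (dual_w p w)) (p - 1)) \<le> 0"
    by (intro SUP_least) simp
  then show ?thesis
    unfolding Bp_def by (rule le_less_trans) simp
qed

text \<open>Provides one null set for all pseudo-balls at once and a positive real constant by which
  one can divide.\<close>

lemma B1_avg_bound:
  assumes "weight w" "B1 a w"
  obtains C where "0 < C" "AE z in mu_alpha a. \<forall>B\<in>pballs. z \<in> B \<longrightarrow> avg a B (\<lambda>x. ennreal (w x)) \<le> ennreal (C * w z)"
proof -
  obtain C where C: "C < top" "AE z in mu_alpha a. z \<in> ball 0 1 \<longrightarrow> max_alpha a w z \<le> C * ennreal (w z)"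
    using assms(2) by (auto simp: B1_iff)
  obtain c where c: "C = ennreal c" "0 \<le> c"
    using C(1) by (cases C) auto
  have nonneg: "0 \<le> w z" if "z \<in> ball 0 1" for z
    using assms(1) that by (auto simp: weight_def)
  have "avg a B (\<lambda>x. ennreal \<bar>w x\<bar>) = avg a B (\<lambda>x. ennreal (w x))" if "B \<in> pballs" for B
    using nonneg by (intro avg_cong_AE that AE_I2) auto
  then have "AE z in mu_alpha a. \<forall>B\<in>pballs. z \<in> B \<longrightarrow> avg a B (\<lambda>x. ennreal (w x)) \<le> ennreal ((c + 1) * w z)"
    using C(2)
  proof (elim eventually_mono, intro ballI impI)
    fix z B
    assume *: "z \<in> ball 0 1 \<longrightarrow> max_alpha a w z \<le> C * ennreal (w z)" and B: "B \<in> pballs" "z \<in> B"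
      and eq: "\<And>B. B \<in> pballs \<Longrightarrow> avg a B (\<lambda>x. ennreal \<bar>w x\<bar>) = avg a B (\<lambda>x. ennreal (w x))"
    have z: "z \<in> ball 0 1"
      using pballs_subset_ball B by blast
    have "avg a B (\<lambda>x. ennreal \<bar>w x\<bar>) \<le> C * ennreal (w z)"
      using * z B by (simp add: max_alpha_le_iff)
    then have "avg a B (\<lambda>x. ennreal (w x)) \<le> C * ennreal (w z)"
      by (simp only: eq[OF B(1)])
    also have "\<dots> \<le> ennreal ((c + 1) * w z)"
      using c nonneg[OF z] by (simp add: ennreal_mult[symmetric] ennreal_leI algebra_simps)
    finally show "avg a B (\<lambda>x. ennreal (w x)) \<le> ennreal ((c + 1) * w z)" .
  qed
  then show thesis
    using c by (intro that[of "c + 1"]) auto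
qed

text \<open>At almost every point of \<open>B\<close> the weight is 0, so \<open>B1\<close> makes
  the averages over all pseudo-balls through such a point vanish, among them the average over the
  whole ball.\<close>

lemma B1_vanishing:
  assumes a: "0 < a" and w: "weight w" "B1 a w" and B: "B \<in> pballs" "avg a B (\<lambda>z. ennreal (w z)) = 0"
  shows "AE z in mu_alpha a. z \<in> ball 0 1 \<longrightarrow> w z = 0"
proof -
  have zero: "z \<in> ball 0 1 \<Longrightarrow> ennreal (w z) = 0 \<longleftrightarrow> w z = 0" for z
    using w(1) by (auto simp: weight_def)
  obtain C where C: "0 < C" "AE z in mu_alpha a. \<forall>B\<in>pballs. z \<in> B \<longrightarrow> avg a B (\<lambda>x. ennreal (w x)) \<le> ennreal (C * w z)"
    using B1_avg_bound[OF w] by blast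
  have "AE z in mu_alpha a. z \<in> B \<longrightarrow> ennreal (w z) = 0"
    using B(2) avg_eq_0_iff[OF a B(1) weight_measurable[OF w(1) B(1)]] by simp
  with C(2) have "AE z in mu_alpha a. (\<forall>B\<in>pballs. z \<in> B \<longrightarrow> avg a B (\<lambda>x. ennreal (w x)) \<le> ennreal (C * w z)) \<and>
      (z \<in> B \<longrightarrow> ennreal (w z) = 0)"
    by eventually_elim blast
  moreover have "B \<in> sets (mu_alpha a)"
    using pballs_sets[OF B(1)] by simp
  ultimately obtain z where z: "z \<in> B" "(\<forall>B\<in>pballs. z \<in> B \<longrightarrow> avg a B (\<lambda>x. ennreal (w x)) \<le> ennreal (C * w z)) \<and>
      (z \<in> B \<longrightarrow> ennreal (w z) = 0)"
    using pballs_pos[OF a B(1)] by (rule AE_exists_in)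
  have zb: "z \<in> ball 0 1"
    using z(1) pballs_subset_ball[OF B(1)] by blast
  have "avg a (ball 0 1) (\<lambda>x. ennreal (w x)) = 0"
    using z zb zero[OF zb] ball_in_pballs by auto
  then have "AE z in mu_alpha a. z \<in> ball 0 1 \<longrightarrow> ennreal (w z) = 0"
    using avg_eq_0_iff[OF a ball_in_pballs weight_measurable[OF w(1) ball_in_pballs]] by simp
  then show ?thesis
    by (rule eventually_mono) (use zero in blast)
qed

text \<open>With u and v the averages of \<open>w1\<close> and \<open>w2\<close>, the two factors
  are at most (v/C2)^(1-p) u and (u/C1)^(-1) v^(p-1). All powers of u and v cancel, leaving C1
  C2^(p-1). The cancellation needs positive averages, hence the case distinction.\<close>

lemma Bp_of_factorization:
  fixes w :: "complex^'n \<Rightarrow> real"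
  assumes a: "0 < a" and p: "1 < p"
    and w1: "weight w1" "B1 a w1" and w2: "weight w2" "B1 a w2"
    and w: "\<forall>z\<in>ball 0 1. w z = w1 z * w2 z powr (1 - p)"
  shows "Bp a p w"
proof (cases "\<exists>B\<in>pballs. avg a B (\<lambda>z. ennreal (w1 z)) = 0 \<or> avg a B (\<lambda>z. ennreal (w2 z)) = 0")
  case True
  then have "(AE z in mu_alpha a. z \<in> ball 0 1 \<longrightarrow> w1 z = 0) \<or> (AE z in mu_alpha a. z \<in> ball 0 1 \<longrightarrow> w2 z = 0)"
    using B1_vanishing[OF a w1] B1_vanishing[OF a w2] by blast
  \<comment> \<open>This also covers the vanishing of \<open>w2\<close>, because
    \<open>0 powr (1 - p) = 0\<close>.\<close>
  then have "AE z in mu_alpha a. z \<in> ball 0 1 \<longrightarrow> w z = 0"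
    using w by (auto elim!: eventually_mono)
  then show ?thesis
    by (rule Bp_of_AE_zero)
next
  case False
  obtain C1 where C1: "0 < C1" "AE z in mu_alpha a. \<forall>B\<in>pballs. z \<in> B \<longrightarrow> avg a B (\<lambda>x. ennreal (w1 x)) \<le> ennreal (C1 * w1 z)"
    using B1_avg_bound[OF w1] by blast
  obtain C2 where C2: "0 < C2" "AE z in mu_alpha a. \<forall>B\<in>pballs. z \<in> B \<longrightarrow> avg a B (\<lambda>x. ennreal (w2 x)) \<le> ennreal (C2 * w2 z)"
    using B1_avg_bound[OF w2] by blast
  have "avg a B (\<lambda>z. ennreal (w z)) * epow (avg a B (dual_w p w)) (p - 1) \<le> ennreal (C1 * C2 powr (p - 1))"
    if B: "B \<in> pballs" for B
  proof -
    have both: "AE z in mu_alpha a. z \<in> B \<longrightarrow> avg a B (\<lambda>x. ennreal (w1 x)) \<le> ennreal (C1 * w1 z) \<and>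
        avg a B (\<lambda>x. ennreal (w2 x)) \<le> ennreal (C2 * w2 z)"
      using C1(2) C2(2) by eventually_elim (use B in blast)
    moreover have "B \<in> sets (mu_alpha a)"
      using pballs_sets[OF B] by simp
    \<comment> \<open>One point at which both real-valued bounds hold shows that the averages are
      finite.\<close>
    ultimately obtain z0 where "z0 \<in> B" "z0 \<in> B \<longrightarrow> avg a B (\<lambda>x. ennreal (w1 x)) \<le> ennreal (C1 * w1 z0) \<and>
        avg a B (\<lambda>x. ennreal (w2 x)) \<le> ennreal (C2 * w2 z0)"
      using pballs_pos[OF a B] by (rule AE_exists_in)
    then have fin: "avg a B (\<lambda>x. ennreal (w1 x)) < top" "avg a B (\<lambda>x. ennreal (w2 x)) < top"
      by (auto intro: le_less_trans)
    have nz: "avg a B (\<lambda>x. ennreal (w1 x)) \<noteq> 0" "avg a B (\<lambda>x. ennreal (w2 x)) \<noteq> 0"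
      using False B by auto
    have real: "\<exists>r. x = ennreal r \<and> 0 < r" if "x < top" "x \<noteq> 0" for x
      using that by (cases x) (auto simp: less_le)
    obtain u where u: "avg a B (\<lambda>x. ennreal (w1 x)) = ennreal u" "0 < u"
      using real[OF fin(1) nz(1)] by blast
    obtain v where v: "avg a B (\<lambda>x. ennreal (w2 x)) = ennreal v" "0 < v"
      using real[OF fin(2) nz(2)] by blast
    have bounds: "AE z in mu_alpha a. z \<in> B \<longrightarrow> u / C1 \<le> w1 z \<and> v / C2 \<le> w2 z"
      using both
    proof (rule eventually_mono, intro impI)
      fix z
      assume *: "z \<in> B \<longrightarrow> avg a B (\<lambda>x. ennreal (w1 x)) \<le> ennreal (C1 * w1 z) \<and>
        avg a B (\<lambda>x. ennreal (w2 x)) \<le> ennreal (C2 * w2 z)" and z: "z \<in> B"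
      have "u \<le> C1 * w1 z" "v \<le> C2 * w2 z"
        using * z u v by (auto simp: ennreal_le_iff2)
      then show "u / C1 \<le> w1 z \<and> v / C2 \<le> w2 z"
        using C1 C2 by (simp add: divide_le_eq mult.commute)
    qed
    have "avg a B (\<lambda>z. ennreal (w z)) \<le> ennreal ((v / C2) powr (1 - p)) * avg a B (\<lambda>z. ennreal (w1 z))"
    proof (intro avg_le_cmult weight_measurable w1 B)
      show "AE z in mu_alpha a. z \<in> B \<longrightarrow> ennreal (w z) \<le> ennreal ((v / C2) powr (1 - p)) * ennreal (w1 z)"
        using bounds
      proof (rule eventually_mono, intro impI)
        fix z
        assume *: "z \<in> B \<longrightarrow> u / C1 \<le> w1 z \<and> v / C2 \<le> w2 z" and z: "z \<in> B"
        have pos: "0 < u / C1" "0 < v / C2"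
          using u v C1 C2 by auto
        have "w2 z powr (1 - p) \<le> (v / C2) powr (1 - p)"
          using * z pos p by (intro powr_mono2') auto
        moreover have "w z = w1 z * w2 z powr (1 - p)"
          using w z pballs_subset_ball[OF B] by blast
        moreover have w1z: "0 \<le> w1 z"
          using * z pos by auto
        ultimately have "w z \<le> (v / C2) powr (1 - p) * w1 z"
          by (simp add: mult.commute mult_left_mono)
        then show "ennreal (w z) \<le> ennreal ((v / C2) powr (1 - p)) * ennreal (w1 z)"
          using w1z by (simp add: ennreal_mult[symmetric] ennreal_leI)
      qed
    qed
    also have "\<dots> = ennreal ((v / C2) powr (1 - p) * u)"
      using u by (simp add: ennreal_mult)
    finally have 1: "avg a B (\<lambda>z. ennreal (w z)) \<le> ennreal ((v / C2) powr (1 - p) * u)" .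
    have "avg a B (dual_w p w) \<le> ennreal ((u / C1) powr (- 1 / (p - 1))) * avg a B (\<lambda>z. ennreal (w2 z))"
    proof (intro avg_le_cmult weight_measurable w2 B)
      show "AE z in mu_alpha a. z \<in> B \<longrightarrow> dual_w p w z \<le> ennreal ((u / C1) powr (- 1 / (p - 1))) * ennreal (w2 z)"
        using bounds
      proof (rule eventually_mono, intro impI)
        fix z
        assume *: "z \<in> B \<longrightarrow> u / C1 \<le> w1 z \<and> v / C2 \<le> w2 z" and z: "z \<in> B"
        have pos: "0 < u / C1" "0 < v / C2"
          using u v C1 C2 by auto
        have wpos: "0 < w1 z" "0 < w2 z"
          using * z pos by auto
        have weq: "w z = w1 z * w2 z powr (1 - p)"
          using w z pballs_subset_ball[OF B] by blast
        have "(1 - p) * (- 1 / (p - 1)) = 1"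
          using p by (simp add: field_simps)
        then have "w z powr (- 1 / (p - 1)) = w1 z powr (- 1 / (p - 1)) * w2 z"
          using wpos by (simp add: weq powr_mult powr_powr)
        also have "w1 z powr (- 1 / (p - 1)) \<le> (u / C1) powr (- 1 / (p - 1))"
          using * z pos p by (intro powr_mono2') auto
        finally have "w z powr (- 1 / (p - 1)) \<le> (u / C1) powr (- 1 / (p - 1)) * w2 z"
          using wpos by (simp add: mult_right_mono)
        moreover have "w z \<noteq> 0"
          using wpos by (simp add: weq)
        ultimately show "dual_w p w z \<le> ennreal ((u / C1) powr (- 1 / (p - 1))) * ennreal (w2 z)"
          using wpos by (simp add: dual_w_def ennreal_mult[symmetric] ennreal_leI)
      qed
    qed
    also have "\<dots> = ennreal ((u / C1) powr (- 1 / (p - 1)) * v)"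
      using v by (simp add: ennreal_mult)
    finally have "epow (avg a B (dual_w p w)) (p - 1) \<le> epow (ennreal ((u / C1) powr (- 1 / (p - 1)) * v)) (p - 1)"
      using p by (intro epow_mono) auto
    also have "\<dots> = ennreal ((u / C1) powr (- 1) * v powr (p - 1))"
      using u v C1 p by (simp add: powr_mult powr_powr)
    finally have "avg a B (\<lambda>z. ennreal (w z)) * epow (avg a B (dual_w p w)) (p - 1)
        \<le> ennreal ((v / C2) powr (1 - p) * u) * ennreal ((u / C1) powr (- 1) * v powr (p - 1))"
      using 1 by (intro mult_mono) auto
    also have "\<dots> = ennreal (((v / C2) powr (1 - p) * u) * ((u / C1) powr (- 1) * v powr (p - 1)))"
      using u v by (intro ennreal_mult[symmetric]) auto
    also have "((v / C2) powr (1 - p) * u) * ((u / C1) powr (- 1) * v powr (p - 1)) = C1 * C2 powr (p - 1)"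
    proof -
      have "(v / C2) powr (1 - p) = C2 powr (p - 1) / v powr (p - 1)"
        using v C2 powr_minus_divide[of "v / C2" "p - 1"] by (simp add: powr_divide)
      moreover have "(u / C1) powr (- 1) = C1 / u"
        using u C1 by (simp add: powr_minus_divide)
      ultimately show ?thesis
        using u v C1 C2 by simp
    qed
    finally show ?thesis .
  qed
  then have "(SUP B\<in>pballs. avg a B (\<lambda>z. ennreal (w z)) * epow (avg a B (dual_w p w)) (p - 1)) \<le> ennreal (C1 * C2 powr (p - 1))"
    by (rule SUP_least)
  then show ?thesis
    unfolding Bp_def by (rule le_less_trans) simp
qed

section \<open>From \<open>Bp\<close> to a factorization\<close>

lemma weightI:
  fixes w :: "complex^'n \<Rightarrow> real"
  assumes meas: "set_borel_measurable lebesgue (ball 0 1) w"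
    and nonneg: "\<And>z. z \<in> ball 0 1 \<Longrightarrow> 0 \<le> w z"
    and fin: "(\<integral>\<^sup>+z\<in>ball 0 1. ennreal (w z) \<partial>mu_alpha a) < top"
  shows "weight w"
proof -
  have "set_integrable lebesgue K w" if K: "compact K" "K \<subseteq> ball 0 1" for K
  proof (cases "K = {}")
    case False
    have [measurable]: "K \<in> sets lebesgue"
      using K(1) by (simp add: borel_compact sets_completionI_sets)
    have Kpos: "0 < 1 - (norm z)\<^sup>2" if "z \<in> K" for z
      using K(2) that by (auto simp: power_less_one_iff)
    have "continuous_on K (\<lambda>z. (1 - (norm z)\<^sup>2) powr (a - 1))"
      using Kpos by (intro continuous_intros) force+
    then obtain z0 where z0: "z0 \<in> K" "\<And>z. z \<in> K \<Longrightarrow> (1 - (norm z0)\<^sup>2) powr (a - 1) \<le> (1 - (norm z)\<^sup>2) powr (a - 1)"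
      using continuous_attains_inf[OF K(1) False] by blast
    \<comment> \<open>The density has a positive minimum on a compact subset of the ball, so a
      finite \<open>mu_alpha\<close> integral gives Lebesgue integrability there.\<close>
    define c where "c = (1 - (norm z0)\<^sup>2) powr (a - 1)"
    have c: "0 < c"
      using Kpos[OF z0(1)] by (simp add: c_def)
    have wm [measurable]: "(\<lambda>z. indicator (ball 0 1) z *\<^sub>R w z) \<in> borel_measurable lebesgue"
      using meas by (simp add: set_borel_measurable_def)
    have eq: "indicator K z *\<^sub>R w z = indicator K z *\<^sub>R (indicator (ball 0 1) z *\<^sub>R w z)" for z
      using K(2) by (auto simp: indicator_def)
    have wm2: "(\<lambda>z. ennreal (w z) * indicator (ball 0 1) z) \<in> borel_measurable lebesgue"
    proof -
      have "(\<lambda>z. ennreal (w z) * indicator (ball 0 1) z) = (\<lambda>z. ennreal (indicator (ball 0 1) z *\<^sub>R w z))"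
        by (auto simp: indicator_def fun_eq_iff)
      then show ?thesis using wm by simp
    qed
    have "ennreal c * (\<integral>\<^sup>+z. ennreal (norm (indicator K z *\<^sub>R w z)) \<partial>lebesgue)
        = (\<integral>\<^sup>+z. ennreal c * ennreal (norm (indicator K z *\<^sub>R w z)) \<partial>lebesgue)"
      unfolding eq using wm by (intro nn_integral_cmult[symmetric]) measurable
    also have "\<dots> \<le> (\<integral>\<^sup>+z. indicator (ball 0 1) z * ennreal ((1 - (norm z)\<^sup>2) powr (a - 1)) *
        (ennreal (w z) * indicator (ball 0 1) z) \<partial>lebesgue)"
    proof (intro nn_integral_mono)
      fix z :: "complex^'n"
      show "ennreal c * ennreal (norm (indicator K z *\<^sub>R w z))
        \<le> indicator (ball 0 1) z * ennreal ((1 - (norm z)\<^sup>2) powr (a - 1)) * (ennreal (w z) * indicator (ball 0 1) z)"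
      proof (cases "z \<in> K")
        case True
        then have "z \<in> ball 0 1" using K(2) by blast
        then show ?thesis
          using True z0(2)[OF True] nonneg[of z] by (auto simp: c_def intro!: mult_right_mono ennreal_leI)
      qed simp
    qed
    also have "\<dots> = (\<integral>\<^sup>+z\<in>ball 0 1. ennreal (w z) \<partial>mu_alpha a)"
      unfolding mu_alpha_def by (rule nn_integral_density[symmetric, OF mu_alpha_density_measurable wm2])
    finally have "ennreal c * (\<integral>\<^sup>+z. ennreal (norm (indicator K z *\<^sub>R w z)) \<partial>lebesgue) < top"
      using fin by (rule le_less_trans)
    then have "(\<integral>\<^sup>+z. ennreal (norm (indicator K z *\<^sub>R w z)) \<partial>lebesgue) < top"
      using c by (auto simp: ennreal_mult_less_top)
    moreover have "(\<lambda>z. indicator K z *\<^sub>R w z) \<in> borel_measurable lebesgue"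
      unfolding eq by measurable
    ultimately show ?thesis
      unfolding set_integrable_def by (intro integrableI_bounded) (auto simp: infinity_ennreal_def)
  qed (simp add: set_integrable_def)
  then show ?thesis
    using meas nonneg by (simp add: weight_def)
qed

text \<open>Integrability comes for free: the whole ball is a pseudo-ball through every point, so
  the bound at one good point makes the average over it finite.\<close>

lemma B1_weightI:
  fixes w :: "complex^'n \<Rightarrow> real"
  assumes a: "0 < a" and meas: "set_borel_measurable lebesgue (ball 0 1) w"
    and nonneg: "\<And>z. z \<in> ball 0 1 \<Longrightarrow> 0 \<le> w z"
    and C: "C < top" "AE z in mu_alpha a. z \<in> ball 0 1 \<longrightarrow> max_alpha a w z \<le> C * ennreal (w z)"
  shows "weight w" "B1 a w"
proof -
  show "B1 a w"
    using C by (auto simp: B1_iff)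
  obtain z where z: "z \<in> ball 0 1" "z \<in> ball 0 1 \<longrightarrow> max_alpha a w z \<le> C * ennreal (w z)"
    using AE_exists_in[OF C(2), of "ball 0 1"] mu_alpha_ball_pos[of a, where 'n = 'n] by auto
  then have "avg a (ball 0 1) (\<lambda>x. ennreal \<bar>w x\<bar>) \<le> C * ennreal (w z)"
    using ball_in_pballs by (auto simp: max_alpha_le_iff)
  also have "\<dots> < top"
    using C(1) by (simp add: ennreal_mult_less_top)
  also have "avg a (ball 0 1) (\<lambda>x. ennreal \<bar>w x\<bar>) = avg a (ball 0 1) (\<lambda>x. ennreal (w x))"
    using nonneg by (intro avg_cong_AE ball_in_pballs AE_I2) auto
  finally have "(\<integral>\<^sup>+z\<in>ball 0 1. ennreal (w z) \<partial>mu_alpha a) < top"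
    using mu_alpha_ball_fin[OF a, where 'n = 'n]
    by (auto simp: avg_def ennreal_divide_eq_top_iff less_top[symmetric])
  then show "weight w"
    by (intro weightI meas nonneg)
qed

lemma factorization_of_AE_zero:
  fixes w :: "complex^'n \<Rightarrow> real"
  assumes a: "0 < a" and w: "weight w" "AE z in mu_alpha a. z \<in> ball 0 1 \<longrightarrow> w z = 0"
  shows "B1 a w" "B1 a (\<lambda>_ :: complex^'n. 1)"
proof -
  have "avg a B (\<lambda>x. ennreal \<bar>w x\<bar>) = avg a B (\<lambda>x. 0)" if "B \<in> pballs" for B
    using w(2) by (intro avg_cong_AE that) (auto elim!: eventually_mono)
  then have "max_alpha a w z \<le> 0" for z
    unfolding max_alpha_le_iff by (simp add: avg_def)
  then show "B1 a w"
    unfolding B1_iff by (intro exI[of _ 0]) simp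
  have "avg a B (\<lambda>x. ennreal \<bar>1\<bar>) \<le> 1" if "B \<in> pballs" for B :: "(complex^'n) set"
    using pballs_pos[OF a that] pballs_fin[OF a that] pballs_sets[OF that] by (simp add: avg_def)
  then have "max_alpha a (\<lambda>_. 1) z \<le> 1" for z :: "complex^'n"
    unfolding max_alpha_le_iff by simp
  then show "B1 a (\<lambda>_ :: complex^'n. 1)"
    unfolding B1_iff by (intro exI[of _ 1]) simp
qed

text \<open>Over the unit ball the average of \<open>w\<close> is not 0, so the dual average is
  finite. As \<open>dual_w\<close> is infinite where \<open>w\<close> vanishes, that set is
  null.\<close>

lemma Bp_AE_pos:
  fixes w :: "complex^'n \<Rightarrow> real"
  assumes a: "0 < a" and p: "1 < p" and w: "weight w" and Bp: "Bp a p w"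
    and nz: "\<not> (AE z in mu_alpha a. z \<in> ball 0 1 \<longrightarrow> w z = 0)"
  shows "AE z in mu_alpha a. z \<in> ball 0 1 \<longrightarrow> 0 < w z"
proof -
  have nonneg: "0 \<le> w z" if "z \<in> ball 0 1" for z
    using w that by (auto simp: weight_def)
  have zero: "z \<in> ball 0 1 \<Longrightarrow> ennreal (w z) = 0 \<longleftrightarrow> w z = 0" for z
    using nonneg by simp
  have "avg a (ball 0 1) (\<lambda>z. ennreal (w z)) \<noteq> 0"
    using nz avg_eq_0_iff[OF a ball_in_pballs weight_measurable[OF w ball_in_pballs]] zero
    by (auto elim!: eventually_mono)
  moreover have "avg a (ball 0 1) (\<lambda>z. ennreal (w z)) * epow (avg a (ball 0 1) (dual_w p w)) (p - 1) < top"
    using Bp unfolding Bp_def by (rule le_less_trans[OF SUP_upper[OF ball_in_pballs]])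
  ultimately have "avg a (ball 0 1) (dual_w p w) < top"
    by (auto simp: ennreal_mult_less_top)
  then have fin: "(\<integral>\<^sup>+z\<in>ball 0 1. dual_w p w z \<partial>mu_alpha a) \<noteq> top"
    using mu_alpha_ball_fin[OF a, where 'n = 'n] by (auto simp: avg_def ennreal_top_divide split: if_splits)
  have [measurable]: "(\<lambda>z. ennreal (w z) * indicator (ball 0 1) z) \<in> borel_measurable (mu_alpha a)"
    using weight_measurable[OF w ball_in_pballs] by (simp add: measurable_cong_sets[OF sets_mu_alpha refl])
  define N where "N = {z. ennreal (w z) * indicator (ball 0 1) z = 0} \<inter> ball 0 1"
  have N_sets [measurable]: "N \<in> sets (mu_alpha a)"
  proof -
    have "{z \<in> space (mu_alpha a). ennreal (w z) * indicator (ball 0 1) z = 0} \<in> sets (mu_alpha a)"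
      by measurable
    then show ?thesis
      unfolding N_def by (intro sets.Int) simp_all
  qed
  have "top * emeasure (mu_alpha a) N = (\<integral>\<^sup>+z. top * indicator N z \<partial>mu_alpha a)"
    by (rule nn_integral_cmult_indicator[symmetric]) measurable
  also have "\<dots> \<le> (\<integral>\<^sup>+z\<in>ball 0 1. dual_w p w z \<partial>mu_alpha a)"
    using zero by (intro nn_integral_mono) (auto simp: N_def indicator_def dual_w_def)
  finally have "emeasure (mu_alpha a) N = 0"
    using fin by (auto simp: top_unique ennreal_top_mult split: if_splits)
  then have "AE z in mu_alpha a. z \<notin> N"
    using N_sets by (intro AE_not_in) (simp add: null_sets_def)
  then show ?thesis
    using nonneg by (auto simp: N_def less_le elim!: eventually_mono)
qed

lemma factorization_of_Bp:
  fixes w :: "complex^'n \<Rightarrow> real"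
  assumes a: "0 < a" and p: "1 < p" and w: "weight w" and Bp: "Bp a p w"
    and pos: "AE z in mu_alpha a. z \<in> ball 0 1 \<longrightarrow> 0 < w z"
  shows "\<exists>w1 w2 :: complex^'n \<Rightarrow> real. weight w1 \<and> weight w2 \<and> B1 a w1 \<and> B1 a w2 \<and>
        (\<forall>z\<in>ball 0 1. w z = w1 z * w2 z powr (1 - p))"
proof -
  define M where "M = (mu_alpha a :: (complex^'n) measure)"
  have sets_M [measurable_cong]: "sets M = sets lebesgue"
    by (simp add: M_def)
  have nonneg: "0 \<le> w z" if "z \<in> ball 0 1" for z
    using w that by (auto simp: weight_def)
  have wm [measurable]: "(\<lambda>z. indicator (ball 0 1) z *\<^sub>R w z) \<in> borel_measurable lebesgue"
    using w by (simp add: weight_def set_borel_measurable_def)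
  \<comment> \<open>\<open>v\<close> is a version of \<open>w\<close> that is measurable and
    positive on the whole space, with default value 1 off the ball and on the null set of
    zeros.\<close>
  define v where "v z = (if 0 < indicator (ball 0 1) z *\<^sub>R w z then indicator (ball 0 1) z *\<^sub>R w z else 1)" for z
  define \<sigma> where "\<sigma> z = v z powr (- 1 / (p - 1))" for z
  have v_meas [measurable]: "v \<in> borel_measurable M"
    unfolding v_def by measurable
  have \<sigma>_meas [measurable]: "\<sigma> \<in> borel_measurable M"
    unfolding \<sigma>_def by measurable
  have v_pos: "0 < v z" for z
    by (simp add: v_def)
  have AE_M: "AE z in M. z \<in> ball 0 1 \<and> w z = v z"
    using pos AE_mu_alpha_ball[of a] unfolding M_def by eventually_elim (simp add: v_def)
  define q where "q = p / (p - 1)"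
  define A where "A = (SUP B\<in>pballs. avg a B (\<lambda>z. ennreal (w z)) * epow (avg a B (dual_w p w)) (p - 1))"
  obtain D where "doubling_basis M pball_index (\<lambda>j. pball (fst j) (snd j)) (\<lambda>j. pball (fst j) (10 * snd j)) snd D"
    using doubling_basis_pball[OF a, where 'n = 'n] unfolding M_def by blast
  then interpret db: doubling_basis M pball_index "\<lambda>j. pball (fst j) (snd j)" "\<lambda>j. pball (fst j) (10 * snd j)" snd D .
  have avg_average: "avg a (pball (fst j) (snd j)) f = db.average M f j" for f j
    by (simp add: avg_def db.average_def M_def)
  interpret muckenhoupt M pball_index "\<lambda>j. pball (fst j) (snd j)" "\<lambda>j. pball (fst j) (10 * snd j)" snd D p q v \<sigma> A
  proof
    show "1 < p" by (rule p)
    show "1 < q" "1 / p + 1 / q = 1"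
      using p by (simp_all add: q_def field_simps)
    show "A < top"
      using Bp by (simp add: Bp_def A_def)
    fix j :: "(complex^'n) \<times> real"
    assume j: "j \<in> pball_index"
    let ?B = "pball (fst j) (snd j)"
    have B: "?B \<in> pballs"
      using j by (auto simp: pballs_eq_image)
    have [measurable]: "?B \<in> sets M"
      by (rule db.B_sets[OF j])
    let ?m = "emeasure M ?B" and ?W = "emeasure (density M v) ?B" and ?S = "emeasure (density M \<sigma>) ?B"
    have m: "0 < ?m" "?m < top"
      using db.B_pos[OF j] db.B_fin[OF j] by auto
    have W: "avg a ?B (\<lambda>z. ennreal (w z)) = ?W / ?m"
    proof -
      have "avg a ?B (\<lambda>z. ennreal (w z)) = avg a ?B (\<lambda>z. ennreal (v z))"
        using AE_M unfolding M_def by (intro avg_cong_AE B) (elim eventually_mono, simp)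
      then show ?thesis
        by (simp add: avg_def M_def[symmetric] emeasure_density)
    qed
    have S: "avg a ?B (dual_w p w) = ?S / ?m"
    proof -
      have "dual_w p w z = ennreal (\<sigma> z)" if "w z = v z" for z
        using that v_pos[of z] by (simp add: dual_w_def \<sigma>_def)
      then have "avg a ?B (dual_w p w) = avg a ?B (\<lambda>z. ennreal (\<sigma> z))"
        using AE_M unfolding M_def by (intro avg_cong_AE B) (elim eventually_mono, simp)
      then show ?thesis
        by (simp add: avg_def M_def[symmetric] emeasure_density)
    qed
    have "?W / ?m * epow (?S / ?m) (p - 1) \<le> A"
      unfolding A_def W[symmetric] S[symmetric] by (rule SUP_upper[OF B])
    then have "?W / ?m * epow (?S / ?m) (p - 1) * epow ?m p \<le> A * epow ?m p"
      by (rule mult_right_mono) simp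
    also have "?W / ?m * epow (?S / ?m) (p - 1) * epow ?m p = (?W / ?m * ?m) * epow (?S / ?m * ?m) (p - 1)"
    proof -
      have "epow ?m p = ?m * epow ?m (p - 1)"
        using epow_add[of ?m 1 "p - 1"] by simp
      then show ?thesis
        by (simp only: epow_mult ac_simps)
    qed
    also have "?W / ?m * ?m = ?W"
      using m by (simp add: ennreal_divide_times)
    also have "?S / ?m * ?m = ?S"
      using m by (simp add: ennreal_divide_times)
    finally show "?W * epow ?S (p - 1) \<le> A * epow ?m p" .
  qed (auto simp: \<sigma>_def v_pos)
  obtain \<eta> C where \<eta> [measurable]: "\<eta> \<in> borel_measurable M" and C: "C < top" and ge1: "\<And>x. 1 \<le> \<eta> x"
    and fin: "AE x in M. \<eta> x < top"
    and m1: "\<And>x. db.maxop M \<eta> x \<le> C * \<eta> x"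
    and m2: "\<And>x. db.maxop M (\<lambda>y. v y * epow (\<eta> y) (p - 1)) x \<le> C * (v x * epow (\<eta> x) (p - 1))"
    using Jones_factor by blast
  \<comment> \<open>The default 1 on the null set where \<open>\<eta>\<close> is infinite keeps
    \<open>w2\<close> at least 1 everywhere.\<close>
  define w2 where "w2 z = (if \<eta> z < top then enn2real (\<eta> z) else 1)" for z
  \<comment> \<open>Built from \<open>w\<close> instead of \<open>v\<close>, so that the
    factorization holds at every point of the ball and not just almost everywhere.\<close>
  define w1 where "w1 z = w z * w2 z powr (p - 1)" for z
  have w2_ge1: "1 \<le> w2 z" for z
    using ge1[of z] by (cases "\<eta> z") (auto simp: w2_def)
  have \<eta>_leb [measurable]: "\<eta> \<in> borel_measurable lebesgue"
    using \<eta> by (simp add: measurable_cong_sets[OF sets_M refl])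
  have w2_meas [measurable]: "w2 \<in> borel_measurable lebesgue"
    unfolding w2_def by measurable
  have AE2: "AE z in M. z \<in> ball 0 1 \<and> ennreal (w2 z) = \<eta> z \<and> ennreal (w1 z) = v z * epow (\<eta> z) (p - 1)"
    using AE_M fin
  proof eventually_elim
    case (elim z)
    have "ennreal (w2 z) = \<eta> z"
      using elim(2) by (simp add: w2_def)
    moreover have "ennreal (w1 z) = v z * epow (ennreal (w2 z)) (p - 1)"
      using elim(1) w2_ge1[of z] v_pos[of z] by (simp add: w1_def ennreal_mult)
    ultimately show ?case
      using elim(1) by simp
  qed
  \<comment> \<open>\<open>max_alpha\<close> sees a function only through its averages, so it equals
    \<open>maxop\<close> of any extended-valued function that agrees almost everywhere.\<close>
  have transfer: "AE z in M. z \<in> ball 0 1 \<longrightarrow> max_alpha a u z \<le> C * ennreal (u z)"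
    if u: "\<And>z. z \<in> ball 0 1 \<Longrightarrow> 0 \<le> u z" and g: "AE z in M. ennreal (u z) = g z"
      and bound: "\<And>z. db.maxop M g z \<le> C * g z" for u :: "complex^'n \<Rightarrow> real" and g
  proof -
    have "avg a B (\<lambda>x. ennreal \<bar>u x\<bar>) = avg a B g" if "B \<in> pballs" for B
      using g u unfolding M_def by (intro avg_cong_AE that) (auto elim!: eventually_mono)
    then have "max_alpha a u z = (SUP B\<in>pballs. indicator B z * avg a B g)" for z
      by (simp add: max_alpha_def cong: SUP_cong)
    also have "(SUP B\<in>pballs. indicator B z * avg a B g) = db.maxop M g z" for z
      unfolding db.maxop_def pballs_eq_image image_image avg_average ..
    finally have eq: "max_alpha a u z = db.maxop M g z" for z .
    show ?thesis
      using g by (rule eventually_mono) (use bound in \<open>simp add: eq\<close>)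
  qed
  have w2_nonneg: "0 \<le> w2 z" for z
    using w2_ge1[of z] by simp
  have w1_nonneg: "0 \<le> w1 z" if "z \<in> ball 0 1" for z
    using nonneg[OF that] by (simp add: w1_def)
  have ball_leb [measurable]: "ball (0 :: complex^'n) 1 \<in> sets lebesgue"
    by simp
  have s2: "set_borel_measurable lebesgue (ball 0 1) w2"
    unfolding set_borel_measurable_def by measurable
  have s1: "set_borel_measurable lebesgue (ball 0 1) w1"
  proof -
    have "(\<lambda>z. (indicator (ball 0 1) z *\<^sub>R w z) * w2 z powr (p - 1)) \<in> borel_measurable lebesgue"
      by measurable
    then show ?thesis
      by (simp add: set_borel_measurable_def w1_def mult.assoc)
  qed
  have "AE z in M. z \<in> ball 0 1 \<longrightarrow> max_alpha a w2 z \<le> C * ennreal (w2 z)"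
    using w2_nonneg AE2 m1 by (intro transfer[where g = \<eta>]) (auto elim!: eventually_mono)
  note W2 = B1_weightI[OF a s2 w2_nonneg C this[unfolded M_def]]
  have "AE z in M. z \<in> ball 0 1 \<longrightarrow> max_alpha a w1 z \<le> C * ennreal (w1 z)"
    using w1_nonneg AE2 m2 by (intro transfer[where g = "\<lambda>y. v y * epow (\<eta> y) (p - 1)"]) (auto elim!: eventually_mono)
  note W1 = B1_weightI[OF a s1 w1_nonneg C this[unfolded M_def]]
  have "w z = w1 z * w2 z powr (1 - p)" for z
    using w2_ge1[of z] by (simp add: w1_def mult.assoc powr_add[symmetric])
  then show ?thesis
    using W1 W2 by blast
qed

theorem mainTheorem19:
  fixes a p :: real and w :: "complex^'n \<Rightarrow> real"
  assumes "a > 0" and "1 < p"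
    and "weight w"
  shows "Bp a p w \<longleftrightarrow>
    (\<exists>w1 w2 :: complex^'n \<Rightarrow> real. weight w1 \<and> weight w2 \<and> B1 a w1 \<and> B1 a w2 \<and>
        (\<forall>z\<in>ball 0 1. w z = w1 z * w2 z powr (1 - p)))"
proof
  assume Bp: "Bp a p w"
  show "\<exists>w1 w2 :: complex^'n \<Rightarrow> real. weight w1 \<and> weight w2 \<and> B1 a w1 \<and> B1 a w2 \<and>
        (\<forall>z\<in>ball 0 1. w z = w1 z * w2 z powr (1 - p))"
  proof (cases "AE z in mu_alpha a. z \<in> ball 0 1 \<longrightarrow> w z = 0")
    case True
    show ?thesis
      using factorization_of_AE_zero[OF assms(1,3) True] assms(3) weight_one
      by (intro exI[of _ w] exI[of _ "\<lambda>_. 1"]) simp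
  next
    case False
    show ?thesis
      by (rule factorization_of_Bp[OF assms Bp Bp_AE_pos[OF assms Bp False]])
  qed
qed (use Bp_of_factorization[OF assms(1,2)] in blast)

end
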